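(* Let $f(x)=\sum_{k\ge0}f_kx^k$ and let $\widehat\Psi^{f(x)}_0=\widehat\Psi^{f(x)}_0(z,\mathbf p)=\Psi^{f(x)}_0(1,z,\mathbf p)$. Then $\widehat\Psi^{f(x)}_0$ is the unique solution to the partial differential equation $$z\,p_1+z\sum_{k\ge1}\frac{f_k}{k+1}\sum_{j=1}^k\binom{k+1}{j}\sum_{\ell\ge0}\ \sum_{\substack{a_1,\ldots,a_j\ge1\\ a_1+\cdots+a_j=\ell+1}}p_{a_1}\cdots p_{a_j}\,[u^\ell]\Big(\sum_{i\ge1}\big(p_i^\perp\widehat\Psi^{f(x)}_0\big)u^i\Big)^{k+1-j}=\sum_{i\ge1}p_i\,p_i^\perp\,\widehat\Psi^{f(x)}_0$$ that satisfies the initial condition $\widehat\Psi^{f(x)}_0(0,\mathbf p)=0$.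
   Context: $\mathbf p=(p_1,p_2,\ldots)$ are the power sum symmetric functions, $p_i^\perp=i\,\partial/\partial p_i$, $p_\alpha=p_{\alpha_1}p_{\alpha_2}\cdots$ for a partition $\alpha$, $l(\alpha)$ is the number of parts of $\alpha$, and $[u^\ell]$ denotes extraction of the coefficient of $u^\ell$. The Schur function is $s_\lambda(\mathbf p)=\sum_{\alpha\vdash n}\frac{|\mathcal C_\alpha|}{n!}\chi^\lambda_\alpha p_\alpha$ for $\lambda\vdash n$, where $\mathcal C_\alpha$ is the conjugacy class of cycle type $\alpha$ in the symmetric group $\mathcal S_n$ and $\chi^\lambda_\alpha$ is the value of the irreducible character $\chi^\lambda$ on $\mathcal C_\alpha$. The content of a cell $\Box$ in row $i$, column $j$ of the diagram of a partition is $c(\Box)=j-i$. For a formal power series $f(x)=\sum_{k\ge0}f_kx^k$, the content series is $$\Phi^{f(x)}(y,z,\mathbf p)=\sum_{n\ge0}\frac{z^n}{n!}\sum_{\lambda\vdash n}\chi^\lambda_{(1^n)}\,s_\lambda(\mathbf p)\prod_{\Box\in\lambda}f(y\,c(\Box)),$$ the product being over all cells of the diagram of $\lambda$. Its logarithm has an expansion $$\log\Phi^{f(x)}(y,z,\mathbf p)=\sum_{g\ge0}\Psi_g^{f(x)}(y,z,\mathbf p),\qquad \Psi_g^{f(x)}(y,z,\mathbf p)=\sum_{n\ge1}\frac{z^n}{n!}\sum_{\beta\vdash n}b(\beta,g)\,p_\beta\,y^{\,n+l(\beta)-2+2g},$$ for coefficients $b(\beta,g)$ that are polynomials in $f_0,f_1,\ldots$.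 Thus $\Psi_0^{f(x)}$ is the part of $\log\Phi^{f(x)}$ consisting of the monomials $z^{|\beta|}p_\beta y^{|\beta|+l(\beta)-2}$.
   Formalization: The first term z p_1 is corrected to f_0 z p_1 (as printed the equation fails unless f_0=1), and uniqueness is among series that also vanish at p=0, since otherwise any series in z alone with zero constant term could be added to a solution. *)

theory Defs
  imports
    "HOL-Library.Poly_Mapping"
    "HOL-Library.Multiset"
    "HOL-Combinatorics.Combinatorics"
    "HOL-Computational_Algebra.Formal_Power_Series"
begin

unbundle fps_syntax

subsection \<open>Partitions\<close>

definition partitions :: "nat \<Rightarrow> nat list set"
  where "partitions n = {\<mu>. sorted_wrt (\<ge>) \<mu> \<and> 0 \<notin> set \<mu> \<and> sum_list \<mu> = n}"

text \<open>Rows and columns are numbered from 0, which does not affect contents.\<close>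

definition cells :: "nat list \<Rightarrow> (nat \<times> nat) set"
  where "cells \<mu> = {(i, j). i < length \<mu> \<and> j < \<mu> ! i}"

definition content :: "nat \<times> nat \<Rightarrow> int"
  where "content = (\<lambda>(i, j). int j - int i)"


subsection \<open>Irreducible characters of the symmetric group\<close>

text \<open>
  \<open>\<S>\<^sub>n\<close> is the set of permutations of \<open>{..<n}\<close>. Its rational group algebra consists of the finitely
  supported functions on \<open>nat \<Rightarrow> nat\<close> with support in \<open>\<S>\<^sub>n\<close>. The library product on \<open>\<Rightarrow>\<^sub>0\<close> requires
  additive keys, so the convolution product along composition is defined here.
\<close>

definition Sym :: "nat \<Rightarrow> (nat \<Rightarrow> nat) set"
  where "Sym n = {\<sigma>. \<sigma> permutes {..<n}}"

type_synonym galg = "(nat \<Rightarrow> nat) \<Rightarrow>\<^sub>0 rat"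

definition group_algebra :: "nat \<Rightarrow> galg set"
  where "group_algebra n = {a. Poly_Mapping.keys a \<subseteq> Sym n}"

definition gmult :: "galg \<Rightarrow> galg \<Rightarrow> galg"  (infixl \<open>\<star>\<close> 70)
  where "a \<star> b = (\<Sum>\<sigma>\<in>Poly_Mapping.keys a. \<Sum>\<tau>\<in>Poly_Mapping.keys b.
    Poly_Mapping.single (\<sigma> \<circ> \<tau>) (Poly_Mapping.lookup a \<sigma> * Poly_Mapping.lookup b \<tau>))"

definition gscale :: "rat \<Rightarrow> galg \<Rightarrow> galg"
  where "gscale c = Poly_Mapping.map ((*) c)"

lemma lookup_gscale [simp]:
  "Poly_Mapping.lookup (gscale c a) \<sigma> = c * Poly_Mapping.lookup a \<sigma>"
  by (simp add: gscale_def Poly_Mapping.map.rep_eq when_def)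

interpretation galg: vector_space gscale
  by unfold_locales (auto intro!: poly_mapping_eqI simp: lookup_add algebra_simps)

text \<open>
  The trace of the restriction of \<open>T\<close> to a \<open>T\<close>-invariant finite-dimensional subspace \<open>V\<close>;
  it does not depend on the basis that is chosen.
\<close>

definition trace_on :: "galg set \<Rightarrow> (galg \<Rightarrow> galg) \<Rightarrow> rat"
  where "trace_on V T =
    (let B = (SOME B. galg.independent B \<and> galg.span B = V)
     in \<Sum>b\<in>B. galg.representation B (T b) b)"

text \<open>
  The entries of the canonical tableau of shape \<open>\<mu>\<close>, filled with \<open>0, 1, 2, \<dots>\<close> row by row, and the
  groups of permutations that preserve each of its rows, respectively each of its columns.
\<close>

definition entry :: "nat list \<Rightarrow> nat \<times> nat \<Rightarrow> nat"
  where "entry \<mu> = (\<lambda>(i, j). sum_list (take i \<mu>) + j)"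

definition row_group :: "nat list \<Rightarrow> (nat \<Rightarrow> nat) set"
  where "row_group \<mu> = {\<sigma> \<in> Sym (sum_list \<mu>).
    \<forall>(i, j)\<in>cells \<mu>. \<exists>j'. (i, j') \<in> cells \<mu> \<and> \<sigma> (entry \<mu> (i, j)) = entry \<mu> (i, j')}"

definition column_group :: "nat list \<Rightarrow> (nat \<Rightarrow> nat) set"
  where "column_group \<mu> = {\<sigma> \<in> Sym (sum_list \<mu>).
    \<forall>(i, j)\<in>cells \<mu>. \<exists>i'. (i', j) \<in> cells \<mu> \<and> \<sigma> (entry \<mu> (i, j)) = entry \<mu> (i', j)}"

definition young_symmetrizer :: "nat list \<Rightarrow> galg"
  where "young_symmetrizer \<mu> =
    (\<Sum>\<sigma>\<in>row_group \<mu>. Poly_Mapping.single \<sigma> 1) \<star>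
    (\<Sum>\<sigma>\<in>column_group \<mu>. Poly_Mapping.single \<sigma> (of_int (sign \<sigma>)))"

text \<open>
  The irreducible module indexed by \<open>\<mu>\<close>: the left ideal generated by the Young symmetrizer
  (the Specht module, up to isomorphism). With this labelling \<open>\<mu> = (n)\<close> is the trivial module and
  \<open>\<mu> = (1\<^sup>n)\<close> the sign module. It is absolutely irreducible, so the character over the complex numbers
  is the same.
\<close>

definition irrep :: "nat list \<Rightarrow> galg set"
  where "irrep \<mu> = {a \<star> young_symmetrizer \<mu> |a. a \<in> group_algebra (sum_list \<mu>)}"

definition irr_char :: "nat list \<Rightarrow> (nat \<Rightarrow> nat) \<Rightarrow> rat"
  where "irr_char \<mu> \<sigma> = trace_on (irrep \<mu>) (\<lambda>v. Poly_Mapping.single \<sigma> 1 \<star> v)"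

definition cycle_type :: "nat \<Rightarrow> (nat \<Rightarrow> nat) \<Rightarrow> nat list"
  where "cycle_type n \<sigma> =
    rev (sorted_list_of_multiset (image_mset card (mset_set (orbit \<sigma> ` {..<n}))))"

definition conj_class :: "nat list \<Rightarrow> (nat \<Rightarrow> nat) set"
  where "conj_class \<alpha> = {\<sigma> \<in> Sym (sum_list \<alpha>). cycle_type (sum_list \<alpha>) \<sigma> = \<alpha>}"

definition char_value :: "nat list \<Rightarrow> nat list \<Rightarrow> rat"
  where "char_value \<mu> \<alpha> = irr_char \<mu> (SOME \<sigma>. \<sigma> \<in> conj_class \<alpha>)"


subsection \<open>Polynomials in the power sums\<close>

text \<open>
  Polynomials in \<open>p\<^sub>1, p\<^sub>2, \<dots>\<close>; exponents are finitely supported, and the variable \<open>p\<^sub>i\<close>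
  (\<open>i \<ge> 1\<close>) has index \<open>i - 1\<close>, so that there is no spurious variable \<open>p\<^sub>0\<close>.
\<close>

type_synonym 'a ppoly = "(nat \<Rightarrow>\<^sub>0 nat) \<Rightarrow>\<^sub>0 'a"

definition pconst :: "'a::zero \<Rightarrow> 'a ppoly"
  where "pconst c = Poly_Mapping.single 0 c"

definition pvar :: "nat \<Rightarrow> 'a::zero_neq_one ppoly"
  where "pvar i = Poly_Mapping.single (Poly_Mapping.single (i - 1) 1) 1"

definition pprod :: "nat list \<Rightarrow> 'a::comm_semiring_1 ppoly"
  where "pprod \<alpha> = prod_list (map pvar \<alpha>)"

definition pexp :: "nat list \<Rightarrow> (nat \<Rightarrow>\<^sub>0 nat)"
  where "pexp \<alpha> = sum_list (map (\<lambda>i. Poly_Mapping.single (i - 1) 1) \<alpha>)"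

definition pcoeff :: "'a::zero ppoly \<Rightarrow> nat list \<Rightarrow> 'a"
  where "pcoeff P \<alpha> = Poly_Mapping.lookup P (pexp \<alpha>)"

definition perp :: "nat \<Rightarrow> 'a::comm_semiring_1 ppoly \<Rightarrow> 'a ppoly"
  where "perp i P = (\<Sum>m\<in>Poly_Mapping.keys P.
    Poly_Mapping.single (m - Poly_Mapping.single (i - 1) 1)
      (of_nat i * of_nat (Poly_Mapping.lookup m (i - 1)) * Poly_Mapping.lookup P m))"

definition schur :: "nat list \<Rightarrow> rat ppoly"
  where "schur \<mu> = (\<Sum>\<alpha>\<in>partitions (sum_list \<mu>).
    pconst (of_nat (card (conj_class \<alpha>)) / fact (sum_list \<mu>) * char_value \<mu> \<alpha>) * pprod \<alpha>)"


subsection \<open>The content series and the genus zero part of its logarithm\<close>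

text \<open>
  \<open>\<Phi>\<close> is a power series in \<open>z\<close> whose coefficients are polynomials in \<open>p\<^sub>1, p\<^sub>2, \<dots>\<close> over the
  power series in \<open>y\<close>.
\<close>

definition content_series :: "'a::field_char_0 fps \<Rightarrow> 'a fps ppoly fps"
  where "content_series f = Abs_fps (\<lambda>n. \<Sum>\<mu>\<in>partitions n.
    pconst (fps_const (of_rat (char_value \<mu> (replicate n 1) / fact n)) *
            (\<Prod>c\<in>cells \<mu>. f oo (fps_const (of_int (content c)) * fps_X))) *
    Poly_Mapping.map (\<lambda>q. fps_const (of_rat q)) (schur \<mu>))"

text \<open>The logarithm of a series in \<open>z\<close> with constant term 1; \<open>fps_ln 1\<close> is the series of \<open>ln (1 + x)\<close>.\<close>

definition log_series :: "'a::field_char_0 fps ppoly fps \<Rightarrow> 'a fps ppoly fps"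
  where "log_series F = Abs_fps (\<lambda>k. pconst (fps_const (fps_ln 1 $ k))) oo (F - 1)"

definition Psi :: "nat \<Rightarrow> 'a::field_char_0 fps \<Rightarrow> 'a fps ppoly fps"
  where "Psi g f = Abs_fps (\<lambda>n. if n = 0 then 0 else
    \<Sum>\<beta>\<in>partitions n. let e = n + length \<beta> - 2 + 2 * g in
      pconst (fps_const (pcoeff (log_series (content_series f) $ n) \<beta> $ e) * fps_X ^ e) * pprod \<beta>)"

text \<open>Evaluation of a power series with finitely many nonzero terms.\<close>

definition fps_eval :: "'a::comm_semiring_1 fps \<Rightarrow> 'a \<Rightarrow> 'a"
  where "fps_eval c a = (\<Sum>d | c $ d \<noteq> 0. c $ d * a ^ d)"

definition Psi0_hat :: "'a::field_char_0 fps \<Rightarrow> 'a ppoly fps"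
  where "Psi0_hat f = Abs_fps (\<lambda>n. Poly_Mapping.map (\<lambda>c. fps_eval c 1) (Psi 0 f $ n))"


subsection \<open>The differential equation\<close>

definition zperp :: "nat \<Rightarrow> 'a::comm_semiring_1 ppoly fps \<Rightarrow> 'a ppoly fps"
  where "zperp i G = Abs_fps (\<lambda>n. perp i (G $ n))"

text \<open>\<open>\<Sum>\<^sub>i\<^sub>\<ge>\<^sub>1 (p\<^sub>i\<^sup>\<bottom> G) u\<^sup>i\<close> as a power series in \<open>u\<close>.\<close>

definition perp_series :: "'a::comm_semiring_1 ppoly fps \<Rightarrow> 'a ppoly fps fps"
  where "perp_series G = Abs_fps (\<lambda>i. if i = 0 then 0 else zperp i G)"

definition compositions :: "nat \<Rightarrow> nat \<Rightarrow> nat list set"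
  where "compositions n j = {a. length a = j \<and> 0 \<notin> set a \<and> sum_list a = n}"

text \<open>
  The infinite sums converge in the topology of formal power series in \<open>z\<close> (each coefficient is
  eventually constant) whenever \<open>G\<close> has zero constant term in \<open>z\<close>; the index \<open>k\<close> is shifted by
  one in the sum over \<open>k \<ge> 1\<close>, and \<open>i\<close> in the sum over \<open>i \<ge> 1\<close>.

  The coefficient of \<open>z p\<^sub>1\<close> is \<open>f\<^sub>0\<close>, because the content series begins
  \<open>1 + f\<^sub>0 z p\<^sub>1 + \<dots>\<close>. Written with a bare \<open>z p\<^sub>1\<close>, the equation holds exactly when \<open>f\<^sub>0 = 1\<close>.
\<close>

definition pde_lhs :: "'a::field_char_0 fps \<Rightarrow> 'a ppoly fps \<Rightarrow> 'a ppoly fps"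
  where "pde_lhs f G =
    fps_X * fps_const (pconst (f $ 0) * pvar 1) +
    fps_X * suminf (\<lambda>k'. let k = Suc k' in
      fps_const (pconst (f $ k / of_nat (k + 1))) *
      (\<Sum>j = 1..k. of_nat ((k + 1) choose j) *
        suminf (\<lambda>l. \<Sum>a\<in>compositions (l + 1) j.
          fps_const (pprod a) * ((perp_series G ^ (k + 1 - j)) $ l))))"

definition pde_rhs :: "'a::field_char_0 ppoly fps \<Rightarrow> 'a ppoly fps"
  where "pde_rhs G = suminf (\<lambda>i'. let i = Suc i' in fps_const (pvar i) * zperp i G)"

text \<open>
  The series \<open>G(z, 0)\<close>. The operators \<open>p\<^sub>i\<^sup>\<bottom>\<close> annihilate series in \<open>z\<close> alone, so the equation
  determines its solutions only up to such series; the solutions sought have, like \<open>log \<Phi>\<close>, only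
  terms \<open>z\<^sup>n p\<^sub>\<beta>\<close> with \<open>\<beta>\<close> nonempty.
\<close>

definition at_p_zero :: "'a::zero ppoly fps \<Rightarrow> 'a fps"
  where "at_p_zero G = Abs_fps (\<lambda>n. pcoeff (G $ n) [])"

end

theory Submission
  imports Defs
begin

text \<open>
  Let \<open>\<Phi>\<close> be the content series, and let \<open>J\<^sub>k = \<Sum>\<^sub>l\<^sub><\<^sub>k (l k)\<close> be the Jucys--Murphy elements of the group ring of the
  permutations of \<open>{0, 1, 2, \<dots>}\<close>.

  A Young symmetrizer is an eigenvector of \<open>J\<^sub>k\<close>, and the eigenvalue is the content of the cell that the
  canonical tableau fills with \<open>k\<close> (\<open>JM_young\<close>). The product \<open>f(y J\<^sub>0) \<cdots> f(y J\<^sub>n\<^sub>-\<^sub>1)\<close> is central in the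
  group ring of the permutations of \<open>n\<close> points (\<open>JM_product_central\<close>), so it acts on the central idempotent of \<open>\<mu>\<close> as the content product of \<open>\<mu>\<close>. These
  idempotents add up to 1 (\<open>completeness\<close>), and up to a factor their coefficients are the irreducible
  characters (\<open>irr_char_eq\<close>). Hence \<open>n! [z\<^sup>n] \<Phi>\<close> is the sum, over the permutations \<open>\<sigma>\<close> of \<open>n\<close> points, of the
  coefficient of \<open>\<sigma>\<close> in that product times \<open>p\<^sub>\<alpha>\<close>, where \<open>\<alpha>\<close> is the cycle type of \<open>\<sigma>\<close>
  (\<open>content_series_nth\<close>).

  Passing from \<open>n\<close> to \<open>n + 1\<close> points multiplies the product by \<open>f(y J\<^sub>n)\<close>. Mark the cycle that contains the
  new point \<open>n\<close>, and record its length \<open>a\<close> separately. A factor \<open>(l n)\<close> of \<open>J\<^sub>n\<close> cuts the marked cycle, and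
  the part of length \<open>i\<close> that is split off contributes \<open>p\<^sub>i\<close>; or it joins another cycle of length \<open>i\<close> to the
  marked one, and the sum over all these joins is \<open>p\<^sub>i\<^sup>\<bottom>\<close>. If \<open>T\<close> is this cut-and-join operator on sequences
  indexed by \<open>a\<close>, then
  \<open>\<partial>\<Phi>/\<partial>z = \<Sum>\<^sub>k f\<^sub>k y\<^sup>k \<Sum>\<^sub>a p\<^sub>a (T\<^sup>k (\<Phi>, 0, 0, \<dots>))\<^sub>a\<close> (\<open>content_series_recurrence\<close>). Dividing by \<open>\<Phi>\<close> replaces the
  left side by \<open>\<partial>L/\<partial>z\<close> with \<open>L = log \<Phi>\<close>, the sequence \<open>(\<Phi>, 0, 0, \<dots>)\<close> by \<open>(1, 0, 0, \<dots>)\<close>, and the operator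
  \<open>p\<^sub>i\<^sup>\<bottom>\<close> in \<open>T\<close> by \<open>p\<^sub>i\<^sup>\<bottom> + (p\<^sub>i\<^sup>\<bottom> L)\<close> (\<open>log_content_equation\<close>).

  Now measure a monomial \<open>z\<^sup>n p\<^sub>\<beta> y\<^sup>e\<close> by \<open>e - n - l(\<beta>)\<close>. By induction on \<open>n\<close>, all monomials of \<open>L\<close> have measure
  at least \<open>-2\<close>, and those of measure \<open>-2\<close> make up the genus zero part. The term \<open>p\<^sub>i\<^sup>\<bottom>\<close> of the operator
  raises the measure by 1, while multiplication by \<open>p\<^sub>i\<close> and by \<open>p\<^sub>i\<^sup>\<bottom> L\<close> lowers it by at most 1; so only the
  two multiplications survive in lowest order (\<open>genus_zero_leading\<close>). What remains is the weighted count of lattice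
  paths that start at height 0, go down \<open>i\<close> with weight \<open>p\<^sub>i\<close> and up \<open>i\<close> with weight \<open>p\<^sub>i\<^sup>\<bottom> \<Psi>\<close>, and reach a
  negative height, namely \<open>-1\<close>, only after the last of their \<open>k + 1\<close> steps. By the cycle lemma exactly one
  of the \<open>k + 1\<close> rotations of a sequence of steps with sum \<open>-1\<close> is such a path, so the count is \<open>1 / (k + 1)\<close> times the coefficient of
  \<open>u\<^sup>-\<^sup>1\<close> in \<open>(\<Sum>\<^sub>i p\<^sub>i u\<^sup>-\<^sup>i + \<Sum>\<^sub>i (p\<^sub>i\<^sup>\<bottom> \<Psi>) u\<^sup>i)\<^sup>k\<^sup>+\<^sup>1\<close> (\<open>unmark_cut_join_lead_power\<close>). Expanding this power by the
  binomial theorem, with \<open>j\<close> down steps, gives the left side of the differential equation divided by \<open>z\<close>. The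
  right side is \<open>z \<partial>\<Psi>/\<partial>z\<close>, because \<open>\<Sum>\<^sub>i p\<^sub>i p\<^sub>i\<^sup>\<bottom>\<close> multiplies \<open>p\<^sub>\<beta>\<close> by \<open>|\<beta>|\<close> and every monomial
  \<open>z\<^sup>n p\<^sub>\<beta>\<close> of \<open>\<Psi>\<close> has \<open>|\<beta>| = n\<close>.

  The solution is unique because the coefficient of \<open>z\<^sup>n\<^sup>+\<^sup>1\<close> on the left side depends only on the solution
  up to \<open>z\<^sup>n\<close>, and on the right side it determines all coefficients of \<open>z\<^sup>n\<^sup>+\<^sup>1 p\<^sub>\<beta>\<close> with \<open>|\<beta>| > 0\<close>.
\<close>

abbreviation lookup :: "('a \<Rightarrow>\<^sub>0 'b) \<Rightarrow> 'a \<Rightarrow> 'b::zero"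
  where "lookup \<equiv> Poly_Mapping.lookup"

abbreviation single :: "'a \<Rightarrow> 'b \<Rightarrow> 'a \<Rightarrow>\<^sub>0 'b::zero"
  where "single \<equiv> Poly_Mapping.single"

abbreviation keys :: "('a \<Rightarrow>\<^sub>0 'b::zero) \<Rightarrow> 'a set"
  where "keys \<equiv> Poly_Mapping.keys"

section \<open>The group ring of the finitary symmetric group\<close>

text \<open>
  The product of finitely supported functions is the convolution over the addition of the arguments. Writing
  the composition of permutations additively therefore makes \<open>fperm \<Rightarrow>\<^sub>0 'r\<close> the group ring over \<open>'r\<close> of the
  finitary symmetric group.
\<close>

typedef fperm = "{\<sigma> :: nat \<Rightarrow> nat. permutation \<sigma>}"
  morphisms fun_of mk_perm
  by (rule exI[of _ id]) (simp add: permutation_id)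

lemma permutation_fun_of [simp]: "permutation (fun_of g)"
  using fun_of by simp

lemma bij_fun_of [simp]: "bij (fun_of g)"
  by (simp add: permutation_bijective)

lemma fun_of_mk_perm [simp]: "permutation \<sigma> \<Longrightarrow> fun_of (mk_perm \<sigma>) = \<sigma>"
  by (simp add: mk_perm_inverse)

instantiation fperm :: group_add
begin

definition "0 = mk_perm id"
definition "g + h = mk_perm (fun_of g \<circ> fun_of h)"
definition "- g = mk_perm (inv (fun_of g))"
definition "(g :: fperm) - h = g + - h"

lemma fun_of_zero_aux: "fun_of 0 = id"
  by (simp add: zero_fperm_def permutation_id)

lemma fun_of_plus_aux: "fun_of (g + h) = fun_of g \<circ> fun_of h"
  by (simp add: plus_fperm_def permutation_compose)

lemma fun_of_uminus_aux: "fun_of (- g) = inv (fun_of g)"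
  by (simp add: uminus_fperm_def permutation_inverse)

instance
proof
  fix a b c :: fperm
  show "a + b + c = a + (b + c)" "0 + a = a" "a + 0 = a" "- a + a = 0" "a + - b = a - b"
    by (simp_all add: fun_of_inject[symmetric] fun_of_plus_aux fun_of_zero_aux fun_of_uminus_aux
          comp_assoc minus_fperm_def inv_o_cancel bij_is_inj)
qed

end

lemmas fun_of_zero [simp] = fun_of_zero_aux
lemmas fun_of_plus [simp] = fun_of_plus_aux
lemmas fun_of_uminus [simp] = fun_of_uminus_aux

text \<open>
  All symmetric groups live in one type, the smaller ones fixing more points, so that Jucys--Murphy elements
  of different levels can be multiplied.
\<close>

definition SymP :: "nat \<Rightarrow> fperm set"
  where "SymP n = {g. fun_of g permutes {..<n}}"

lemma fun_of_SymP: "fun_of ` SymP n = Sym n"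
proof
  show "Sym n \<subseteq> fun_of ` SymP n"
  proof
    fix \<sigma> assume "\<sigma> \<in> Sym n"
    then have "\<sigma> permutes {..<n}" "permutation \<sigma>"
      by (auto simp: Sym_def permutation_permutes)
    then show "\<sigma> \<in> fun_of ` SymP n"
      by (intro image_eqI[of _ _ "mk_perm \<sigma>"]) (auto simp: SymP_def)
  qed
qed (auto simp: SymP_def Sym_def)

lemma inj_fun_of: "inj fun_of"
  by (auto intro: injI simp: fun_of_inject)

lemma finite_Sym: "finite (Sym n)"
  by (simp add: Sym_def finite_permutations)

lemma finite_SymP [simp]: "finite (SymP n)"
  using finite_Sym fun_of_SymP finite_image_iff inj_fun_of by (metis inj_on_subset subset_UNIV)

lemma card_SymP: "card (SymP n) = fact n"
proof -
  have "card (SymP n) = card (Sym n)"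
    unfolding fun_of_SymP[symmetric] by (rule card_image[symmetric]) (rule inj_on_subset[OF inj_fun_of], simp)
  then show ?thesis by (simp add: Sym_def card_permutations)
qed

lemma SymP_zero [simp]: "0 \<in> SymP n"
  by (simp add: SymP_def permutes_id)

lemma SymP_plus [intro]: "g \<in> SymP n \<Longrightarrow> h \<in> SymP n \<Longrightarrow> g + h \<in> SymP n"
  by (simp add: SymP_def permutes_compose)

lemma SymP_uminus [intro]: "g \<in> SymP n \<Longrightarrow> - g \<in> SymP n"
  by (simp add: SymP_def permutes_inv)

lemma SymP_diff [intro]: "g \<in> SymP n \<Longrightarrow> h \<in> SymP n \<Longrightarrow> g - h \<in> SymP n"
  using SymP_plus[of g n "- h"] SymP_uminus[of h n] by simp

lemma SymP_uminus_iff [simp]: "- g \<in> SymP n \<longleftrightarrow> g \<in> SymP n"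
  using SymP_uminus[of g] SymP_uminus[of "-g"] by auto

lemma SymP_mono: "m \<le> n \<Longrightarrow> SymP m \<subseteq> SymP n"
  by (auto simp: SymP_def intro: permutes_subset)

lemma SymP_less: "g \<in> SymP n \<Longrightarrow> fun_of g x < n \<longleftrightarrow> x < n"
  by (metis SymP_def lessThan_iff mem_Collect_eq permutes_in_image)

lemma SymP_fix: "g \<in> SymP n \<Longrightarrow> \<not> x < n \<Longrightarrow> fun_of g x = x"
  by (simp add: SymP_def permutes_not_in)

lemma fun_of_inj [simp]: "fun_of g x = fun_of g y \<longleftrightarrow> x = y"
  by (meson bij_fun_of bij_is_inj inj_eq)

lemma fun_of_inv [simp]: "fun_of g (inv (fun_of g) x) = x" "inv (fun_of g) (fun_of g x) = x"
  by (simp_all add: bij_is_surj surj_f_inv_f bij_is_inj inv_f_f)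

lemma bij_SymP_plus: "h \<in> SymP n \<Longrightarrow> bij_betw ((+) h) (SymP n) (SymP n)"
  by (rule bij_betwI[of _ _ _ "(+) (- h)"]) (auto simp flip: add.assoc)

lemma bij_SymP_plus_right: "h \<in> SymP n \<Longrightarrow> bij_betw (\<lambda>g. g + h) (SymP n) (SymP n)"
  by (rule bij_betwI[of _ _ _ "\<lambda>g. g + (- h)"]) (auto simp: add.assoc)

lemma bij_SymP_uminus: "bij_betw uminus (SymP n) (SymP n)"
  by (rule bij_betwI[of _ _ _ uminus]) auto

definition transp :: "nat \<Rightarrow> nat \<Rightarrow> fperm"
  where "transp l k = mk_perm (Transposition.transpose l k)"

lemma fun_of_transp [simp]: "fun_of (transp l k) = Transposition.transpose l k"
  by (simp add: transp_def permutation_swap_id)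

lemma transp_self [simp]: "transp k k = 0"
  by (simp add: fun_of_inject[symmetric])

lemma transp_plus_self [simp]: "transp l k + transp l k = 0"
  by (simp add: fun_of_inject[symmetric] fun_eq_iff)

lemma transp_plus_self_left [simp]: "transp l k + (transp l k + g) = g"
  by (simp flip: add.assoc)

lemma uminus_transp [simp]: "- transp l k = transp l k"
  using transp_plus_self by (metis minus_unique)

lemma transp_SymP [intro]: "l < n \<Longrightarrow> k < n \<Longrightarrow> transp l k \<in> SymP n"
  by (simp add: SymP_def permutes_swap_id)

lemma transp_conj: "g + transp l k = transp (fun_of g l) (fun_of g k) + g"
  by (auto simp: fun_of_inject[symmetric] fun_eq_iff Transposition.transpose_def)

subsection \<open>Finitely supported functions as sums of monomials\<close>

lemma sum_single_superset:
  assumes "finite A" "keys x \<subseteq> A"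
  shows "(\<Sum>k\<in>A. single k (lookup x k)) = x"
proof (rule poly_mapping_eqI)
  fix k
  show "lookup (\<Sum>k\<in>A. single k (lookup x k)) k = lookup x k"
    using assms by (auto simp: lookup_sum lookup_single when_def in_keys_iff sum.If_cases subset_iff)
qed

lemma sum_single_keys: "(\<Sum>k\<in>keys x. single k (lookup x k)) = x"
  by (rule sum_single_superset) auto

lemma lookup_mult_single_left:
  fixes g :: "'g :: group_add" and x :: "'g \<Rightarrow>\<^sub>0 'r :: semiring_0"
  shows "lookup (single g a * x) h = a * lookup x (- g + h)"
proof -
  have "lookup (single g a * x) h =
     (\<Sum>k\<in>keys x. lookup (single (g + k) (a * lookup x k)) h)"
    by (subst sum_single_keys[of x, symmetric]) (simp add: sum_distrib_left lookup_sum mult_single)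
  also have "\<dots> = (\<Sum>k\<in>keys x. if k = - g + h then a * lookup x k else 0)"
    by (intro sum.cong refl) (auto simp: lookup_single when_def add.assoc[symmetric])
  also have "\<dots> = a * lookup x (- g + h)"
    by (auto simp: sum.If_cases in_keys_iff)
  finally show ?thesis .
qed

lemma lookup_mult_single_right:
  fixes g :: "'g :: group_add" and x :: "'g \<Rightarrow>\<^sub>0 'r :: semiring_0"
  shows "lookup (x * single g a) h = lookup x (h - g) * a"
proof -
  have "lookup (x * single g a) h =
     (\<Sum>k\<in>keys x. lookup (single (k + g) (lookup x k * a)) h)"
    by (subst sum_single_keys[of x, symmetric]) (simp add: sum_distrib_right lookup_sum mult_single)
  also have "\<dots> = (\<Sum>k\<in>keys x. if k = h - g then lookup x k * a else 0)"
    by (intro sum.cong refl) (auto simp: lookup_single when_def algebra_simps)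
  also have "\<dots> = lookup x (h - g) * a"
    by (auto simp: sum.If_cases in_keys_iff)
  finally show ?thesis .
qed

lemma lookup_group_mult:
  fixes x y :: "'g :: group_add \<Rightarrow>\<^sub>0 'r :: semiring_0"
  assumes "finite A" "keys x \<subseteq> A"
  shows "lookup (x * y) g = (\<Sum>h\<in>A. lookup x h * lookup y (- h + g))"
  by (subst sum_single_superset[OF assms, symmetric])
     (simp add: sum_distrib_right lookup_sum lookup_mult_single_left)

lemma lookup_const_mult [simp]:
  fixes x :: "'g :: group_add \<Rightarrow>\<^sub>0 'r :: semiring_0"
  shows "lookup (single 0 a * x) h = a * lookup x h"
  by (simp add: lookup_mult_single_left)

lemma const_mult_commute:
  fixes x :: "'g :: group_add \<Rightarrow>\<^sub>0 'r :: comm_semiring_0"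
  shows "x * single 0 a = single 0 a * x"
  by (rule poly_mapping_eqI) (simp add: lookup_mult_single_right mult.commute)

text \<open>
  The coefficient of the identity is a trace.
\<close>

lemma lookup_zero_mult_commute:
  fixes x y :: "'g :: group_add \<Rightarrow>\<^sub>0 'r :: comm_semiring_0"
  shows "lookup (x * y) 0 = lookup (y * x) 0"
proof -
  define A where "A = keys x \<union> uminus ` keys y"
  have A: "finite A" "keys x \<subseteq> A" "keys y \<subseteq> uminus ` A"
    by (auto simp: A_def image_Un image_image)
  have "lookup (x * y) 0 = (\<Sum>h\<in>A. lookup x h * lookup y (- h))"
    using lookup_group_mult[OF A(1,2), of y 0] by simp
  also have "\<dots> = (\<Sum>h\<in>uminus ` A. lookup y h * lookup x (- h))"
    by (subst sum.reindex) (auto simp: inj_on_def mult.commute)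
  also have "\<dots> = lookup (y * x) 0"
    using lookup_group_mult[OF _ A(3), of x 0] A(1) by simp
  finally show ?thesis .
qed

abbreviation elt :: "fperm \<Rightarrow> fperm \<Rightarrow>\<^sub>0 'r :: semiring_1"
  where "elt g \<equiv> single g 1"

lemma elt_mult_left: "elt g * (elt h * x) = (elt (g + h) * x :: fperm \<Rightarrow>\<^sub>0 'r :: semiring_1)"
  by (simp add: mult_single flip: mult.assoc)

definition group_ring :: "nat \<Rightarrow> (fperm \<Rightarrow>\<^sub>0 'r :: zero) set"
  where "group_ring n = {x. keys x \<subseteq> SymP n}"

lemma group_ring_iff: "x \<in> group_ring n \<longleftrightarrow> (\<forall>g. g \<notin> SymP n \<longrightarrow> lookup x g = 0)"
  by (auto simp: group_ring_def in_keys_iff subset_iff)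

lemma group_ring_single [intro]: "g \<in> SymP n \<Longrightarrow> single g a \<in> group_ring n"
  by (auto simp: group_ring_def)

lemma group_ring_zero [simp]: "0 \<in> group_ring n"
  by (simp add: group_ring_def)

lemma group_ring_one [simp]: "(1 :: fperm \<Rightarrow>\<^sub>0 'r :: zero_neq_one) \<in> group_ring n"
  by (simp add: group_ring_def)

lemma group_ring_add [intro]: "x \<in> group_ring n \<Longrightarrow> y \<in> group_ring n \<Longrightarrow> x + y \<in> group_ring n"
  by (auto simp: group_ring_iff lookup_add)

lemma group_ring_sum [intro]: "(\<And>i. i \<in> A \<Longrightarrow> f i \<in> group_ring n) \<Longrightarrow> sum f A \<in> group_ring n"
  by (auto simp: group_ring_iff lookup_sum intro!: sum.neutral)

lemma group_ring_mult [intro]: "x \<in> group_ring n \<Longrightarrow> y \<in> group_ring n \<Longrightarrow> (x * y :: fperm \<Rightarrow>\<^sub>0 'r :: semiring_0) \<in> group_ring n"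
  using keys_mult[of x y] by (fastforce simp: group_ring_def)

lemma group_ring_power [intro]: "x \<in> group_ring n \<Longrightarrow> (x ^ k :: fperm \<Rightarrow>\<^sub>0 'r :: {semiring_1, zero_neq_one}) \<in> group_ring n"
  by (induction k) auto

lemma group_ring_mono: "m \<le> n \<Longrightarrow> x \<in> group_ring m \<Longrightarrow> x \<in> group_ring n"
  using SymP_mono by (fastforce simp: group_ring_def)

lemma group_ring_expand: "x \<in> group_ring n \<Longrightarrow> (\<Sum>g\<in>SymP n. single g (lookup x g)) = x"
  by (rule sum_single_superset) (auto simp: group_ring_def)

(* These rules would turn the scalars single 0 (of_int k) into of_int k, to which the lemmas about
   scalars in the group ring do not apply. *)
declare single_of_int [simp del] single_of_nat [simp del]

section \<open>Rows and columns of the canonical tableau\<close>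

text \<open>
  The canonical tableau is used through the row and the column of each entry; the default value of
  \<open>inv_into\<close> is taken only by numbers that are not entries.
\<close>

definition rowf :: "nat list \<Rightarrow> nat \<Rightarrow> nat"
  where "rowf \<mu> x = fst (inv_into (cells \<mu>) (entry \<mu>) x)"

definition colf :: "nat list \<Rightarrow> nat \<Rightarrow> nat"
  where "colf \<mu> x = snd (inv_into (cells \<mu>) (entry \<mu>) x)"

lemma sum_take_mono: "i \<le> j \<Longrightarrow> sum_list (take i (\<mu> :: nat list)) \<le> sum_list (take j \<mu>)"
proof -
  assume "i \<le> j"
  then have "take j \<mu> = take i \<mu> @ take (j - i) (drop i \<mu>)"
    by (metis le_add_diff_inverse take_add)
  then show ?thesis by simp
qed

lemma sum_take_le: "sum_list (take i (\<mu> :: nat list)) \<le> sum_list \<mu>"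
  using sum_take_mono[of i "max i (length \<mu>)" \<mu>] by simp

lemma sum_take_Suc: "i < length \<mu> \<Longrightarrow> sum_list (take (Suc i) \<mu>) = sum_list (take i \<mu>) + (\<mu> ! i :: nat)"
  by (simp add: take_Suc_conv_app_nth)

lemma entry_bounds:
  assumes "(i, j) \<in> cells \<mu>"
  shows "sum_list (take i \<mu>) \<le> entry \<mu> (i, j)" "entry \<mu> (i, j) < sum_list (take (Suc i) \<mu>)"
  using assms by (auto simp: cells_def entry_def sum_take_Suc)

lemma entry_less: "c \<in> cells \<mu> \<Longrightarrow> entry \<mu> c < sum_list \<mu>"
  using entry_bounds(2)[of "fst c" "snd c" \<mu>] sum_take_le[of "Suc (fst c)" \<mu>] by force

lemma entry_less_row:
  assumes "(i, j) \<in> cells \<mu>" "(i', j') \<in> cells \<mu>" "i < i'"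
  shows "entry \<mu> (i, j) < entry \<mu> (i', j')"
  using entry_bounds(2)[OF assms(1)] entry_bounds(1)[OF assms(2)] sum_take_mono[of "Suc i" i' \<mu>] assms(3)
  by linarith

lemma inj_on_entry: "inj_on (entry \<mu>) (cells \<mu>)"
proof (rule inj_onI, clarify)
  fix i j i' j' assume *: "(i, j) \<in> cells \<mu>" "(i', j') \<in> cells \<mu>" "entry \<mu> (i, j) = entry \<mu> (i', j')"
  then have "i = i'"
    using entry_less_row[OF *(1,2)] entry_less_row[OF *(2,1)] by (metis less_irrefl nat_neq_iff)
  then show "i = i' \<and> j = j'" using * by (simp add: entry_def)
qed

lemma entry_surj: "x < sum_list \<mu> \<Longrightarrow> \<exists>c\<in>cells \<mu>. entry \<mu> c = x"
proof (induction \<mu> arbitrary: x)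
  case (Cons m \<mu>)
  show ?case
  proof (cases "x < m")
    case True
    then show ?thesis by (intro bexI[of _ "(0, x)"]) (auto simp: entry_def cells_def)
  next
    case False
    with Cons.prems have "x - m < sum_list \<mu>" by simp
    then obtain i j where c: "(i, j) \<in> cells \<mu>" "entry \<mu> (i, j) = x - m" using Cons.IH by force
    then show ?thesis using False by (intro bexI[of _ "(Suc i, j)"]) (auto simp: entry_def cells_def)
  qed
qed simp

lemma bij_betw_entry: "bij_betw (entry \<mu>) (cells \<mu>) {..<sum_list \<mu>}"
  using inj_on_entry entry_surj entry_less by (fastforce simp: bij_betw_def)

lemma rowf_entry [simp]: "(i, j) \<in> cells \<mu> \<Longrightarrow> rowf \<mu> (entry \<mu> (i, j)) = i"
  and colf_entry [simp]: "(i, j) \<in> cells \<mu> \<Longrightarrow> colf \<mu> (entry \<mu> (i, j)) = j"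
  by (simp_all add: rowf_def colf_def inv_into_f_f[OF inj_on_entry])

lemma
  assumes "x < sum_list \<mu>"
  shows pos_in_cells: "(rowf \<mu> x, colf \<mu> x) \<in> cells \<mu>"
    and entry_pos: "entry \<mu> (rowf \<mu> x, colf \<mu> x) = x"
proof -
  obtain i j where "(i, j) \<in> cells \<mu>" "x = entry \<mu> (i, j)" using entry_surj[OF assms] by force
  then show "(rowf \<mu> x, colf \<mu> x) \<in> cells \<mu>" "entry \<mu> (rowf \<mu> x, colf \<mu> x) = x" by simp_all
qed

lemma pos_eqI:
  assumes "x < sum_list \<mu>" "y < sum_list \<mu>" "rowf \<mu> x = rowf \<mu> y" "colf \<mu> x = colf \<mu> y"
  shows "x = y"
  using entry_pos[OF assms(1)] entry_pos[OF assms(2)] assms(3,4) by metis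

lemma rowf_less_iff:
  assumes "x < sum_list \<mu>"
  shows "rowf \<mu> x < r \<longleftrightarrow> x < sum_list (take r \<mu>)"
proof -
  have "sum_list (take (rowf \<mu> x) \<mu>) \<le> x" "x < sum_list (take (Suc (rowf \<mu> x)) \<mu>)"
    using entry_bounds[OF pos_in_cells[OF assms]] unfolding entry_pos[OF assms] by blast+
  then show ?thesis
    using sum_take_mono[of "Suc (rowf \<mu> x)" r \<mu>] sum_take_mono[of r "rowf \<mu> x" \<mu>]
    by (cases "rowf \<mu> x < r") auto
qed

lemma colf_le: "x < sum_list \<mu> \<Longrightarrow> colf \<mu> x \<le> x"
  using entry_pos[of x \<mu>] unfolding entry_def by simp

lemma card_rowf_less: "card {x. x < sum_list \<mu> \<and> rowf \<mu> x < r} = sum_list (take r \<mu>)"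
proof -
  have "{x. x < sum_list \<mu> \<and> rowf \<mu> x < r} = {..<sum_list (take r \<mu>)}"
    using rowf_less_iff sum_take_le[of r \<mu>] by fastforce
  then show ?thesis by simp
qed

definition column_length :: "nat list \<Rightarrow> nat \<Rightarrow> nat"
  where "column_length \<mu> j = card {i. i < length \<mu> \<and> j < \<mu> ! i}"

lemma downset_eq_lessThan:
  assumes "finite S" "\<And>i i'. i \<in> S \<Longrightarrow> i' \<le> i \<Longrightarrow> i' \<in> S"
  shows "S = {..<card S :: nat}"
proof -
  define m where "m = (LEAST m. m \<notin> S)"
  have "\<exists>m. m \<notin> S" using assms(1) by (meson ex_new_if_finite infinite_UNIV_nat)
  then have "m \<notin> S" unfolding m_def by (rule LeastI_ex)
  moreover have "\<And>k. k < m \<Longrightarrow> k \<in> S" unfolding m_def using not_less_Least by blast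
  ultimately have "S = {..<m}" using assms(2) by (force simp: not_less[symmetric])
  then show ?thesis by simp
qed

lemma cells_iff_column_length:
  assumes "sorted_wrt (\<ge>) \<mu>"
  shows "(i, j) \<in> cells \<mu> \<longleftrightarrow> i < column_length \<mu> j"
proof -
  have "{i. i < length \<mu> \<and> j < \<mu> ! i} = {..<column_length \<mu> j}"
    unfolding column_length_def
  proof (rule downset_eq_lessThan)
    fix i i' assume "i \<in> {i. i < length \<mu> \<and> j < \<mu> ! i}" "i' \<le> i"
    moreover have "i' < i \<Longrightarrow> i < length \<mu> \<Longrightarrow> \<mu> ! i \<le> \<mu> ! i'"
      using assms by (simp add: sorted_wrt_iff_nth_less)
    ultimately show "i' \<in> {i. i < length \<mu> \<and> j < \<mu> ! i}"
      by (cases "i' = i") fastforce+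
  qed simp
  then show ?thesis by (auto simp: cells_def)
qed

lemma card_by_column:
  "card {x. x < sum_list \<mu> \<and> P x} = (\<Sum>j<sum_list \<mu>. card {x. x < sum_list \<mu> \<and> colf \<mu> x = j \<and> P x})"
proof -
  have "(\<Sum>j<sum_list \<mu>. sum (\<lambda>_. 1) {x \<in> {x. x < sum_list \<mu> \<and> P x}. colf \<mu> x = j}) =
      sum (\<lambda>_. 1::nat) {x. x < sum_list \<mu> \<and> P x}"
    by (rule sum.group) (auto intro: le_less_trans[OF colf_le])
  moreover have "{x \<in> {x. x < sum_list \<mu> \<and> P x}. colf \<mu> x = j} = {x. x < sum_list \<mu> \<and> colf \<mu> x = j \<and> P x}" for j
    by auto
  ultimately show ?thesis by simp
qed

lemma card_column_rows:
  assumes "sorted_wrt (\<ge>) \<mu>"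
  shows "card {x. x < sum_list \<mu> \<and> colf \<mu> x = j \<and> rowf \<mu> x < r} = min r (column_length \<mu> j)"
proof -
  have "bij_betw (rowf \<mu>) {x. x < sum_list \<mu> \<and> colf \<mu> x = j \<and> rowf \<mu> x < r} {..<min r (column_length \<mu> j)}"
    by (rule bij_betwI[of _ _ _ "\<lambda>i. entry \<mu> (i, j)"])
       (auto simp: cells_iff_column_length[OF assms, symmetric] pos_in_cells entry_pos entry_less)
  then show ?thesis using bij_betw_same_card by fastforce
qed

lemma card_column:
  assumes "sorted_wrt (\<ge>) \<mu>"
  shows "card {x. x < sum_list \<mu> \<and> colf \<mu> x = j} = column_length \<mu> j"
proof -
  have "{x. x < sum_list \<mu> \<and> colf \<mu> x = j} = {x. x < sum_list \<mu> \<and> colf \<mu> x = j \<and> rowf \<mu> x < column_length \<mu> j}"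
    using cells_iff_column_length[OF assms] pos_in_cells by blast
  then show ?thesis using card_column_rows[OF assms, of j "column_length \<mu> j"] by simp
qed

definition col_inj :: "nat list \<Rightarrow> (nat \<Rightarrow> nat) \<Rightarrow> bool"
  where "col_inj \<mu> \<rho> \<longleftrightarrow> (\<forall>x y. x < sum_list \<mu> \<longrightarrow> y < sum_list \<mu> \<longrightarrow> x \<noteq> y \<longrightarrow> colf \<mu> x = colf \<mu> y \<longrightarrow> \<rho> x \<noteq> \<rho> y)"

lemma card_column_col_inj:
  assumes "sorted_wrt (\<ge>) \<mu>" "col_inj \<mu> \<rho>"
  shows "card {x. x < sum_list \<mu> \<and> colf \<mu> x = j \<and> \<rho> x < r} \<le> min r (column_length \<mu> j)"
proof -
  have "card {x. x < sum_list \<mu> \<and> colf \<mu> x = j \<and> \<rho> x < r} \<le> card {x. x < sum_list \<mu> \<and> colf \<mu> x = j}"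
    by (rule card_mono) auto
  moreover have "card {x. x < sum_list \<mu> \<and> colf \<mu> x = j \<and> \<rho> x < r} \<le> card {..<r}"
    using assms(2) by (intro card_inj_on_le[of \<rho>]) (fastforce simp: col_inj_def inj_on_def)+
  ultimately show ?thesis using card_column[OF assms(1)] by simp
qed

text \<open>
  A column of length \<open>c\<close> contains at most \<open>min r c\<close> entries with label below \<open>r\<close> if its labels are distinct,
  and the labelling by rows attains this bound in every column. This is where the dominance order enters.
\<close>

lemma col_inj_card_le:
  assumes "sorted_wrt (\<ge>) \<mu>" "col_inj \<mu> \<rho>"
  shows "card {x. x < sum_list \<mu> \<and> \<rho> x < r} \<le> sum_list (take r \<mu>)"
proof -
  have "card {x. x < sum_list \<mu> \<and> \<rho> x < r} = (\<Sum>j<sum_list \<mu>. card {x. x < sum_list \<mu> \<and> colf \<mu> x = j \<and> \<rho> x < r})"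
    by (rule card_by_column)
  also have "\<dots> \<le> (\<Sum>j<sum_list \<mu>. card {x. x < sum_list \<mu> \<and> colf \<mu> x = j \<and> rowf \<mu> x < r})"
    unfolding card_column_rows[OF assms(1)] by (intro sum_mono card_column_col_inj assms)
  also have "\<dots> = sum_list (take r \<mu>)"
    by (simp only: card_by_column[symmetric] card_rowf_less)
  finally show ?thesis .
qed

text \<open>
  If equality holds in the total count, it holds in each column. With \<open>r\<close> the length of the column, all its
  labels are below \<open>r\<close>, which says that the cell in this row and column exists.
\<close>

lemma col_inj_in_cells:
  assumes "sorted_wrt (\<ge>) \<mu>" "col_inj \<mu> \<rho>"
    and eq: "\<And>r. card {x. x < sum_list \<mu> \<and> \<rho> x < r} = sum_list (take r \<mu>)"
    and x: "x < sum_list \<mu>"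
  shows "(\<rho> x, colf \<mu> x) \<in> cells \<mu>"
proof -
  define j where "j = colf \<mu> x"
  \<comment> \<open>With this \<open>r\<close> the bound for the column of \<open>x\<close> is its full length.\<close>
  define r where "r = column_length \<mu> j"
  let ?A = "\<lambda>j. card {x. x < sum_list \<mu> \<and> colf \<mu> x = j \<and> \<rho> x < r}"
  have "sum ?A {..<sum_list \<mu>} = (\<Sum>j<sum_list \<mu>. min r (column_length \<mu> j))"
    using eq[of r] card_rowf_less[of \<mu> r]
    by (simp add: card_by_column[of \<mu> "\<lambda>x. \<rho> x < r"] card_by_column[of \<mu> "\<lambda>x. rowf \<mu> x < r"] card_column_rows[OF assms(1)])
  moreover have "j \<in> {..<sum_list \<mu>}" using colf_le[OF x] x by (simp add: j_def)
  ultimately have "?A j = min r (column_length \<mu> j)"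
    by (intro sum_mono_inv[of ?A "{..<sum_list \<mu>}" "\<lambda>j. min r (column_length \<mu> j)"])
      (simp_all only: card_column_col_inj[OF assms(1,2)] finite_lessThan)
  then have c: "?A j = card {x. x < sum_list \<mu> \<and> colf \<mu> x = j}"
    by (simp add: r_def card_column[OF assms(1)])
  have "{x. x < sum_list \<mu> \<and> colf \<mu> x = j \<and> \<rho> x < r} = {x. x < sum_list \<mu> \<and> colf \<mu> x = j}"
    by (rule card_subset_eq) (auto simp: c)
  then have "\<rho> x < r" using x j_def by blast
  then show ?thesis by (simp add: cells_iff_column_length[OF assms(1)] r_def j_def)
qed

section \<open>Young symmetrizers\<close>

text \<open>
  Young subgroups are given by labellings of the points. Arbitrary labellings occur, and not only rows and
  columns of a tableau, because the eigenvalue computation for Jucys--Murphy elements moves a single entry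
  into another row.
\<close>

definition Stab :: "nat \<Rightarrow> (nat \<Rightarrow> nat) \<Rightarrow> fperm set"
  where "Stab n \<rho> = {g \<in> SymP n. \<forall>x<n. \<rho> (fun_of g x) = \<rho> x}"

definition stab_sum :: "nat \<Rightarrow> (nat \<Rightarrow> nat) \<Rightarrow> fperm \<Rightarrow>\<^sub>0 rat"
  where "stab_sum n \<rho> = (\<Sum>g\<in>Stab n \<rho>. elt g)"

definition alt_sum :: "nat \<Rightarrow> (nat \<Rightarrow> nat) \<Rightarrow> fperm \<Rightarrow>\<^sub>0 rat"
  where "alt_sum n \<rho> = (\<Sum>g\<in>Stab n \<rho>. single g (of_int (sign (fun_of g))))"

lemma Stab_SymP: "g \<in> Stab n \<rho> \<Longrightarrow> g \<in> SymP n"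
  by (simp add: Stab_def)

lemma finite_Stab [simp]: "finite (Stab n \<rho>)"
  by (rule finite_subset[of _ "SymP n"]) (auto simp: Stab_def)

lemma Stab_zero [simp]: "0 \<in> Stab n \<rho>"
  by (simp add: Stab_def)

lemma Stab_plus [intro]: "g \<in> Stab n \<rho> \<Longrightarrow> h \<in> Stab n \<rho> \<Longrightarrow> g + h \<in> Stab n \<rho>"
  by (auto simp: Stab_def SymP_less)

lemma Stab_uminus [intro]:
  assumes g: "g \<in> Stab n \<rho>" shows "- g \<in> Stab n \<rho>"
proof -
  have gn: "- g \<in> SymP n" using g by (auto simp: Stab_def)
  have "\<rho> (fun_of (- g) x) = \<rho> x" if "x < n" for x
  proof -
    have "fun_of (- g) x < n" using SymP_less[OF gn] that by simp
    then have "\<rho> (fun_of g (fun_of (- g) x)) = \<rho> (fun_of (- g) x)"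
      using g by (simp add: Stab_def del: fun_of_inv fun_of_uminus)
    then show ?thesis by (metis fun_of_inv(1) fun_of_uminus)
  qed
  then show ?thesis using gn by (simp add: Stab_def)
qed

lemma Stab_uminus_iff [simp]: "- g \<in> Stab n \<rho> \<longleftrightarrow> g \<in> Stab n \<rho>"
  using Stab_uminus[of g] Stab_uminus[of "- g"] by auto

lemma Stab_diff [intro]: "g \<in> Stab n \<rho> \<Longrightarrow> h \<in> Stab n \<rho> \<Longrightarrow> g - h \<in> Stab n \<rho>"
  using Stab_plus[of g n \<rho> "- h"] by simp

lemma bij_Stab_left: "h \<in> Stab n \<rho> \<Longrightarrow> bij_betw ((+) h) (Stab n \<rho>) (Stab n \<rho>)"
  by (rule bij_betwI[of _ _ _ "(+) (- h)"]) (auto simp flip: add.assoc)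

lemma bij_Stab_right: "h \<in> Stab n \<rho> \<Longrightarrow> bij_betw (\<lambda>g. g + h) (Stab n \<rho>) (Stab n \<rho>)"
  by (rule bij_betwI[of _ _ _ "\<lambda>g. g - h"]) auto

lemma stab_sum_left: "h \<in> Stab n \<rho> \<Longrightarrow> elt h * stab_sum n \<rho> = stab_sum n \<rho>"
  using sum.reindex_bij_betw[OF bij_Stab_left, of h n \<rho> "\<lambda>g. elt g :: fperm \<Rightarrow>\<^sub>0 rat"]
  by (simp add: stab_sum_def sum_distrib_left mult_single)

lemma stab_sum_right: "h \<in> Stab n \<rho> \<Longrightarrow> stab_sum n \<rho> * elt h = stab_sum n \<rho>"
  using sum.reindex_bij_betw[OF bij_Stab_right, of h n \<rho> "\<lambda>g. elt g :: fperm \<Rightarrow>\<^sub>0 rat"]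
  by (simp add: stab_sum_def sum_distrib_right mult_single)

lemma sign_plus: "sign (fun_of (g + h)) = sign (fun_of g) * sign (fun_of h)"
  by (simp add: sign_compose)

lemma alt_sum_left:
  assumes "h \<in> Stab n \<rho>"
  shows "elt h * alt_sum n \<rho> = single 0 (of_int (sign (fun_of h))) * alt_sum n \<rho>"
proof -
  have "elt h * alt_sum n \<rho> = (\<Sum>g\<in>Stab n \<rho>. single (h + g) (of_int (sign (fun_of g))))"
    by (simp add: alt_sum_def sum_distrib_left mult_single)
  also have "\<dots> = (\<Sum>g\<in>Stab n \<rho>. single (h + g) (of_int (sign (fun_of h) * sign (fun_of (h + g)))))"
    by (intro sum.cong refl) (simp add: sign_plus del: fun_of_plus flip: mult.assoc)
  also have "\<dots> = (\<Sum>g\<in>Stab n \<rho>. single g (of_int (sign (fun_of h) * sign (fun_of g))))"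
    using sum.reindex_bij_betw[OF bij_Stab_left[OF assms],
        of "\<lambda>g. single g (of_int (sign (fun_of h) * sign (fun_of g)))"] .
  also have "\<dots> = single 0 (of_int (sign (fun_of h))) * alt_sum n \<rho>"
    by (simp add: alt_sum_def sum_distrib_left mult_single)
  finally show ?thesis .
qed

lemma stab_sum_group_ring [simp]: "stab_sum n \<rho> \<in> group_ring n"
  unfolding stab_sum_def by (intro group_ring_sum group_ring_single Stab_SymP)

lemma alt_sum_group_ring [simp]: "alt_sum n \<rho> \<in> group_ring n"
  unfolding alt_sum_def by (intro group_ring_sum group_ring_single Stab_SymP)

lemma lookup_stab_sum: "lookup (stab_sum n \<rho>) g = (if g \<in> Stab n \<rho> then 1 else 0)"
  by (auto simp: stab_sum_def lookup_sum lookup_single when_def sum.If_cases)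

lemma lookup_alt_sum: "lookup (alt_sum n \<rho>) g = (if g \<in> Stab n \<rho> then of_int (sign (fun_of g)) else 0)"
  by (auto simp: alt_sum_def lookup_sum lookup_single when_def sum.If_cases)

lemma transp_Stab: "x < n \<Longrightarrow> y < n \<Longrightarrow> \<rho> x = \<rho> y \<Longrightarrow> transp x y \<in> Stab n \<rho>"
  by (auto simp: Stab_def transp_SymP Transposition.transpose_def)

lemma eq_neg_self_zero: "x = - x \<Longrightarrow> (x :: fperm \<Rightarrow>\<^sub>0 rat) = 0"
  by (rule poly_mapping_eqI) (metis lookup_uminus lookup_zero neg_equal_zero)

text \<open>
  The transposition of \<open>x\<close> and \<open>y\<close> can be absorbed on the left with sign \<open>+1\<close> and on the right with sign
  \<open>-1\<close>.
\<close>

lemma collision: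
  assumes g: "g \<in> SymP n" and xy: "x < n" "y < n" "x \<noteq> y"
    and "\<sigma> x = \<sigma> y" "\<rho> (fun_of g x) = \<rho> (fun_of g y)"
  shows "stab_sum n \<rho> * elt g * alt_sum n \<sigma> = 0"
proof (rule eq_neg_self_zero)
  have "transp (fun_of g x) (fun_of g y) \<in> Stab n \<rho>"
    using assms by (intro transp_Stab) (auto simp: SymP_less)
  then have "stab_sum n \<rho> * elt g * alt_sum n \<sigma> = stab_sum n \<rho> * elt (transp (fun_of g x) (fun_of g y)) * elt g * alt_sum n \<sigma>"
    by (simp only: stab_sum_right)
  also have "\<dots> = stab_sum n \<rho> * elt g * (elt (transp x y) * alt_sum n \<sigma>)"
    by (simp only: mult.assoc elt_mult_left transp_conj)
  also have "elt (transp x y) * alt_sum n \<sigma> = single 0 (of_int (sign (fun_of (transp x y)))) * alt_sum n \<sigma>"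
    by (rule alt_sum_left) (rule transp_Stab[OF xy(1,2) assms(5)])
  also have "sign (fun_of (transp x y)) = - 1" using xy(3) by (simp add: sign_swap_id)
  also have "single 0 (of_int (- 1)) * alt_sum n \<sigma> = - alt_sum n \<sigma>"
    by (rule poly_mapping_eqI) simp
  finally show "stab_sum n \<rho> * elt g * alt_sum n \<sigma> = - (stab_sum n \<rho> * elt g * alt_sum n \<sigma>)"
    unfolding mult_minus_right .
qed

lemma col_inj_if_nonzero:
  assumes "g \<in> SymP (sum_list \<mu>)" "stab_sum (sum_list \<mu>) \<rho> * elt g * alt_sum (sum_list \<mu>) (colf \<mu>) \<noteq> 0"
  shows "col_inj \<mu> (\<lambda>x. \<rho> (fun_of g x))"
  using assms collision unfolding col_inj_def by blast

lemma card_reindex_SymP: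
  assumes "g \<in> SymP n"
  shows "card {x. x < n \<and> P (fun_of g x)} = card {x. x < n \<and> P x}"
proof -
  have "bij_betw (fun_of g) {x. x < n \<and> P (fun_of g x)} {x. x < n \<and> P x}"
    by (rule bij_betwI[of _ _ _ "fun_of (- g)"])
       (use assms SymP_less[OF assms] SymP_less[of "- g" n] in auto)
  then show ?thesis by (rule bij_betw_same_card)
qed

lemma row_bound_if_nonzero:
  assumes "sorted_wrt (\<ge>) \<mu>" "g \<in> SymP (sum_list \<mu>)" "stab_sum (sum_list \<mu>) \<rho> * elt g * alt_sum (sum_list \<mu>) (colf \<mu>) \<noteq> 0"
  shows "card {x. x < sum_list \<mu> \<and> \<rho> x < r} \<le> sum_list (take r \<mu>)"
  using col_inj_card_le[OF assms(1) col_inj_if_nonzero[OF assms(2,3)], of r] card_reindex_SymP[OF assms(2), of "\<lambda>x. \<rho> x < r"]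
  by simp

text \<open>
  Von Neumann's lemma. The factor \<open>q\<close> moves \<open>x\<close> within its column to the row that \<open>g\<close> prescribes; the
  resulting position is a cell by the equality case of the counting lemma.
\<close>

lemma col_inj_factor:
  assumes s: "sorted_wrt (\<ge>) \<mu>" and g: "g \<in> SymP (sum_list \<mu>)" and inj: "col_inj \<mu> (\<lambda>x. rowf \<mu> (fun_of g x))"
  shows "\<exists>p\<in>Stab (sum_list \<mu>) (rowf \<mu>). \<exists>q\<in>Stab (sum_list \<mu>) (colf \<mu>). g = p + q"
proof -
  let ?n = "sum_list \<mu>"
  \<comment> \<open>The column permutation that puts \<open>x\<close> into the row of \<open>g x\<close>.\<close>
  define \<tau> where "\<tau> x = (if x < ?n then entry \<mu> (rowf \<mu> (fun_of g x), colf \<mu> x) else x)" for x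
  have c: "(rowf \<mu> (fun_of g x), colf \<mu> x) \<in> cells \<mu>" if "x < ?n" for x
    by (rule col_inj_in_cells[OF s inj _ that]) (simp add: card_reindex_SymP[OF g, of "\<lambda>y. rowf \<mu> y < r" for r] card_rowf_less)
  have \<tau>n: "\<tau> x < ?n" if "x < ?n" for x using c[OF that] that by (simp add: \<tau>_def entry_less)
  have "inj_on \<tau> {..<?n}"
  proof (rule inj_onI)
    fix x y assume xy: "x \<in> {..<?n}" "y \<in> {..<?n}" "\<tau> x = \<tau> y"
    then have "(rowf \<mu> (fun_of g x), colf \<mu> x) = (rowf \<mu> (fun_of g y), colf \<mu> y)"
      using c[of x] c[of y] by (intro inj_onD[OF inj_on_entry]) (auto simp: \<tau>_def)
    then have "rowf \<mu> (fun_of g x) = rowf \<mu> (fun_of g y)" "colf \<mu> x = colf \<mu> y"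
      by simp_all
    then show "x = y" using inj xy by (auto simp: col_inj_def)
  qed
  moreover have "\<tau> ` {..<?n} = {..<?n}"
    by (rule endo_inj_surj) (use \<tau>n calculation in auto)
  ultimately have "\<tau> permutes {..<?n}"
    by (intro bij_imp_permutes) (auto simp: bij_betw_def \<tau>_def)
  moreover from this have "permutation \<tau>" by (meson finite_lessThan permutation_permutes)
  ultimately have q: "fun_of (mk_perm \<tau>) = \<tau>" "mk_perm \<tau> \<in> SymP ?n"
    by (simp_all add: SymP_def)
  have qS: "mk_perm \<tau> \<in> Stab ?n (colf \<mu>)"
    using q c by (auto simp: Stab_def \<tau>_def)
  have "rowf \<mu> (fun_of (g - mk_perm \<tau>) x) = rowf \<mu> x" if "x < ?n" for x
  proof -
    define y where "y = fun_of (- mk_perm \<tau>) x"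
    have yn: "y < ?n" using SymP_less[of "- mk_perm \<tau>" ?n x] q(2) that by (simp add: y_def del: fun_of_uminus)
    have "\<tau> y = x" using fun_of_inv(1)[of "mk_perm \<tau>" x] q(1) by (simp add: y_def)
    then have "rowf \<mu> x = rowf \<mu> (fun_of g y)" using c[OF yn] yn by (auto simp: \<tau>_def)
    then show ?thesis by (simp add: y_def diff_conv_add_uminus del: add_uminus_conv_diff)
  qed
  then have "g - mk_perm \<tau> \<in> Stab ?n (rowf \<mu>)" using g q(2) by (auto simp: Stab_def)
  then show ?thesis using qS by (metis diff_add_cancel)
qed

definition young :: "nat list \<Rightarrow> fperm \<Rightarrow>\<^sub>0 rat"
  where "young \<mu> = stab_sum (sum_list \<mu>) (rowf \<mu>) * alt_sum (sum_list \<mu>) (colf \<mu>)"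

lemma young_group_ring [simp]: "young \<mu> \<in> group_ring (sum_list \<mu>)"
  by (auto simp: young_def)

lemma lookup_young_zero: "lookup (young \<mu>) 0 = 1"
proof -
  let ?n = "sum_list \<mu>"
  have triv: "g = 0" if "g \<in> Stab ?n (rowf \<mu>)" "g \<in> Stab ?n (colf \<mu>)" for g
  proof -
    have "fun_of g x = x" for x
    proof (cases "x < ?n")
      case True
      then show ?thesis using that by - (rule pos_eqI[of _ \<mu>], auto simp: Stab_def SymP_less)
    qed (use that in \<open>auto simp: Stab_def SymP_fix\<close>)
    then show ?thesis by (simp add: fun_of_inject[symmetric] fun_eq_iff)
  qed
  have "lookup (young \<mu>) 0 =
      (\<Sum>h\<in>SymP ?n. lookup (stab_sum ?n (rowf \<mu>)) h * lookup (alt_sum ?n (colf \<mu>)) (- h))"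
    unfolding young_def using stab_sum_group_ring by (subst lookup_group_mult[of "SymP ?n"]) (auto simp: group_ring_def)
  also have "\<dots> = (\<Sum>h\<in>SymP ?n. if h = 0 then 1 else 0)"
    by (intro sum.cong refl) (use triv in \<open>auto simp: lookup_stab_sum lookup_alt_sum sign_id\<close>)
  finally show ?thesis by simp
qed

lemma row_elt_column:
  assumes s: "sorted_wrt (\<ge>) \<mu>" and g: "g \<in> SymP (sum_list \<mu>)"
  shows "\<exists>k. stab_sum (sum_list \<mu>) (rowf \<mu>) * elt g * alt_sum (sum_list \<mu>) (colf \<mu>) = single 0 k * young \<mu>"
proof (cases "stab_sum (sum_list \<mu>) (rowf \<mu>) * elt g * alt_sum (sum_list \<mu>) (colf \<mu>) = 0")
  case True
  then show ?thesis by (intro exI[of _ 0]) simp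
next
  case False
  obtain p q where pq: "p \<in> Stab (sum_list \<mu>) (rowf \<mu>)" "q \<in> Stab (sum_list \<mu>) (colf \<mu>)" "g = p + q"
    using col_inj_factor[OF s g col_inj_if_nonzero[OF g False]] by blast
  have "stab_sum (sum_list \<mu>) (rowf \<mu>) * elt g * alt_sum (sum_list \<mu>) (colf \<mu>) =
      (stab_sum (sum_list \<mu>) (rowf \<mu>) * elt p) * (elt q * alt_sum (sum_list \<mu>) (colf \<mu>))"
    by (simp add: pq(3) mult.assoc elt_mult_left)
  also have "\<dots> = single 0 (of_int (sign (fun_of q))) * young \<mu>"
    unfolding stab_sum_right[OF pq(1)] alt_sum_left[OF pq(2)] young_def
    by (simp add: const_mult_commute flip: mult.assoc)
  finally show ?thesis by blast
qed

text \<open>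
  By linearity it suffices to consider a single permutation. It either factors through the two stabilizers, which
  the sums absorb, or it maps two points of a column into the same row, and the product vanishes.
\<close>

lemma row_group_ring_column:
  assumes s: "sorted_wrt (\<ge>) \<mu>" and x: "x \<in> group_ring (sum_list \<mu>)"
  shows "\<exists>k. stab_sum (sum_list \<mu>) (rowf \<mu>) * x * alt_sum (sum_list \<mu>) (colf \<mu>) = single 0 k * young \<mu>"
proof -
  let ?a = "stab_sum (sum_list \<mu>) (rowf \<mu>)" and ?b = "alt_sum (sum_list \<mu>) (colf \<mu>)"
  obtain k where k: "\<And>g. g \<in> SymP (sum_list \<mu>) \<Longrightarrow> ?a * elt g * ?b = single 0 (k g) * young \<mu>"
    using row_elt_column[OF s] by metis
  have "?a * x * ?b = (\<Sum>g\<in>SymP (sum_list \<mu>). ?a * single g (lookup x g) * ?b)"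
    by (subst group_ring_expand[OF x, symmetric]) (simp add: sum_distrib_left sum_distrib_right)
  also have "\<dots> = (\<Sum>g\<in>SymP (sum_list \<mu>). single 0 (lookup x g) * (?a * elt g * ?b))"
  proof (intro sum.cong refl)
    fix g
    have "single g (lookup x g) = single 0 (lookup x g) * elt g"
      by (simp add: mult_single)
    then show "?a * single g (lookup x g) * ?b = single 0 (lookup x g) * (?a * elt g * ?b)"
      by (simp only: mult.assoc[symmetric] const_mult_commute)
  qed
  also have "\<dots> = (\<Sum>g\<in>SymP (sum_list \<mu>). single 0 (lookup x g * k g) * young \<mu>)"
    by (intro sum.cong refl) (simp add: k mult_single flip: mult.assoc)
  also have "\<dots> = single 0 (\<Sum>g\<in>SymP (sum_list \<mu>). lookup x g * k g) * young \<mu>"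
    by (rule poly_mapping_eqI) (simp add: lookup_sum sum_distrib_right)
  finally show ?thesis by blast
qed

lemma row_group_ring_column_zero:
  assumes "\<And>g. g \<in> SymP n \<Longrightarrow> stab_sum n \<rho> * elt g * alt_sum n \<sigma> = 0" and x: "x \<in> group_ring n"
  shows "stab_sum n \<rho> * x * alt_sum n \<sigma> = 0"
proof -
  have "stab_sum n \<rho> * x * alt_sum n \<sigma> = (\<Sum>g\<in>SymP n. stab_sum n \<rho> * single g (lookup x g) * alt_sum n \<sigma>)"
    by (subst group_ring_expand[OF x, symmetric]) (simp add: sum_distrib_left sum_distrib_right)
  also have "\<dots> = 0"
  proof (intro sum.neutral ballI)
    fix g assume "g \<in> SymP n"
    have "single g (lookup x g) = elt g * single 0 (lookup x g)"
      by (simp add: mult_single)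
    then have "stab_sum n \<rho> * single g (lookup x g) * alt_sum n \<sigma> =
        single 0 (lookup x g) * (stab_sum n \<rho> * elt g * alt_sum n \<sigma>)"
      by (simp only: mult.assoc[symmetric] const_mult_commute)
    then show "stab_sum n \<rho> * single g (lookup x g) * alt_sum n \<sigma> = 0"
      using assms(1)[OF \<open>g \<in> SymP n\<close>] by simp
  qed
  finally show ?thesis .
qed

subsection \<open>The involution that inverts permutations\<close>

text \<open>
  This involution reverses products and fixes row and column sums, and \<open>x * star x\<close> has a positive
  coefficient at the identity. The first property exchanges left and right, and the second yields
  semisimplicity.
\<close>

definition star :: "(fperm \<Rightarrow>\<^sub>0 rat) \<Rightarrow> fperm \<Rightarrow>\<^sub>0 rat"
  where "star = Poly_Mapping.map_key uminus"

lemma lookup_star [simp]: "lookup (star x) g = lookup x (- g)"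
  unfolding star_def by (subst map_key.rep_eq) (auto intro: injI)

lemma star_star [simp]: "star (star x) = x"
  by (rule poly_mapping_eqI) simp

lemma star_zero [simp]: "star 0 = 0"
  by (rule poly_mapping_eqI) simp

lemma star_single: "star (single g a) = single (- g) a"
  by (rule poly_mapping_eqI) (auto simp: lookup_single when_def)

lemma star_sum: "star (sum f A) = (\<Sum>i\<in>A. star (f i))"
  by (rule poly_mapping_eqI) (simp add: lookup_sum)

lemma star_mult: "star (x * y) = star y * star x"
proof -
  let ?l = lookup
  have "star (x * y) = (\<Sum>h\<in>keys x. \<Sum>k\<in>keys y. single (- k + - h) (?l x h * ?l y k))"
    by (subst sum_single_keys[of x, symmetric], subst sum_single_keys[of y, symmetric])
       (simp add: sum_distrib_left sum_distrib_right star_sum mult_single star_single minus_add sum.swap[of _ "keys y"] del: add_uminus_conv_diff)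
  also have "\<dots> = star (\<Sum>k\<in>keys y. single k (?l y k)) * star (\<Sum>h\<in>keys x. single h (?l x h))"
    by (simp add: sum_distrib_left sum_distrib_right star_sum mult_single star_single mult.commute sum.swap[of _ "keys y"] del: add_uminus_conv_diff)
  finally show ?thesis by (simp add: sum_single_keys)
qed

lemma star_group_ring [intro]: "x \<in> group_ring n \<Longrightarrow> star x \<in> group_ring n"
  by (auto simp: group_ring_iff)

lemma star_stab_sum [simp]: "star (stab_sum n \<rho>) = stab_sum n \<rho>"
  by (rule poly_mapping_eqI) (simp add: lookup_stab_sum)

lemma star_alt_sum [simp]: "star (alt_sum n \<rho>) = alt_sum n \<rho>"
  by (rule poly_mapping_eqI) (simp add: lookup_alt_sum sign_inverse)

lemma lookup_mult_star: "lookup (x * star x) 0 = (\<Sum>h\<in>keys x. (lookup x h)\<^sup>2)"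
  by (subst lookup_group_mult[of "keys x"]) (auto simp: power2_eq_square)

lemma lookup_mult_star_pos:
  assumes "x \<noteq> 0"
  shows "lookup (x * star x) 0 > 0"
proof -
  obtain h where "h \<in> keys x" using assms keys_eq_empty by (metis all_not_in_conv poly_mapping_eqI lookup_zero in_keys_iff)
  then show ?thesis unfolding lookup_mult_star
    by (intro sum_pos2[of _ h]) (auto simp: in_keys_iff)
qed

subsection \<open>Young symmetrizers are multiples of orthogonal idempotents\<close>

abbreviation scal :: "'r \<Rightarrow> fperm \<Rightarrow>\<^sub>0 'r :: zero"
  where "scal \<equiv> single 0"

lemma scal_mult_left: "scal a * (scal b * x) = (scal (a * b) * x :: fperm \<Rightarrow>\<^sub>0 'r :: semiring_0)"
  by (simp add: mult_single flip: mult.assoc)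

lemma scal_commute_left: "y * (scal a * x) = (scal a * (y * x) :: fperm \<Rightarrow>\<^sub>0 'r :: comm_semiring_0)"
  by (metis const_mult_commute mult.assoc)

lemma scal_inject: "scal a * x = scal b * x \<Longrightarrow> x \<noteq> 0 \<Longrightarrow> a = (b :: 'r :: idom)"
proof -
  assume *: "scal a * x = scal b * x" "x \<noteq> 0"
  then obtain g where "lookup x g \<noteq> 0" by (metis poly_mapping_eqI lookup_zero)
  moreover have "a * lookup x g = b * lookup x g"
    using arg_cong[OF *(1), of "\<lambda>z. lookup z g"] by simp
  ultimately show ?thesis by simp
qed

lemma stab_sum_square: "stab_sum n \<rho> * stab_sum n \<rho> = scal (of_nat (card (Stab n \<rho>))) * stab_sum n \<rho>"
proof -
  have "stab_sum n \<rho> * stab_sum n \<rho> = (\<Sum>g\<in>Stab n \<rho>. elt g * stab_sum n \<rho>)"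
    by (subst stab_sum_def) (simp add: sum_distrib_right)
  also have "\<dots> = (\<Sum>g\<in>Stab n \<rho>. stab_sum n \<rho>)" by (intro sum.cong refl stab_sum_left)
  also have "\<dots> = scal (of_nat (card (Stab n \<rho>))) * stab_sum n \<rho>"
    by (simp add: single_of_nat)
  finally show ?thesis .
qed

lemma alt_sum_square: "alt_sum n \<rho> * alt_sum n \<rho> = scal (of_nat (card (Stab n \<rho>))) * alt_sum n \<rho>"
proof -
  have "alt_sum n \<rho> * alt_sum n \<rho> = (\<Sum>g\<in>Stab n \<rho>. scal (of_int (sign (fun_of g))) * (elt g * alt_sum n \<rho>))"
    by (subst alt_sum_def) (simp add: sum_distrib_right mult_single flip: mult.assoc)
  also have "\<dots> = (\<Sum>g\<in>Stab n \<rho>. alt_sum n \<rho>)"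
    by (intro sum.cong refl) (simp add: alt_sum_left scal_mult_left flip: of_int_mult)
  also have "\<dots> = scal (of_nat (card (Stab n \<rho>))) * alt_sum n \<rho>"
    by (simp add: single_of_nat)
  finally show ?thesis .
qed

text \<open>
  The factor by which the Young symmetrizer fails to be idempotent. It is \<open>n!\<close> divided by the dimension of
  the irreducible representation, that is, the product of the hook lengths.
\<close>

definition kappa :: "nat list \<Rightarrow> rat"
  where "kappa \<mu> = lookup (young \<mu> * young \<mu>) 0"

text \<open>
  The scalar is read off from the coefficient of the identity, which is 1 in \<open>young \<mu>\<close>.
\<close>

lemma young_sandwich:
  assumes s: "sorted_wrt (\<ge>) \<mu>" and x: "x \<in> group_ring (sum_list \<mu>)"
  shows "young \<mu> * x * young \<mu> = scal (lookup (young \<mu> * x * young \<mu>) 0) * young \<mu>"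
proof -
  let ?a = "stab_sum (sum_list \<mu>) (rowf \<mu>)" and ?b = "alt_sum (sum_list \<mu>) (colf \<mu>)"
  have "?b * x * ?a \<in> group_ring (sum_list \<mu>)" using x by (intro group_ring_mult) auto
  from row_group_ring_column[OF s this] obtain k where k: "young \<mu> * x * young \<mu> = scal k * young \<mu>"
    by (auto simp: young_def mult.assoc)
  then show ?thesis by (simp add: lookup_young_zero)
qed

lemma young_square:
  assumes "sorted_wrt (\<ge>) \<mu>"
  shows "young \<mu> * young \<mu> = scal (kappa \<mu>) * young \<mu>"
  using young_sandwich[OF assms, of 1] by (simp add: kappa_def)

text \<open>
  Write \<open>young \<mu> = a b\<close>. If \<open>a b a b = 0\<close>, then \<open>(a b a) (a b a)\<^sup>*\<close> vanishes, since it is a multiple of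
  \<open>a b a b a\<close>; positivity gives \<open>a b a = 0\<close>. As \<open>(a b) (a b)\<^sup>*\<close> is a multiple of \<open>a b a\<close>, positivity gives
  \<open>a b = 0\<close>, but the Young symmetrizer is not zero.
\<close>

lemma kappa_nonzero:
  assumes s: "sorted_wrt (\<ge>) \<mu>"
  shows "kappa \<mu> \<noteq> 0"
proof
  assume 0: "kappa \<mu> = 0"
  let ?n = "sum_list \<mu>"
  define a where "a = stab_sum ?n (rowf \<mu>)"
  define b where "b = alt_sum ?n (colf \<mu>)"
  have ab: "young \<mu> = a * b" by (simp add: young_def a_def b_def)
  have aa: "a * (a * x) = scal (of_nat (card (Stab ?n (rowf \<mu>)))) * (a * x)" for x
    using stab_sum_square[of ?n "rowf \<mu>"] by (simp add: a_def flip: mult.assoc)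
  have bb: "b * (b * x) = scal (of_nat (card (Stab ?n (colf \<mu>)))) * (b * x)" for x
    using alt_sum_square[of ?n "colf \<mu>"] by (simp add: b_def flip: mult.assoc)
  have abab: "a * (b * (a * (b * x))) = 0" for x
    using young_square[OF s] by (simp add: ab 0 flip: mult.assoc)
  have sa: "star a = a" "star b = b" by (simp_all add: a_def b_def)
  have "young \<mu> \<noteq> 0" using lookup_young_zero[of \<mu>] by auto
  then have "lookup (young \<mu> * star (young \<mu>)) 0 > 0" by (rule lookup_mult_star_pos)
  then have "a * (b * a) \<noteq> 0" by (auto simp: ab star_mult sa mult.assoc bb scal_commute_left)
  then have "lookup ((a * (b * a)) * star (a * (b * a))) 0 > 0" by (rule lookup_mult_star_pos)
  then show False by (simp add: star_mult sa mult.assoc aa scal_commute_left abab)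
qed

lemma partition_takes_eq:
  fixes \<mu> \<nu> :: "nat list"
  assumes eq: "\<And>r. sum_list (take r \<mu>) = sum_list (take r \<nu>)" and "0 \<notin> set \<mu>" "0 \<notin> set \<nu>"
  shows "\<mu> = \<nu>"
proof -
  have len: "\<not> length \<mu> < length \<nu>" if eq: "\<And>r. sum_list (take r \<mu>) = sum_list (take r \<nu>)" and "0 \<notin> set \<nu>" for \<mu> \<nu> :: "nat list"
  proof
    assume l: "length \<mu> < length \<nu>"
    then have "\<nu> ! length \<mu> = 0"
      using sum_take_Suc[OF l] eq[of "length \<mu>"] eq[of "Suc (length \<mu>)"] by simp
    then show False using l that(2) by (metis nth_mem)
  qed
  have "length \<mu> = length \<nu>" using len[of \<mu> \<nu>] len[of \<nu> \<mu>] assms by simp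
  then show ?thesis
  proof (rule nth_equalityI)
    fix i assume "i < length \<mu>"
    then show "\<mu> ! i = \<nu> ! i"
      using sum_take_Suc[of i \<mu>] sum_take_Suc[of i \<nu>] eq[of i] eq[of "Suc i"] \<open>length \<mu> = length \<nu>\<close> by simp
  qed
qed

text \<open>
  A nonzero product would make the row labels of \<open>\<mu>\<close>, moved by some permutation, distinct in each column of
  \<open>\<nu>\<close>; then \<open>\<nu>\<close> dominates \<open>\<mu>\<close>.
\<close>

lemma row_column_zero:
  assumes "\<mu> \<in> partitions n" "\<nu> \<in> partitions n" "sum_list (take r \<mu>) > sum_list (take r \<nu>)" "x \<in> group_ring n"
  shows "stab_sum n (rowf \<mu>) * x * alt_sum n (colf \<nu>) = 0"
proof (rule row_group_ring_column_zero[OF _ assms(4)], rule ccontr)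
  fix g assume g: "g \<in> SymP n" and nz: "stab_sum n (rowf \<mu>) * elt g * alt_sum n (colf \<nu>) \<noteq> 0"
  have n: "sum_list \<mu> = n" "sum_list \<nu> = n" "sorted_wrt (\<ge>) \<nu>" using assms by (auto simp: partitions_def)
  have "card {x. x < n \<and> rowf \<mu> x < r} \<le> sum_list (take r \<nu>)"
    using row_bound_if_nonzero[of \<nu> g "rowf \<mu>" r] g nz n by simp
  then show False using card_rowf_less[of \<mu> r] assms(3) n by simp
qed

text \<open>
  Two different partitions cannot dominate each other. If \<open>\<nu>\<close> fails to dominate \<open>\<mu>\<close>, the outer row and column
  sums annihilate each other; otherwise the inner ones do, by the involution.
\<close>

lemma young_orthogonal:
  assumes \<mu>: "\<mu> \<in> partitions n" and \<nu>: "\<nu> \<in> partitions n" and ne: "\<mu> \<noteq> \<nu>" and x: "x \<in> group_ring n"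
  shows "young \<mu> * x * young \<nu> = 0"
proof -
  have n: "sum_list \<mu> = n" "sum_list \<nu> = n" using \<mu> \<nu> by (auto simp: partitions_def)
  have y: "young \<mu> * x * young \<nu> = stab_sum n (rowf \<mu>) * (alt_sum n (colf \<mu>) * x * stab_sum n (rowf \<nu>)) * alt_sum n (colf \<nu>)"
    by (simp add: young_def n mult.assoc)
  obtain r where "sum_list (take r \<mu>) \<noteq> sum_list (take r \<nu>)"
    using partition_takes_eq[of \<mu> \<nu>] \<mu> \<nu> ne by (auto simp: partitions_def)
  then consider "sum_list (take r \<mu>) > sum_list (take r \<nu>)" | "sum_list (take r \<nu>) > sum_list (take r \<mu>)" by linarith
  then show ?thesis
  proof cases
    case 1
    show ?thesis unfolding y by (rule row_column_zero[OF \<mu> \<nu> 1]) (auto intro!: group_ring_mult x)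
  next
    case 2
    have "star (stab_sum n (rowf \<nu>) * star x * alt_sum n (colf \<mu>)) = 0"
      using row_column_zero[OF \<nu> \<mu> 2 star_group_ring[OF x]] by simp
    then have "alt_sum n (colf \<mu>) * x * stab_sum n (rowf \<nu>) = 0" by (simp add: star_mult mult.assoc)
    then show ?thesis unfolding y by simp
  qed
qed

subsection \<open>The central idempotents\<close>

text \<open>
  Summing over all conjugates makes the Young symmetrizer central. The result is the central idempotent of
  \<open>\<mu>\<close> up to the factor \<open>\<kappa>\<^sup>2\<close>.
\<close>

definition conj_young :: "nat list \<Rightarrow> fperm \<Rightarrow>\<^sub>0 rat"
  where "conj_young \<mu> = (\<Sum>t\<in>SymP (sum_list \<mu>). elt t * young \<mu> * elt (- t))"

lemma commute_group_ring:
  fixes z :: "fperm \<Rightarrow>\<^sub>0 'r :: comm_semiring_1"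
  assumes "\<And>g. g \<in> SymP n \<Longrightarrow> elt g * z = z * elt g" and x: "x \<in> group_ring n"
  shows "x * z = z * x"
proof -
  have "single g a * z = z * single g a" if "g \<in> SymP n" for g a
  proof -
    have "single g a = scal a * elt g" "single g a = elt g * scal a" by (simp_all add: mult_single)
    then show ?thesis using assms(1)[OF that] by (metis const_mult_commute mult.assoc)
  qed
  then show ?thesis
    by (subst (1 2) group_ring_expand[OF x, symmetric]) (simp add: sum_distrib_left sum_distrib_right)
qed

lemma conj_sum_commute:
  fixes z :: "fperm \<Rightarrow>\<^sub>0 'r :: comm_semiring_1"
  assumes g: "g \<in> SymP n"
  shows "elt g * (\<Sum>t\<in>SymP n. elt t * z * elt (- t)) = (\<Sum>t\<in>SymP n. elt t * z * elt (- t)) * elt g"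
proof -
  have "elt g * (\<Sum>t\<in>SymP n. elt t * z * elt (- t)) = (\<Sum>t\<in>SymP n. elt (g + t) * z * elt (- (g + t)) * elt g)"
    by (simp add: sum_distrib_left mult_single minus_add mult.assoc flip: mult.assoc[of "elt g"])
  also have "\<dots> = (\<Sum>t\<in>SymP n. elt t * z * elt (- t) * elt g)"
    using sum.reindex_bij_betw[OF bij_SymP_plus[OF g], of "\<lambda>t. elt t * z * elt (- t) * elt g"] .
  finally show ?thesis by (simp add: sum_distrib_right)
qed

lemma conj_young_commute: "x \<in> group_ring (sum_list \<mu>) \<Longrightarrow> x * conj_young \<mu> = conj_young \<mu> * x"
  unfolding conj_young_def by (rule commute_group_ring[OF conj_sum_commute])

lemma conj_young_group_ring [simp]: "conj_young \<mu> \<in> group_ring (sum_list \<mu>)"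
  unfolding conj_young_def by (intro group_ring_sum group_ring_mult group_ring_single) auto

text \<open>
  Between two Young symmetrizers each summand becomes a scalar, which the trace property evaluates. The sum of
  these scalars is \<open>\<kappa>\<^sup>2\<close> times the coefficient of the identity in \<open>young \<mu> * young \<mu>\<close>, which is \<open>\<kappa>\<close> again.
\<close>

lemma conj_young_young:
  assumes s: "sorted_wrt (\<ge>) \<mu>"
  shows "conj_young \<mu> * young \<mu> = scal ((kappa \<mu>)\<^sup>2) * young \<mu>"
proof -
  let ?y = "young \<mu>" and ?n = "sum_list \<mu>" and ?l = lookup
  have phi: "?y * elt t * ?y = scal (kappa \<mu> * ?l ?y (- t)) * ?y" if "t \<in> SymP ?n" for t
  proof -
    have "?l (?y * elt t * ?y) 0 = ?l (elt t * (?y * ?y)) 0"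
      using lookup_zero_mult_commute[of ?y "elt t * ?y"] by (simp add: mult.assoc)
    also have "\<dots> = kappa \<mu> * ?l ?y (- t)" unfolding young_square[OF s] by (simp add: lookup_mult_single_left)
    finally show ?thesis using young_sandwich[OF s, of "elt t"] that by auto
  qed
  have "?y * conj_young \<mu> * ?y = (\<Sum>t\<in>SymP ?n. ?y * elt t * ?y * elt (- t) * ?y)"
    by (simp add: conj_young_def sum_distrib_left sum_distrib_right mult.assoc)
  also have "\<dots> = (\<Sum>t\<in>SymP ?n. scal (kappa \<mu> * ?l ?y (- t)) * (?y * elt (- t) * ?y))"
  proof (intro sum.cong refl)
    fix t assume t: "t \<in> SymP ?n"
    have "?y * elt t * ?y * elt (- t) * ?y = (?y * elt t * ?y) * (elt (- t) * ?y)" by (simp only: mult.assoc)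
    also have "\<dots> = scal (kappa \<mu> * ?l ?y (- t)) * ?y * (elt (- t) * ?y)" by (simp only: phi[OF t])
    also have "\<dots> = scal (kappa \<mu> * ?l ?y (- t)) * (?y * elt (- t) * ?y)" by (simp only: mult.assoc)
    finally show "?y * elt t * ?y * elt (- t) * ?y = scal (kappa \<mu> * ?l ?y (- t)) * (?y * elt (- t) * ?y)" .
  qed
  also have "\<dots> = (\<Sum>t\<in>SymP ?n. scal (kappa \<mu> * ?l ?y (- t) * (kappa \<mu> * ?l ?y t)) * ?y)"
    by (intro sum.cong refl) (subst phi, auto simp: scal_mult_left)
  also have "\<dots> = scal ((kappa \<mu>)\<^sup>2 * (\<Sum>t\<in>SymP ?n. ?l ?y t * ?l ?y (- t))) * ?y"
    by (rule poly_mapping_eqI) (simp add: lookup_sum sum_distrib_left sum_distrib_right power2_eq_square mult_ac)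
  also have "(\<Sum>t\<in>SymP ?n. ?l ?y t * ?l ?y (- t)) = kappa \<mu>"
    unfolding kappa_def using young_group_ring[of \<mu>] by (subst lookup_group_mult[of "SymP ?n"]) (auto simp: group_ring_def)
  finally have 1: "?y * conj_young \<mu> * ?y = scal ((kappa \<mu>)\<^sup>2 * kappa \<mu>) * ?y" .
  have "?y * conj_young \<mu> * ?y = scal (kappa \<mu>) * (conj_young \<mu> * ?y)"
    by (simp add: conj_young_commute mult.assoc young_square[OF s] scal_commute_left)
  with 1 have "scal (inverse (kappa \<mu>)) * (scal (kappa \<mu>) * (conj_young \<mu> * ?y)) = scal (inverse (kappa \<mu>)) * (scal ((kappa \<mu>)\<^sup>2 * kappa \<mu>) * ?y)"
    by simp
  moreover have "inverse (kappa \<mu>) * ((kappa \<mu>)\<^sup>2 * kappa \<mu>) = (kappa \<mu>)\<^sup>2"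
    using kappa_nonzero[OF s] by (simp add: field_simps)
  ultimately show ?thesis using kappa_nonzero[OF s] by (simp add: scal_mult_left)
qed

lemma conj_young_square:
  assumes s: "sorted_wrt (\<ge>) \<mu>"
  shows "conj_young \<mu> * conj_young \<mu> = scal ((kappa \<mu>)\<^sup>2) * conj_young \<mu>"
proof -
  have "conj_young \<mu> * conj_young \<mu> = (\<Sum>t\<in>SymP (sum_list \<mu>). (conj_young \<mu> * elt t) * young \<mu> * elt (- t))"
    by (subst (2) conj_young_def) (simp add: sum_distrib_left mult.assoc)
  also have "\<dots> = (\<Sum>t\<in>SymP (sum_list \<mu>). elt t * (conj_young \<mu> * young \<mu>) * elt (- t))"
  proof (intro sum.cong refl)
    fix t assume "t \<in> SymP (sum_list \<mu>)"
    then have "elt t * conj_young \<mu> = conj_young \<mu> * elt t" by (intro conj_young_commute) auto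
    then show "(conj_young \<mu> * elt t) * young \<mu> * elt (- t) = elt t * (conj_young \<mu> * young \<mu>) * elt (- t)" by (metis mult.assoc)
  qed
  also have "\<dots> = scal ((kappa \<mu>)\<^sup>2) * conj_young \<mu>"
    unfolding conj_young_young[OF s] by (simp add: conj_young_def sum_distrib_left scal_commute_left mult.assoc)
  finally show ?thesis .
qed

lemma conj_young_orthogonal:
  assumes \<mu>: "\<mu> \<in> partitions n" and \<nu>: "\<nu> \<in> partitions n" and ne: "\<mu> \<noteq> \<nu>"
  shows "conj_young \<mu> * conj_young \<nu> = 0"
proof -
  have n: "sum_list \<mu> = n" "sum_list \<nu> = n" using \<mu> \<nu> by (auto simp: partitions_def)
  have "conj_young \<mu> * conj_young \<nu> = (\<Sum>t\<in>SymP n. \<Sum>s\<in>SymP n. elt t * young \<mu> * elt (- t) * (elt s * young \<nu> * elt (- s)))"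
    unfolding conj_young_def n by (rule sum_product)
  also have "\<dots> = (\<Sum>t\<in>SymP n. \<Sum>s\<in>SymP n. elt t * (young \<mu> * elt (- t + s) * young \<nu>) * elt (- s))"
    by (intro sum.cong refl) (simp only: mult.assoc elt_mult_left)
  also have "\<dots> = 0"
    by (intro sum.neutral ballI) (subst young_orthogonal[OF \<mu> \<nu> ne], auto)
  finally show ?thesis .
qed

lemma lookup_conj_young_zero: "lookup (conj_young \<mu>) 0 = fact (sum_list \<mu>)"
proof -
  have "lookup (elt t * young \<mu> * elt (- t)) 0 = 1" for t :: fperm
    by (simp add: lookup_mult_single_left lookup_mult_single_right lookup_young_zero)
  then show ?thesis by (simp add: conj_young_def lookup_sum card_SymP)
qed

lemma lookup_conj:
  "lookup (elt t * x * elt (- t)) g = (lookup x (- t + g + t) :: 'r :: semiring_1)"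
  by (simp add: lookup_mult_single_left lookup_mult_single_right add.assoc)

lemma lookup_conj_young_conj:
  assumes "h \<in> SymP (sum_list \<mu>)"
  shows "lookup (conj_young \<mu>) (h + g - h) = lookup (conj_young \<mu>) g"
proof -
  have "elt h * conj_young \<mu> = conj_young \<mu> * elt h" using assms by (intro conj_young_commute) auto
  then have "lookup (elt h * conj_young \<mu>) (h + g) = lookup (conj_young \<mu> * elt h) (h + g)" by simp
  then show ?thesis by (simp add: lookup_mult_single_left lookup_mult_single_right flip: add.assoc)
qed

section \<open>Jucys--Murphy elements\<close>

definition JM :: "nat \<Rightarrow> fperm \<Rightarrow>\<^sub>0 'r :: semiring_1"
  where "JM k = (\<Sum>l<k. elt (transp l k))"

lemma JM_group_ring: "k < n \<Longrightarrow> JM k \<in> group_ring n"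
  unfolding JM_def by (intro group_ring_sum group_ring_single transp_SymP) auto

text \<open>
  Giving the point \<open>k\<close> the label \<open>i\<close> replaces the stabilizer of \<open>k\<close> in the Young subgroup by a larger group,
  in which the transpositions of \<open>k\<close> with the points labelled \<open>i\<close>, together with the identity, represent the
  cosets of that stabilizer.
\<close>

lemma stab_sum_move_up:
  fixes \<rho> :: "nat \<Rightarrow> nat"
  assumes k: "k < n" and i: "i \<noteq> \<rho> k"
  shows "stab_sum n (\<rho>(k := i)) = (1 + (\<Sum>l\<in>{l. l < n \<and> \<rho> l = i}. elt (transp l k))) * (\<Sum>s\<in>{s \<in> Stab n \<rho>. fun_of s k = k}. elt s)"
proof -
  let ?R = "{l. l < n \<and> \<rho> l = i}" and ?S = "{s \<in> Stab n \<rho>. fun_of s k = k}" and ?\<rho> = "\<rho>(k := i)"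
  have "bij_betw (\<lambda>(l, s). transp l k + s) (insert k ?R \<times> ?S) (Stab n ?\<rho>)"
  proof (rule bij_betwI[of _ _ _ "\<lambda>s. (fun_of s k, transp (fun_of s k) k + s)"])
    show "(\<lambda>(l, s). transp l k + s) \<in> insert k ?R \<times> ?S \<rightarrow> Stab n ?\<rho>"
    proof clarify
      fix l s assume l: "l \<in> insert k ?R" and s: "s \<in> Stab n \<rho>" "fun_of s k = k"
      have "transp l k + s \<in> SymP n" using l s k by (auto simp: Stab_def)
      moreover have "?\<rho> (fun_of (transp l k + s) x) = ?\<rho> x" if x: "x < n" for x
      proof (cases "x = k")
        case True
        then show ?thesis using l s i by auto
      next
        case False
        then have "fun_of s x \<noteq> k" using s(2) by (metis fun_of_inj)
        then show ?thesis using False l s i x by (auto simp: Stab_def Transposition.transpose_def)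
      qed
      ultimately show "transp l k + s \<in> Stab n ?\<rho>" unfolding Stab_def by blast
    qed
    show "(\<lambda>s. (fun_of s k, transp (fun_of s k) k + s)) \<in> Stab n ?\<rho> \<rightarrow> insert k ?R \<times> ?S"
    proof
      fix s assume s: "s \<in> Stab n ?\<rho>"
      let ?l = "fun_of s k"
      have sn: "s \<in> SymP n" using s by (simp add: Stab_def)
      have sr: "?\<rho> (fun_of s x) = ?\<rho> x" if "x < n" for x using s that unfolding Stab_def by blast
      have ln: "?l < n" using SymP_less[OF sn] k by simp
      have l: "?l \<in> insert k ?R" using sr[OF k] ln by (auto split: if_splits)
      have "\<rho> (fun_of (transp ?l k + s) x) = \<rho> x" if x: "x < n" for x
      proof (cases "x = k")
        case False
        then have "fun_of s x \<noteq> ?l" by simp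
        then show ?thesis using sr[OF x] False l by (auto simp: Transposition.transpose_def split: if_splits)
      qed simp
      moreover have "transp ?l k + s \<in> SymP n" using sn ln k by auto
      ultimately show "(?l, transp ?l k + s) \<in> insert k ?R \<times> ?S" using l by (auto simp: Stab_def)
    qed
  qed (auto simp: add.assoc[symmetric])
  then have "stab_sum n ?\<rho> = (\<Sum>(l, s)\<in>insert k ?R \<times> ?S. elt (transp l k + s))"
    unfolding stab_sum_def by (subst sum.reindex_bij_betw[symmetric, of _ "insert k ?R \<times> ?S"]) (auto simp: case_prod_unfold)
  also have "\<dots> = (\<Sum>l\<in>insert k ?R. elt (transp l k)) * (\<Sum>s\<in>?S. elt s)"
    by (simp add: sum_product mult_single sum.cartesian_product)
  also have "(\<Sum>l\<in>insert k ?R. elt (transp l k)) = 1 + (\<Sum>l\<in>?R. elt (transp l k) :: fperm \<Rightarrow>\<^sub>0 rat)"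
    using i by (subst sum.insert) auto
  finally show ?thesis .
qed

text \<open>
  Move \<open>k\<close> up into row \<open>i\<close>. Then too many entries lie in the first \<open>i + 1\<close> rows for the new row sum to
  survive next to the column sum, so \<open>1 + \<Sum> (l k)\<close>, summed over the entries \<open>l\<close> of row \<open>i\<close>, annihilates the
  Young symmetrizer.
\<close>

lemma row_above_young:
  assumes \<mu>: "\<mu> \<in> partitions n" and k: "k < n" and i: "i < rowf \<mu> k"
  shows "(\<Sum>l\<in>{l. l < n \<and> rowf \<mu> l = i}. elt (transp l k)) * young \<mu> = - young \<mu>"
proof -
  have n: "sum_list \<mu> = n" "sorted_wrt (\<ge>) \<mu>" using \<mu> by (auto simp: partitions_def)
  let ?\<rho> = "(rowf \<mu>)(k := i)" and ?S = "{s \<in> Stab n (rowf \<mu>). fun_of s k = k}"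
  define X where "X = (1 + (\<Sum>l\<in>{l. l < n \<and> rowf \<mu> l = i}. elt (transp l k)) :: fperm \<Rightarrow>\<^sub>0 rat)"
  let ?a = "stab_sum n (rowf \<mu>)" and ?b = "alt_sum n (colf \<mu>)"
  have "stab_sum n ?\<rho> * ?a * ?b = 0"
  proof (rule row_group_ring_column_zero, rule ccontr)
    fix g assume g: "g \<in> SymP n" and nz: "stab_sum n ?\<rho> * elt g * ?b \<noteq> 0"
    have "card {x. x < n \<and> ?\<rho> x < Suc i} \<le> sum_list (take (Suc i) \<mu>)"
      using row_bound_if_nonzero[of \<mu> g ?\<rho> "Suc i"] g nz n by simp
    moreover have "{x. x < n \<and> ?\<rho> x < Suc i} = insert k {x. x < n \<and> rowf \<mu> x < Suc i}" using k by auto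
    moreover have "k \<notin> {x. x < n \<and> rowf \<mu> x < Suc i}" using i by auto
    ultimately show False using card_rowf_less[of \<mu> "Suc i"] n by simp
  qed simp
  moreover have "(\<Sum>s\<in>?S. elt s) * ?a = scal (of_nat (card ?S)) * ?a"
  proof -
    have "(\<Sum>s\<in>?S. elt s) * ?a = (\<Sum>s\<in>?S. ?a)"
      unfolding sum_distrib_right by (intro sum.cong refl stab_sum_left) auto
    then show ?thesis by (simp add: single_of_nat)
  qed
  ultimately have "scal (of_nat (card ?S)) * (X * young \<mu>) = 0"
    using stab_sum_move_up[OF k, of i "rowf \<mu>"] i
    by (simp add: X_def[symmetric] young_def n mult.assoc scal_commute_left flip: mult.assoc[of "sum _ _"])
  then have "scal (inverse (of_nat (card ?S))) * (scal (of_nat (card ?S)) * (X * young \<mu>)) = 0" by simp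
  moreover have "card ?S \<noteq> 0" using card_gt_0_iff[of ?S] by (auto intro!: exI[of _ 0])
  ultimately have "X * young \<mu> = 0" by (simp add: scal_mult_left)
  then show ?thesis by (simp add: X_def distrib_right add_eq_0_iff)
qed

text \<open>
  The entries below \<open>k\<close> fill the rows above that of \<open>k\<close> and the part of its own row to the left of it. Each
  full row contributes \<open>-1\<close>, and each entry to the left contributes \<open>1\<close> because the row sum absorbs its
  transposition with \<open>k\<close>.
\<close>

lemma JM_young:
  assumes \<mu>: "\<mu> \<in> partitions n" and k: "k < n"
  shows "JM k * young \<mu> = scal (of_int (content (rowf \<mu> k, colf \<mu> k))) * young \<mu>"
proof -
  have n: "sum_list \<mu> = n" using \<mu> by (auto simp: partitions_def)
  let ?i = "rowf \<mu> k" and ?y = "young \<mu>"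
  let ?R = "\<lambda>i. {l \<in> {..<k}. rowf \<mu> l = i}"
  have kn: "k < sum_list \<mu>" using k n by simp
  have ti: "sum_list (take ?i \<mu>) \<le> k" and kc: "k = sum_list (take ?i \<mu>) + colf \<mu> k"
    using entry_pos[OF kn] by (auto simp: entry_def)
  have row_le: "rowf \<mu> l < Suc ?i" if "l < k" for l
    using that kn rowf_less_iff[of l \<mu> "Suc ?i"] rowf_less_iff[of k \<mu> "Suc ?i"] by simp
  have "JM k * ?y = (\<Sum>l<k. elt (transp l k) * ?y)" by (simp add: JM_def sum_distrib_right)
  also have "\<dots> = (\<Sum>i<Suc ?i. \<Sum>l\<in>?R i. elt (transp l k) * ?y)"
    by (rule sum.group[symmetric]) (use row_le in auto)
  also have "\<dots> = (\<Sum>i<?i. - ?y) + (\<Sum>l\<in>?R ?i. ?y)"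
    unfolding sum.lessThan_Suc
  proof (intro arg_cong2[of _ _ _ _ "(+)"] sum.cong refl)
    fix i assume "i \<in> {..<?i}"
    then have i: "i < ?i" by simp
    have "l < k" if "l < n" "rowf \<mu> l = i" for l
      using rowf_less_iff[of l \<mu> ?i] that i ti n by simp
    then have "?R i = {l. l < n \<and> rowf \<mu> l = i}" using k by auto
    then show "(\<Sum>l\<in>?R i. elt (transp l k) * ?y) = - ?y"
      using row_above_young[OF \<mu> k i] by (simp add: sum_distrib_right)
  next
    fix l assume "l \<in> ?R ?i"
    then have "transp l k \<in> Stab n (rowf \<mu>)" using k by (intro transp_Stab) auto
    then show "elt (transp l k) * ?y = ?y" by (simp add: young_def n stab_sum_left flip: mult.assoc)
  qed
  also have "card (?R ?i) = colf \<mu> k"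
  proof -
    have "?R ?i = {sum_list (take ?i \<mu>)..<k}"
    proof (intro equalityI subsetI)
      fix l assume "l \<in> ?R ?i"
      then show "l \<in> {sum_list (take ?i \<mu>)..<k}" using rowf_less_iff[of l \<mu> ?i] kn by auto
    next
      fix l assume "l \<in> {sum_list (take ?i \<mu>)..<k}"
      then show "l \<in> ?R ?i" using rowf_less_iff[of l \<mu> ?i] row_le[of l] kn by auto
    qed
    then show ?thesis using kc by simp
  qed
  then have "(\<Sum>i<?i. - ?y) + (\<Sum>l\<in>?R ?i. ?y) = scal (of_int (content (?i, colf \<mu> k))) * ?y"
    by (simp add: single_of_nat single_diff content_def left_diff_distrib)
  finally show ?thesis .
qed

section \<open>Cycle types and conjugacy\<close>

abbreviation orb :: "fperm \<Rightarrow> nat \<Rightarrow> nat set"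
  where "orb g \<equiv> orbit (fun_of g)"

definition orbs :: "nat \<Rightarrow> fperm \<Rightarrow> nat set set"
  where "orbs n g = orb g ` {..<n}"

lemma self_orb [simp]: "x \<in> orb g x"
  by (simp add: permutation_self_in_orbit)

lemma orb_eq: "y \<in> orb g x \<Longrightarrow> orb g y = orb g x"
  using orbit_cyclic_eq3[OF cyclic_on_orbit'[OF permutation_fun_of]] by metis

lemma orb_eq_iff: "orb g y = orb g x \<longleftrightarrow> y \<in> orb g x"
  using orb_eq self_orb by metis

lemma finite_orb [simp]: "finite (orb g x)"
  by (simp add: finite_orbit)

lemma card_orb_pos [simp]: "card (orb g x) > 0"
  using self_orb card_gt_0_iff finite_orb by blast

lemma orb_subset: "g \<in> SymP n \<Longrightarrow> x < n \<Longrightarrow> orb g x \<subseteq> {..<n}"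
  using permutes_orbit_subset[of "fun_of g" "{..<n}" x] by (simp add: SymP_def)

lemma finite_orbs [simp]: "finite (orbs n g)"
  by (simp add: orbs_def)

lemma orbs_disjoint: "A \<in> orbs n g \<Longrightarrow> B \<in> orbs n g \<Longrightarrow> x \<in> A \<Longrightarrow> x \<in> B \<Longrightarrow> A = B"
  unfolding orbs_def using orb_eq by blast

lemma Union_orbs: "g \<in> SymP n \<Longrightarrow> \<Union> (orbs n g) = {..<n}"
  using orb_subset by (force simp: orbs_def)

lemma orbs_mem: "A \<in> orbs n g \<Longrightarrow> x \<in> A \<Longrightarrow> A = orb g x"
  by (auto simp: orbs_def orb_eq)

text \<open>
  A cycle is parametrized by the residues modulo its length.
\<close>

lemma funpow_orb_eq_iff:
  "(fun_of g ^^ i) x = (fun_of g ^^ j) x \<longleftrightarrow> i mod card (orb g x) = j mod card (orb g x)"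
proof -
  let ?f = "fun_of g" and ?m = "funpow_dist1 (fun_of g) x x"
  have inj: "inj_on (\<lambda>k. (?f ^^ k) x) {0..<?m}"
    by (rule inj_on_funpow_dist1) (simp add: permutation_self_in_orbit)
  have "orb g x = (\<lambda>k. (?f ^^ k) x) ` {0..<?m}"
    by (rule orbit_conv_funpow_dist1) simp
  then have m: "card (orb g x) = ?m" using card_image[OF inj] by simp
  have "(?f ^^ ?m) x = x" by (rule funpow_dist1_prop) simp
  then have *: "(?f ^^ (k mod ?m)) x = (?f ^^ k) x" for k by (rule funpow_mod_eq)
  have "(?f ^^ i) x = (?f ^^ j) x \<longleftrightarrow> (?f ^^ (i mod ?m)) x = (?f ^^ (j mod ?m)) x" unfolding * ..
  also have "\<dots> \<longleftrightarrow> i mod ?m = j mod ?m"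
    using inj_on_eq_iff[OF inj, of "i mod ?m" "j mod ?m"] by simp
  finally show ?thesis unfolding m .
qed

lemma orb_funpow: "y \<in> orb g x \<Longrightarrow> \<exists>i. y = (fun_of g ^^ i) x"
  by (auto simp: orbit_altdef)

lemma funpow_in_orb: "(fun_of g ^^ i) x \<in> orb g x"
  by (rule funpow_in_orbit) simp

lemma ex_bij_betw_fibres:
  assumes "finite A" "finite B" "image_mset f (mset_set A) = image_mset f' (mset_set B)"
  shows "\<exists>\<beta>. bij_betw \<beta> A B \<and> (\<forall>x\<in>A. f' (\<beta> x) = f x)"
  using assms
proof (induction A arbitrary: B)
  case empty
  then have "B = {}" by (metis image_mset_is_empty_iff mset_set_empty_iff mset_set.empty)
  then show ?case by (auto simp: bij_betw_def)
next
  case (insert a A)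
  then have "f a \<in># image_mset f' (mset_set B)" by (metis add_mset_add_single image_mset_add_mset mset_set.insert union_single_eq_member)
  then obtain b where b: "b \<in> B" "f' b = f a" using insert.prems(1) by auto
  have "mset_set B = add_mset b (mset_set (B - {b}))" using b insert.prems(1) by (metis mset_set.remove)
  then have "image_mset f (mset_set A) = image_mset f' (mset_set (B - {b}))"
    using insert.prems(2) insert.hyps b(2) by simp
  then obtain \<beta> where \<beta>: "bij_betw \<beta> A (B - {b})" "\<forall>x\<in>A. f' (\<beta> x) = f x"
    using insert.IH[of "B - {b}"] insert.prems(1) by auto
  have "bij_betw (\<beta>(a := b)) A (B - {b})"
    using \<beta>(1) insert.hyps(2) by (subst bij_betw_cong[of _ _ \<beta>]) auto
  then have "bij_betw (\<beta>(a := b)) ({a} \<union> A) ({b} \<union> (B - {b}))"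
    by (intro bij_betw_combine) (auto simp: bij_betw_def)
  then have "bij_betw (\<beta>(a := b)) (insert a A) B" using b(1) by (simp add: insert_absorb del: fun_upd_apply)
  moreover have "\<forall>x\<in>insert a A. f' ((\<beta>(a := b)) x) = f x" using \<beta>(2) b insert.hyps(2) by auto
  ultimately show ?case by blast
qed

lemma cycle_type_eq_imp_mset:
  "cycle_type n (fun_of g) = cycle_type n (fun_of h) \<Longrightarrow> image_mset card (mset_set (orbs n g)) = image_mset card (mset_set (orbs n h))"
  unfolding cycle_type_def orbs_def by (metis mset_sorted_list_of_multiset rev_rev_ident)

text \<open>
  Match the cycles of \<open>g\<close> with cycles of \<open>h\<close> of the same length, choose a base point in every cycle, and send
  the \<open>i\<close>-th successor of a base point of \<open>g\<close> to the \<open>i\<close>-th successor of the matching base point of \<open>h\<close>.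
\<close>

lemma cycle_type_eq_imp_conj:
  assumes g: "g \<in> SymP n" and h: "h \<in> SymP n" and ct: "cycle_type n (fun_of g) = cycle_type n (fun_of h)"
  shows "\<exists>t\<in>SymP n. h = t + g - t"
proof -
  obtain \<beta> where \<beta>: "bij_betw \<beta> (orbs n g) (orbs n h)" "\<And>A. A \<in> orbs n g \<Longrightarrow> card (\<beta> A) = card A"
    using ex_bij_betw_fibres[OF _ _ cycle_type_eq_imp_mset[OF ct]] by auto
  define a where "a A = (SOME x. x \<in> A)" for A :: "nat set"
  have a: "a (orb g x) \<in> orb g x" for x and g unfolding a_def by (rule someI) (rule self_orb)
  define b where "b x = a (\<beta> (orb g x))" for x
  have \<beta>b: "\<beta> (orb g x) = orb h (b x)" if "x < n" for x
  proof -
    have "\<beta> (orb g x) \<in> orbs n h" using \<beta>(1) that by (auto simp: bij_betw_def orbs_def)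
    then obtain y where "\<beta> (orb g x) = orb h y" by (auto simp: orbs_def)
    then show ?thesis using orb_eq[OF a[of h y]] by (simp add: b_def)
  qed
  define i where "i x = (SOME i. x = (fun_of g ^^ i) (a (orb g x)))" for x
  have i: "x = (fun_of g ^^ i x) (a (orb g x))" for x
  proof -
    have "x \<in> orb g (a (orb g x))" unfolding orb_eq[OF a] by (rule self_orb)
    then have "\<exists>k. x = (fun_of g ^^ k) (a (orb g x))" by (rule orb_funpow)
    then show ?thesis unfolding i_def by (rule someI_ex[of "\<lambda>k. x = (fun_of g ^^ k) (a (orb g x))"])
  qed
  define \<tau> where "\<tau> x = (if x < n then (fun_of h ^^ i x) (b x) else x)" for x
  have \<tau>orb: "\<tau> x \<in> \<beta> (orb g x)" if "x < n" for x
    unfolding \<beta>b[OF that] using that by (simp add: \<tau>_def funpow_in_orb)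
  have \<beta>orbs: "\<beta> (orb g x) \<in> orbs n h" if "x < n" for x
    using \<beta>(1) that by (auto simp: bij_betw_def orbs_def)
  have \<tau>n: "\<tau> x < n" if "x < n" for x
    using \<tau>orb[OF that] \<beta>orbs[OF that] Union_orbs[OF h] by auto
  have card_eq: "card (orb h (b x)) = card (orb g (a (orb g x)))" if "x < n" for x
    using \<beta>(2)[of "orb g x"] that \<beta>b[OF that] orb_eq[OF a] by (simp add: orbs_def)
  have \<tau>pow: "\<tau> ((fun_of g ^^ j) (a (orb g x))) = (fun_of h ^^ j) (b x)" if "x < n" for x j
  proof -
    let ?y = "(fun_of g ^^ j) (a (orb g x))"
    have "?y \<in> orb g (a (orb g x))" by (rule funpow_in_orb)
    then have yo: "orb g ?y = orb g x" using orb_eq[OF a] orb_eq by metis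
    then have yn: "?y < n" using orb_subset[OF g that] self_orb by (metis lessThan_iff subsetD)
    have "(fun_of g ^^ i ?y) (a (orb g x)) = (fun_of g ^^ j) (a (orb g x))" using i[of ?y] yo by metis
    then have "(fun_of h ^^ i ?y) (b x) = (fun_of h ^^ j) (b x)"
      unfolding funpow_orb_eq_iff card_eq[OF that] .
    then show ?thesis using yn yo by (simp add: \<tau>_def b_def)
  qed
  have inj: "inj_on \<tau> {..<n}"
  proof (rule inj_onI)
    fix x y assume xy: "x \<in> {..<n}" "y \<in> {..<n}" "\<tau> x = \<tau> y"
    have "\<beta> (orb g x) = \<beta> (orb g y)"
      using xy \<tau>orb \<beta>orbs by (metis lessThan_iff orbs_disjoint)
    then have o: "orb g x = orb g y"
      using \<beta>(1) xy by (auto simp: bij_betw_def orbs_def dest: inj_onD)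
    then have "(fun_of h ^^ i x) (b x) = (fun_of h ^^ i y) (b x)" using xy by (simp add: \<tau>_def b_def)
    then have "(fun_of g ^^ i x) (a (orb g x)) = (fun_of g ^^ i y) (a (orb g x))"
      unfolding funpow_orb_eq_iff using card_eq xy by simp
    then show "x = y" using i[of x] i[of y] o by metis
  qed
  have "\<tau> ` {..<n} = {..<n}"
    by (rule endo_inj_surj) (use \<tau>n inj in auto)
  with inj have \<tau>p: "\<tau> permutes {..<n}"
    by (intro bij_imp_permutes) (auto simp: bij_betw_def \<tau>_def)
  moreover from this have "permutation \<tau>" by (meson finite_lessThan permutation_permutes)
  ultimately have t: "fun_of (mk_perm \<tau>) = \<tau>" "mk_perm \<tau> \<in> SymP n" by (simp_all add: SymP_def)
  have "fun_of h (\<tau> x) = \<tau> (fun_of g x)" for x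
  proof (cases "x < n")
    case True
    have "\<tau> (fun_of g x) = \<tau> ((fun_of g ^^ Suc (i x)) (a (orb g x)))" using i[of x] by simp
    also have "\<dots> = fun_of h (\<tau> x)" unfolding \<tau>pow[OF True] using True by (simp add: \<tau>_def)
    finally show ?thesis by simp
  next
    case False
    then show ?thesis using g h by (simp add: \<tau>_def SymP_fix SymP_less)
  qed
  then have "h + mk_perm \<tau> = mk_perm \<tau> + g" by (simp add: fun_of_inject[symmetric] fun_eq_iff t(1))
  then have "h = mk_perm \<tau> + g - mk_perm \<tau>" by (metis add_diff_cancel)
  then show ?thesis using t(2) by blast
qed

lemma cycle_type_uminus: "cycle_type n (fun_of (- g)) = cycle_type n (fun_of g)"
  by (simp add: cycle_type_def orbit_inv_eq)

lemma cycle_type_partition: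
  assumes "g \<in> SymP n"
  shows "cycle_type n (fun_of g) \<in> partitions n"
proof -
  let ?M = "image_mset card (mset_set (orbs n g))"
  have ct: "cycle_type n (fun_of g) = rev (sorted_list_of_multiset ?M)"
    by (simp add: cycle_type_def orbs_def)
  have "sum_list (cycle_type n (fun_of g)) = sum_mset ?M"
    unfolding ct by (metis mset_rev mset_sorted_list_of_multiset sum_mset_sum_list)
  also have "\<dots> = (\<Sum>A\<in>orbs n g. card A)" by (simp add: sum_unfold_sum_mset)
  also have "\<dots> = card (\<Union> (orbs n g))"
    by (rule card_Union_disjoint[symmetric])
       (use orbs_disjoint[of _ n g] in \<open>auto simp: pairwise_def disjnt_def orbs_def\<close>)
  also have "\<dots> = n" using Union_orbs[OF assms] by simp
  finally have "sum_list (cycle_type n (fun_of g)) = n" .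
  moreover have "0 \<notin> set (cycle_type n (fun_of g))"
    unfolding ct by (auto simp: orbs_def) (metis self_orb empty_iff)
  moreover have "sorted_wrt (\<ge>) (cycle_type n (fun_of g))"
    unfolding ct sorted_wrt_rev by simp
  ultimately show ?thesis by (simp add: partitions_def)
qed

lemma length_le_sum_list: "0 \<notin> set \<mu> \<Longrightarrow> length \<mu> \<le> sum_list (\<mu> :: nat list)"
  by (induction \<mu>) auto

lemma finite_partitions [simp]: "finite (partitions n)"
proof (rule finite_subset)
  show "partitions n \<subseteq> {xs. set xs \<subseteq> {..n} \<and> length xs \<le> n}"
    using length_le_sum_list member_le_sum_list by (fastforce simp: partitions_def)
qed (simp add: finite_lists_length_le)

section \<open>Completeness of the central idempotents\<close>

interpretation gring: vector_space "\<lambda>c (x :: fperm \<Rightarrow>\<^sub>0 rat). scal c * x"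
  by unfold_locales (simp_all add: single_add distrib_left distrib_right scal_mult_left)

definition class_sum :: "nat \<Rightarrow> nat list \<Rightarrow> fperm \<Rightarrow>\<^sub>0 rat"
  where "class_sum n \<alpha> = (\<Sum>g\<in>{g \<in> SymP n. cycle_type n (fun_of g) = \<alpha>}. elt g)"

lemma class_function_span:
  assumes x: "x \<in> group_ring n" and cl: "\<And>g h. g \<in> SymP n \<Longrightarrow> h \<in> SymP n \<Longrightarrow> lookup x (h + g - h) = lookup x g"
  shows "x \<in> gring.span (class_sum n ` partitions n)"
proof -
  define c where "c \<alpha> = lookup x (SOME g. g \<in> SymP n \<and> cycle_type n (fun_of g) = \<alpha>)" for \<alpha>
  have c: "c (cycle_type n (fun_of g)) = lookup x g" if g: "g \<in> SymP n" for g
  proof -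
    define g' where "g' = (SOME g'. g' \<in> SymP n \<and> cycle_type n (fun_of g') = cycle_type n (fun_of g))"
    have "g' \<in> SymP n \<and> cycle_type n (fun_of g') = cycle_type n (fun_of g)"
      unfolding g'_def by (rule someI[of _ g]) (use g in simp)
    then obtain t where "t \<in> SymP n" "g' = t + g - t" using cycle_type_eq_imp_conj[OF g] by metis
    then show ?thesis using cl[OF g] by (simp add: c_def g'_def[symmetric])
  qed
  have "x = (\<Sum>g\<in>SymP n. single g (lookup x g))" using group_ring_expand[OF x] by simp
  also have "\<dots> = (\<Sum>g\<in>SymP n. scal (c (cycle_type n (fun_of g))) * elt g)"
    by (intro sum.cong refl) (simp add: c mult_single)
  also have "\<dots> = (\<Sum>\<alpha>\<in>partitions n. \<Sum>g\<in>{g \<in> SymP n. cycle_type n (fun_of g) = \<alpha>}. scal (c (cycle_type n (fun_of g))) * elt g)"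
    by (rule sum.group[symmetric]) (auto simp: cycle_type_partition)
  also have "\<dots> = (\<Sum>\<alpha>\<in>partitions n. scal (c \<alpha>) * class_sum n \<alpha>)"
    by (simp add: class_sum_def sum_distrib_left)
  finally show ?thesis
    by (metis (no_types, lifting) gring.span_sum gring.span_scale gring.span_base imageI)
qed

text \<open>
  The central elements \<open>conj_young \<mu>\<close> are linearly independent, being orthogonal and not nilpotent, and they
  lie in the span of the class sums, of which there are no more than partitions. So they span the
  class functions, and 1 is a combination of them; multiplying it by each of them yields the
  coefficients.
\<close>

theorem completeness:
  "(\<Sum>\<mu>\<in>partitions n. scal (inverse ((kappa \<mu>)\<^sup>2)) * conj_young \<mu>) = 1"
proof -
  let ?P = "partitions n" and ?S = "conj_young ` partitions n"
  have P: "sum_list \<mu> = n" "sorted_wrt (\<ge>) \<mu>" if "\<mu> \<in> ?P" for \<mu> using that by (auto simp: partitions_def)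
  have nz: "conj_young \<mu> \<noteq> 0" for \<mu> using lookup_conj_young_zero[of \<mu>] by (metis fact_nonzero lookup_zero)
  have sq: "conj_young \<mu> * conj_young \<nu> = (if \<mu> = \<nu> then scal ((kappa \<nu>)\<^sup>2) * conj_young \<nu> else 0)" if "\<mu> \<in> ?P" "\<nu> \<in> ?P" for \<mu> \<nu>
    using conj_young_orthogonal[OF that] conj_young_square[OF P(2)[OF that(1)]] by (cases "\<mu> = \<nu>") simp_all
  have k: "kappa \<mu> \<noteq> 0" if "\<mu> \<in> ?P" for \<mu> using kappa_nonzero P(2)[OF that] .
  have inj: "inj_on conj_young ?P"
  proof (rule inj_onI, rule ccontr)
    fix \<mu> \<nu> assume *: "\<mu> \<in> ?P" "\<nu> \<in> ?P" "conj_young \<mu> = conj_young \<nu>" "\<mu> \<noteq> \<nu>"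
    then have "conj_young \<nu> * conj_young \<nu> = 0" using sq[of \<mu> \<nu>] by simp
    then have "scal ((kappa \<nu>)\<^sup>2) * conj_young \<nu> = scal 0 * conj_young \<nu>" using sq[of \<nu> \<nu>] * by simp
    then show False using scal_inject[OF _ nz] k *(2) by fastforce
  qed
  have mult: "(\<Sum>\<mu>\<in>?P. scal (u \<mu>) * conj_young \<mu>) * conj_young \<nu> = scal (u \<nu> * (kappa \<nu>)\<^sup>2) * conj_young \<nu>" if \<nu>: "\<nu> \<in> ?P" for u \<nu>
  proof -
    have "(\<Sum>\<mu>\<in>?P. scal (u \<mu>) * conj_young \<mu>) * conj_young \<nu> = (\<Sum>\<mu>\<in>?P. if \<mu> = \<nu> then scal (u \<nu> * (kappa \<nu>)\<^sup>2) * conj_young \<nu> else 0)"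
      unfolding sum_distrib_right by (intro sum.cong refl) (auto simp: mult.assoc sq \<nu> scal_mult_left)
    then show ?thesis using \<nu> by simp
  qed
  have indep: "gring.independent ?S"
  proof
    assume "gring.dependent ?S"
    then obtain u v where v: "v \<in> ?S" "u v \<noteq> 0" and 0: "(\<Sum>v\<in>?S. scal (u v) * v) = 0"
      by (subst (asm) gring.dependent_finite) auto
    from v obtain \<nu> where \<nu>: "\<nu> \<in> ?P" "v = conj_young \<nu>" by blast
    from 0 have "(\<Sum>\<mu>\<in>?P. scal (u (conj_young \<mu>)) * conj_young \<mu>) = 0" by (simp add: sum.reindex[OF inj])
    then have "scal (u v * (kappa \<nu>)\<^sup>2) * conj_young \<nu> = scal 0 * conj_young \<nu>" using mult[OF \<nu>(1), of "\<lambda>\<mu>. u (conj_young \<mu>)"] \<nu> by simp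
    then have "u v * (kappa \<nu>)\<^sup>2 = 0" by (rule scal_inject) (rule nz)
    then show False using v k[OF \<nu>(1)] by simp
  qed
  have sub: "?S \<subseteq> gring.span (class_sum n ` ?P)"
  proof clarify
    fix \<mu> assume "\<mu> \<in> ?P"
    then show "conj_young \<mu> \<in> gring.span (class_sum n ` ?P)"
      using conj_young_group_ring[of \<mu>] lookup_conj_young_conj[of _ \<mu>] by (intro class_function_span) (simp_all add: P)
  qed
  \<comment> \<open>Otherwise there would be more independent vectors than class sums.\<close>
  have "1 \<in> gring.span ?S"
  proof (rule ccontr)
    assume no: "1 \<notin> gring.span ?S"
    then have "gring.independent (insert 1 ?S)" using indep by (rule gring.independent_insertI)
    moreover have "1 \<in> gring.span (class_sum n ` ?P)"
    proof (rule class_function_span)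
      fix g h :: fperm
      have "h + g - h = 0 \<longleftrightarrow> g = 0" by (metis add.right_neutral add_left_cancel diff_add_cancel eq_iff_diff_eq_0 right_minus_eq)
      then show "lookup 1 (h + g - h) = lookup 1 g" by (simp add: lookup_one)
    qed simp
    ultimately have "card (insert 1 ?S) \<le> card (class_sum n ` ?P)"
      using gring.independent_span_bound[of "class_sum n ` ?P" "insert 1 ?S"] sub by auto
    moreover have "1 \<notin> ?S" using no gring.span_base by blast
    ultimately show False using card_image_le[of ?P "class_sum n"] card_image[OF inj] by simp
  qed
  then obtain u where "1 = (\<Sum>v\<in>?S. scal (u v) * v)" unfolding gring.span_finite[OF finite_imageI[OF finite_partitions]] by auto
  then have u: "1 = (\<Sum>\<mu>\<in>?P. scal (u (conj_young \<mu>)) * conj_young \<mu>)" by (simp add: sum.reindex[OF inj])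
  have "u (conj_young \<nu>) = inverse ((kappa \<nu>)\<^sup>2)" if \<nu>: "\<nu> \<in> ?P" for \<nu>
  proof -
    have "scal (u (conj_young \<nu>) * (kappa \<nu>)\<^sup>2) * conj_young \<nu> = scal 1 * conj_young \<nu>" using mult[OF \<nu>, of "\<lambda>\<mu>. u (conj_young \<mu>)"] u by simp
    then have "u (conj_young \<nu>) * (kappa \<nu>)\<^sup>2 = 1" by (rule scal_inject) (rule nz)
    then show ?thesis by (metis inverse_unique mult.commute)
  qed
  then show ?thesis using u by simp
qed

section \<open>Symmetric products of Jucys--Murphy elements\<close>

abbreviation comm :: "'r :: times \<Rightarrow> 'r \<Rightarrow> bool"
  where "comm x y \<equiv> x * y = y * x"

lemma comm_diff: "comm x y \<Longrightarrow> comm x z \<Longrightarrow> comm x (y - z :: 'r :: ring)"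
  by (simp add: left_diff_distrib right_diff_distrib)

lemma comm_mult: "comm x y \<Longrightarrow> comm x z \<Longrightarrow> comm x (y * z :: 'r :: semigroup_mult)"
  by (metis mult.assoc)

lemma comm_power: "comm x y \<Longrightarrow> comm x (y ^ k :: 'r :: monoid_mult)"
  by (metis power_commuting_commutes)

lemma comm_sum: "(\<And>i. i \<in> A \<Longrightarrow> comm x (h i)) \<Longrightarrow> comm x (sum h A :: 'r :: semiring_0)"
  by (simp add: sum_distrib_left sum_distrib_right)

lemma JM_conj:
  assumes g: "g \<in> SymP k" and k: "k \<le> j"
  shows "comm (elt g) (JM j :: fperm \<Rightarrow>\<^sub>0 'r :: semiring_1)"
proof -
  have gj: "g \<in> SymP j" using SymP_mono[OF k] g by blast
  have gjj: "fun_of g j = j" using SymP_fix[OF gj] by simp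
  have "elt g * JM j = (\<Sum>l<j. elt (transp (fun_of g l) j + g) :: fperm \<Rightarrow>\<^sub>0 'r)"
    by (simp add: JM_def sum_distrib_left mult_single transp_conj gjj)
  also have "\<dots> = (\<Sum>l<j. elt (transp l j + g))"
    using gj by (intro sum.reindex_bij_betw[of "fun_of g" "{..<j}" "{..<j}" "\<lambda>l. elt (transp l j + g)"])
      (auto simp: SymP_def permutes_imp_bij)
  also have "\<dots> = JM j * elt g" by (simp add: JM_def sum_distrib_right mult_single)
  finally show ?thesis .
qed

text \<open>
  The relations of the degenerate affine Hecke algebra.
\<close>

lemma elt_transp_JM:
  fixes n :: nat
  defines "s \<equiv> (elt (transp n (Suc n)) :: fperm \<Rightarrow>\<^sub>0 'r :: ring_1)"
  shows "s * JM n = JM (Suc n) * s - 1" "s * JM (Suc n) = JM n * s + 1"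
proof -
  have ss: "s * s = 1" by (simp add: s_def mult_single)
  have "s * JM n = (\<Sum>l<n. elt (transp l (Suc n) + transp n (Suc n)))"
    unfolding s_def JM_def sum_distrib_left
  proof (intro sum.cong refl)
    fix l assume "l \<in> {..<n}"
    then have "transp n (Suc n) + transp l n = transp l (Suc n) + transp n (Suc n)"
      using transp_conj[of "transp n (Suc n)" l n] by (simp add: Transposition.transpose_def)
    then show "elt (transp n (Suc n)) * elt (transp l n) = (elt (transp l (Suc n) + transp n (Suc n)) :: fperm \<Rightarrow>\<^sub>0 'r)"
      by (simp add: mult_single)
  qed
  also have "\<dots> = (\<Sum>l<n. elt (transp l (Suc n))) * s" by (simp add: s_def sum_distrib_right mult_single)
  also have "(\<Sum>l<n. elt (transp l (Suc n))) = JM (Suc n) - s" by (simp add: JM_def s_def)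
  finally show 1: "s * JM n = JM (Suc n) * s - 1" by (simp add: left_diff_distrib ss)
  have "s * JM (Suc n) = s * (JM (Suc n) * s) * s" by (simp add: ss mult.assoc)
  also have "JM (Suc n) * s = s * JM n + 1" using 1 by simp
  also have "s * (s * JM n + 1) * s = JM n * s + 1" by (simp add: distrib_left distrib_right ss flip: mult.assoc)
  finally show "s * JM (Suc n) = JM n * s + 1" .
qed

lemma JM_comm: "comm (JM n) (JM (Suc n) :: fperm \<Rightarrow>\<^sub>0 'r :: semiring_1)"
proof -
  have "comm (JM (Suc n)) (\<Sum>l<n. elt (transp l n) :: fperm \<Rightarrow>\<^sub>0 'r)"
    by (intro comm_sum) (metis JM_conj[of _ "Suc n" "Suc n"] transp_SymP le_refl lessI lessThan_iff less_SucI)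
  then show ?thesis by (metis JM_def)
qed

text \<open>
  Newton's recursion expresses power sums of two commuting elements by their sum and their product.
\<close>

lemma comm_power_sum:
  fixes x y s :: "'r :: ring_1"
  assumes xy: "comm x y" and 1: "comm s (x + y)" and 2: "comm s (x * y)"
  shows "comm s (x ^ m + y ^ m)"
proof (induction m rule: less_induct)
  case (less m)
  consider "m = 0" | "m = 1" | k where "m = Suc (Suc k)" by (metis One_nat_def old.nat.exhaust)
  then show ?case
  proof cases
    case 1
    then show ?thesis by (simp add: mult_2 mult_2_right)
  next
    case 3
    have px: "x ^ k * y = y * x ^ k" and py: "y ^ k * x = x * y ^ k"
      using xy by (metis power_commuting_commutes)+
    have "x ^ m + y ^ m = (x + y) * (x ^ Suc k + y ^ Suc k) - (x * y) * (x ^ k + y ^ k)"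
      using xy px py by (simp add: 3 algebra_simps) (metis mult.assoc)
    moreover have "comm s \<dots>"
      using 3 by (intro comm_diff[OF comm_mult[OF 1 less.IH] comm_mult[OF 2 less.IH]]) simp_all
    ultimately show ?thesis by simp
  qed (use 1 in simp_all)
qed

lemma comm_symmetric_pair:
  fixes x y s :: "'r :: ring_1"
  assumes xy: "comm x y" and 1: "comm s (x + y)" and 2: "comm s (x * y)"
  shows "comm s (x ^ a * y ^ b + x ^ b * y ^ a)"
proof -
  have *: "x ^ a * y ^ (a + m) + x ^ (a + m) * y ^ a = (x * y) ^ a * (x ^ m + y ^ m)" for a m
  proof -
    have c: "x ^ i * y ^ j = y ^ j * x ^ i" for i j
      by (metis power_commuting_commutes xy)
    have "(x * y) ^ a = x ^ a * y ^ a"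
    proof (induction a)
      case (Suc a)
      then show ?case using c[of a 1] by (simp add: mult.assoc) (metis mult.assoc)
    qed simp
    then show ?thesis using c[of m a] by (simp add: power_add distrib_left mult.assoc add.commute)
  qed
  have "comm s (x ^ a * y ^ (a + m) + x ^ (a + m) * y ^ a)" for a m
    unfolding * by (intro comm_mult comm_power comm_power_sum assms)
  from this[of a "b - a"] this[of b "a - b"] show ?thesis
    by (cases "a \<le> b") (simp_all add: add.commute)
qed

text \<open>
  The series \<open>f(y J\<^sub>k)\<close> in \<open>y\<close>, and the product of the first \<open>n\<close> of them.
\<close>

definition JM_series :: "'a::field_char_0 fps \<Rightarrow> nat \<Rightarrow> (fperm \<Rightarrow>\<^sub>0 'a) fps"
  where "JM_series f k = Abs_fps (\<lambda>m. scal (f $ m) * JM k ^ m)"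

fun JM_product :: "'a::field_char_0 fps \<Rightarrow> nat \<Rightarrow> (fperm \<Rightarrow>\<^sub>0 'a) fps"
  where "JM_product f 0 = 1" | "JM_product f (Suc n) = JM_product f n * JM_series f n"

lemma comm_fps_const: "(\<And>m. comm x (F $ m)) \<Longrightarrow> comm (fps_const x) (F :: 'r :: semiring_1 fps)"
  by (simp add: fps_eq_iff)

lemma comm_scal [simp]: "comm x (scal a :: fperm \<Rightarrow>\<^sub>0 'r :: comm_semiring_1)"
  by (rule const_mult_commute)

lemma JM_series_comm:
  assumes "comm x (JM k)"
  shows "comm (fps_const x) (JM_series f k)"
  by (rule comm_fps_const) (unfold JM_series_def fps_nth_Abs_fps, intro comm_mult comm_scal comm_power assms)

text \<open>
  The transposition of two neighbours commutes with the sum and with the product of their Jucys--Murphy elements,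
  hence with every symmetric expression in them.
\<close>

lemma JM_series_pair_comm:
  fixes f :: "'a::field_char_0 fps"
  shows "comm (fps_const (elt (transp n (Suc n)))) (JM_series f n * JM_series f (Suc n))"
proof (rule comm_fps_const)
  fix m
  let ?s = "elt (transp n (Suc n)) :: fperm \<Rightarrow>\<^sub>0 'a" and ?x = "JM n :: fperm \<Rightarrow>\<^sub>0 'a" and ?y = "JM (Suc n) :: fperm \<Rightarrow>\<^sub>0 'a"
  note s = elt_transp_JM[of n, where 'r = 'a]
  have 1: "comm ?s (?x + ?y)" using s by (simp add: distrib_left distrib_right)
  have 2: "comm ?s (?x * ?y)"
  proof -
    have "?s * (?x * ?y) = ?y * (?s * ?y) - ?y" using s(1) by (simp add: left_diff_distrib flip: mult.assoc)
    also have "\<dots> = ?y * ?x * ?s" unfolding s(2) by (simp add: distrib_left mult.assoc)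
    finally show ?thesis using JM_comm[of n, where 'r = 'a] by simp
  qed
  define S where "S = (JM_series f n * JM_series f (Suc n)) $ m"
  have S: "S = (\<Sum>i=0..m. scal (f $ i * f $ (m - i)) * (?x ^ i * ?y ^ (m - i)))"
  proof -
    have "S = (\<Sum>i=0..m. scal (f $ i) * ?x ^ i * (scal (f $ (m - i)) * ?y ^ (m - i)))"
      by (simp add: S_def fps_mult_nth JM_series_def)
    also have "\<dots> = (\<Sum>i=0..m. scal (f $ i * f $ (m - i)) * (?x ^ i * ?y ^ (m - i)))"
      by (intro sum.cong refl) (simp only: mult.assoc scal_commute_left[of "?x ^ _"] scal_mult_left)
    finally show ?thesis .
  qed
  have "S = (\<Sum>i=0..m. scal (f $ (m - i) * f $ i) * (?x ^ (m - i) * ?y ^ i))"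
    unfolding S by (subst sum.atLeastAtMost_rev) (auto intro!: sum.cong)
  with S have "S + S = (\<Sum>i=0..m. scal (f $ i * f $ (m - i)) * (?x ^ i * ?y ^ (m - i) + ?x ^ (m - i) * ?y ^ i))"
    by (simp add: distrib_left sum.distrib mult.commute[of "f $ (m - _)"])
  \<comment> \<open>Symmetrizing produces twice the coefficient; the factor 2 is cancelled coefficientwise below.\<close>
  then have "comm ?s (S + S)"
    using comm_symmetric_pair[OF JM_comm 1 2] by (auto intro!: comm_sum comm_mult simp: const_mult_commute)
  then have "(?s * S - S * ?s) + (?s * S - S * ?s) = 0" by (simp add: algebra_simps)
  then have "lookup (?s * S - S * ?s) g + lookup (?s * S - S * ?s) g = 0" for g
    by (metis lookup_add lookup_zero)
  then have "?s * S - S * ?s = 0" by (intro poly_mapping_eqI) (simp flip: mult_2)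
  then show "comm ?s ((JM_series f n * JM_series f (Suc n)) $ m)" by (simp add: S_def)
qed

lemma JM_product_comm_disjoint:
  assumes "\<And>g. g \<in> SymP n \<Longrightarrow> g + h = h + g"
  shows "comm (fps_const (elt h)) (JM_product f n)"
  using assms
proof (induction n)
  case (Suc n)
  have "comm (fps_const (elt h)) (JM_product f n)"
    using Suc.prems SymP_mono[of n "Suc n"] by (intro Suc.IH) auto
  moreover have "comm (elt h) (JM n :: fperm \<Rightarrow>\<^sub>0 'a)"
    using Suc.prems unfolding JM_def by (intro comm_sum) (simp add: mult_single transp_SymP)
  ultimately show ?case using comm_mult[OF _ JM_series_comm] by (metis JM_product.simps(2))
qed simp

lemma SymP_Suc_decomp:
  assumes g: "g \<in> SymP (Suc n)"
  shows "\<exists>l h. l \<le> n \<and> h \<in> SymP n \<and> g = transp l n + h"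
proof -
  let ?l = "fun_of g n"
  have l: "?l \<le> n" using SymP_less[OF g, of n] by simp
  have "transp ?l n + g \<in> SymP (Suc n)" using g l by (intro SymP_plus transp_SymP) auto
  moreover have "fun_of (transp ?l n + g) n = n" by simp
  ultimately have "fun_of (transp ?l n + g) permutes {..<n}"
    unfolding SymP_def by (simp add: permutes_def lessThan_Suc del: fun_of_plus)
       (metis (mono_tags, lifting) insert_iff lessThan_iff)
  then have "transp ?l n + g \<in> SymP n" by (simp add: SymP_def)
  moreover have "g = transp ?l n + (transp ?l n + g)" by simp
  ultimately show ?thesis using l by blast
qed

lemma fps_const_elt_mult: "fps_const (elt g) * fps_const (elt h) = (fps_const (elt (g + h)) :: (fperm \<Rightarrow>\<^sub>0 'r :: semiring_1) fps)"
  by (simp add: mult_single)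

lemma comm_left_mult: "comm x z \<Longrightarrow> comm y z \<Longrightarrow> comm (x * y) (z :: 'r :: semigroup_mult)"
  by (metis mult.assoc)

text \<open>
  The group of \<open>n + 1\<close> points is generated by that of \<open>n\<close> points and the transposition of the last two.
  The former commutes with the new factor, and the latter commutes with the product of the last two factors and with all
  earlier ones.
\<close>

lemma JM_product_central:
  assumes "g \<in> SymP n"
  shows "comm (fps_const (elt g)) (JM_product f n)"
  using assms
proof (induction n arbitrary: g)
  case (Suc n)
  have A: "comm (fps_const (elt g)) (JM_product f (Suc n))" if g: "g \<in> SymP n" for g
    using comm_mult[OF Suc.IH[OF g] JM_series_comm[OF JM_conj[OF g le_refl]]] by simp
  have B: "comm (fps_const (elt (transp l n))) (JM_product f (Suc n))" if l: "l < n" for l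
  proof -
    obtain m where m: "n = Suc m" using l by (cases n) auto
    have "comm (fps_const (elt (transp m n))) (JM_product f m)"
      by (rule JM_product_comm_disjoint) (simp add: transp_conj SymP_fix m)
    then have s: "comm (fps_const (elt (transp m n))) (JM_product f (Suc n))"
      using comm_mult[OF _ JM_series_pair_comm[of m f], of "JM_product f m"] by (simp add: m mult.assoc)
    have "transp l n = transp l m + transp m n + transp l m"
      using l m by (auto simp: fun_of_inject[symmetric] fun_eq_iff Transposition.transpose_def)
    then have "fps_const (elt (transp l n)) = fps_const (elt (transp l m)) * fps_const (elt (transp m n)) * (fps_const (elt (transp l m)) :: (fperm \<Rightarrow>\<^sub>0 'a) fps)"
      by (simp add: fps_const_elt_mult del: fps_const_mult)
    then show ?thesis using A[of "transp l m"] s l m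
      by (metis comm_left_mult transp_SymP lessI)
  qed
  obtain l h where lh: "l \<le> n" "h \<in> SymP n" "g = transp l n + h" using SymP_Suc_decomp[OF Suc.prems] by blast
  have "comm (fps_const (elt (transp l n))) (JM_product f (Suc n))"
    using lh(1) B[of l] by (cases "l = n") auto
  then have "comm (fps_const (elt (transp l n)) * fps_const (elt h)) (JM_product f (Suc n))"
    using A[OF lh(2)] by (rule comm_left_mult)
  then show ?case by (simp only: fps_const_elt_mult lh(3))
qed simp

section \<open>The content product through central elements\<close>

definition of_rat_ring :: "(fperm \<Rightarrow>\<^sub>0 rat) \<Rightarrow> fperm \<Rightarrow>\<^sub>0 'a::field_char_0"
  where "of_rat_ring = Poly_Mapping.map of_rat"

lemma lookup_of_rat_ring [simp]: "lookup (of_rat_ring x) g = of_rat (lookup x g)"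
  by (simp add: of_rat_ring_def Poly_Mapping.map.rep_eq when_def)

lemma of_rat_ring_mult: "of_rat_ring (x * y) = of_rat_ring x * of_rat_ring y"
proof (rule poly_mapping_eqI)
  fix g
  have k: "keys (of_rat_ring x :: fperm \<Rightarrow>\<^sub>0 'a) = keys x" by (auto simp: in_keys_iff)
  show "lookup (of_rat_ring (x * y)) g = (lookup (of_rat_ring x * of_rat_ring y) g :: 'a)"
    by (simp add: lookup_group_mult[OF finite_keys order_refl] k of_rat_sum of_rat_mult)
qed

lemma of_rat_ring_sum: "of_rat_ring (sum h A) = (\<Sum>i\<in>A. of_rat_ring (h i))"
  by (rule poly_mapping_eqI) (simp add: lookup_sum of_rat_sum)

lemma of_rat_ring_single [simp]: "of_rat_ring (single g a) = single g (of_rat a)"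
  by (rule poly_mapping_eqI) (auto simp: lookup_single when_def)

lemma of_rat_ring_one [simp]: "of_rat_ring 1 = 1"
  using of_rat_ring_single[of 0 1] by simp

lemma of_rat_ring_JM [simp]: "of_rat_ring (JM k) = JM k"
  by (simp add: JM_def of_rat_ring_sum)

definition lift_const :: "'a::field_char_0 fps \<Rightarrow> (fperm \<Rightarrow>\<^sub>0 'a) fps"
  where "lift_const h = Abs_fps (\<lambda>m. scal (h $ m))"

lemma lift_const_nth [simp]: "lift_const h $ m = scal (h $ m)"
  by (simp add: lift_const_def)

lemma single_sum: "single k (sum h A) = (\<Sum>i\<in>A. single k (h i))"
  by (induction A rule: infinite_finite_induct) (simp_all add: single_add)

lemma lift_const_mult: "lift_const (g * h) = lift_const g * lift_const h"
  by (rule fps_ext) (simp only: lift_const_nth fps_mult_nth single_sum mult_single add_0_left)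

lemma lift_const_one [simp]: "lift_const 1 = 1"
proof (rule fps_ext)
  show "lift_const 1 $ n = (1 :: (fperm \<Rightarrow>\<^sub>0 'a) fps) $ n" for n by (cases n) simp_all
qed

lemma lift_const_comm: "comm x (lift_const h)"
proof (rule fps_ext)
  fix n
  have "(x * lift_const h) $ n = (\<Sum>i=0..n. scal (h $ (n - i)) * x $ i)"
    by (simp add: fps_mult_nth const_mult_commute)
  also have "\<dots> = (\<Sum>i=0..n. scal (h $ i) * x $ (n - i))"
    by (subst sum.atLeastAtMost_rev) (auto intro!: sum.cong)
  finally show "(x * lift_const h) $ n = (lift_const h * x) $ n" by (simp add: fps_mult_nth)
qed

definition content_factor :: "'a::field_char_0 fps \<Rightarrow> nat \<times> nat \<Rightarrow> 'a fps"
  where "content_factor f c = f oo (fps_const (of_int (content c)) * fps_X)"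

lemma content_factor_nth [simp]: "content_factor f c $ m = of_int (content c) ^ m * f $ m"
  unfolding content_factor_def by (rule fps_nth_compose_linear)

lemma fps_const_sum: "fps_const (sum h A) = (\<Sum>i\<in>A. fps_const (h i))"
  by (rule fps_ext) (simp add: fps_sum_nth)

lemma JM_power_young:
  assumes \<mu>: "\<mu> \<in> partitions n" and k: "k < n"
  shows "JM k ^ m * of_rat_ring (young \<mu>) = scal (of_int (content (rowf \<mu> k, colf \<mu> k)) ^ m) * (of_rat_ring (young \<mu>) :: fperm \<Rightarrow>\<^sub>0 'a::field_char_0)"
proof (induction m)
  case (Suc m)
  let ?c = "of_int (content (rowf \<mu> k, colf \<mu> k)) :: 'a"
  have *: "JM k * of_rat_ring (young \<mu>) = scal ?c * (of_rat_ring (young \<mu>) :: fperm \<Rightarrow>\<^sub>0 'a)"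
    using arg_cong[OF JM_young[OF \<mu> k], of "of_rat_ring :: _ \<Rightarrow> fperm \<Rightarrow>\<^sub>0 'a"] by (simp add: of_rat_ring_mult)
  have "JM k ^ Suc m * of_rat_ring (young \<mu>) = JM k * (JM k ^ m * (of_rat_ring (young \<mu>) :: fperm \<Rightarrow>\<^sub>0 'a))"
    by (simp add: mult.assoc)
  also have "\<dots> = scal (?c ^ Suc m) * of_rat_ring (young \<mu>)"
    by (simp only: Suc scal_commute_left[of "JM k"] * scal_mult_left power_Suc mult.commute)
  finally show ?case .
qed simp

lemma JM_series_young:
  assumes \<mu>: "\<mu> \<in> partitions n" and k: "k < n"
  shows "JM_series f k * fps_const (of_rat_ring (young \<mu>)) = lift_const (content_factor f (rowf \<mu> k, colf \<mu> k)) * fps_const (of_rat_ring (young \<mu>))"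
  by (rule fps_ext) (simp add: JM_series_def mult.assoc JM_power_young[OF assms] scal_mult_left mult.commute)

text \<open>
  Only the first \<open>k\<close> factors are applied, so that the induction can peel off the last one while \<open>\<mu>\<close> stays
  fixed.
\<close>

lemma JM_product_young_aux:
  assumes \<mu>: "\<mu> \<in> partitions n" and k: "k \<le> n"
  shows "JM_product f k * fps_const (of_rat_ring (young \<mu>)) = lift_const (\<Prod>j<k. content_factor f (rowf \<mu> j, colf \<mu> j)) * fps_const (of_rat_ring (young \<mu>))"
  using k
proof (induction k)
  case (Suc k)
  then have k: "k < n" by simp
  have "JM_product f (Suc k) * fps_const (of_rat_ring (young \<mu>)) = JM_product f k * (JM_series f k * fps_const (of_rat_ring (young \<mu>)))"
    by (simp add: mult.assoc)
  also have "\<dots> = JM_product f k * lift_const (content_factor f (rowf \<mu> k, colf \<mu> k)) * fps_const (of_rat_ring (young \<mu>))"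
    unfolding JM_series_young[OF \<mu> k] by (simp only: mult.assoc)
  also have "JM_product f k * lift_const (content_factor f (rowf \<mu> k, colf \<mu> k)) = lift_const (content_factor f (rowf \<mu> k, colf \<mu> k)) * JM_product f k"
    by (rule lift_const_comm)
  also have "\<dots> * fps_const (of_rat_ring (young \<mu>)) = lift_const (content_factor f (rowf \<mu> k, colf \<mu> k)) * (JM_product f k * fps_const (of_rat_ring (young \<mu>)))"
    by (rule mult.assoc)
  also have "\<dots> = lift_const (\<Prod>j<Suc k. content_factor f (rowf \<mu> j, colf \<mu> j)) * fps_const (of_rat_ring (young \<mu>))"
    using Suc by (simp add: lift_const_mult mult.assoc[symmetric] mult.commute[of "prod _ _"])
  finally show ?case .
qed simp

definition content_product :: "'a::field_char_0 fps \<Rightarrow> nat list \<Rightarrow> 'a fps"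
  where "content_product f \<mu> = (\<Prod>c\<in>cells \<mu>. content_factor f c)"

lemma JM_product_young:
  assumes \<mu>: "\<mu> \<in> partitions n"
  shows "JM_product f n * fps_const (of_rat_ring (young \<mu>)) = lift_const (content_product f \<mu>) * fps_const (of_rat_ring (young \<mu>))"
proof -
  have n: "sum_list \<mu> = n" using \<mu> by (simp add: partitions_def)
  have "(\<Prod>j<n. content_factor f (rowf \<mu> j, colf \<mu> j)) = (\<Prod>c\<in>cells \<mu>. content_factor f (rowf \<mu> (entry \<mu> c), colf \<mu> (entry \<mu> c)))"
    using prod.reindex_bij_betw[OF bij_betw_entry[of \<mu>], of "\<lambda>j. content_factor f (rowf \<mu> j, colf \<mu> j)"] n by simp
  also have "\<dots> = content_product f \<mu>" unfolding content_product_def by (intro prod.cong refl) auto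
  finally show ?thesis using JM_product_young_aux[OF \<mu> le_refl] by metis
qed

lemma JM_product_conj_young:
  assumes \<mu>: "\<mu> \<in> partitions n"
  shows "JM_product f n * fps_const (of_rat_ring (conj_young \<mu>)) = lift_const (content_product f \<mu>) * fps_const (of_rat_ring (conj_young \<mu>))"
proof -
  have n: "sum_list \<mu> = n" using \<mu> by (simp add: partitions_def)
  let ?y = "fps_const (of_rat_ring (young \<mu>)) :: (fperm \<Rightarrow>\<^sub>0 'a) fps" and ?e = "\<lambda>t. fps_const (elt t) :: (fperm \<Rightarrow>\<^sub>0 'a) fps"
  have N: "fps_const (of_rat_ring (conj_young \<mu>)) = (\<Sum>t\<in>SymP n. ?e t * ?y * ?e (- t))"
    unfolding conj_young_def n of_rat_ring_sum of_rat_ring_mult fps_const_sum by (simp only: of_rat_ring_single of_rat_1 fps_const_mult)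
  have "JM_product f n * fps_const (of_rat_ring (conj_young \<mu>)) = (\<Sum>t\<in>SymP n. lift_const (content_product f \<mu>) * (?e t * ?y * ?e (- t)))"
    unfolding N sum_distrib_left
  proof (intro sum.cong refl)
    fix t assume t: "t \<in> SymP n"
    have "JM_product f n * (?e t * ?y * ?e (- t)) = (JM_product f n * ?e t) * ?y * ?e (- t)" by (simp only: mult.assoc)
    also have "\<dots> = ?e t * (JM_product f n * ?y) * ?e (- t)" unfolding JM_product_central[OF t, symmetric] by (simp only: mult.assoc)
    also have "\<dots> = (?e t * lift_const (content_product f \<mu>)) * ?y * ?e (- t)" unfolding JM_product_young[OF \<mu>] by (simp only: mult.assoc)
    also have "\<dots> = lift_const (content_product f \<mu>) * (?e t * ?y * ?e (- t))" unfolding lift_const_comm[of "?e t"] by (simp only: mult.assoc)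
    finally show "JM_product f n * (?e t * ?y * ?e (- t)) = lift_const (content_product f \<mu>) * (?e t * ?y * ?e (- t))" .
  qed
  then show ?thesis unfolding N sum_distrib_left .
qed

theorem JM_product_eq_character_sum:
  "lookup (JM_product f n $ d) g =
    (\<Sum>\<mu>\<in>partitions n. of_rat (inverse ((kappa \<mu>)\<^sup>2) * lookup (conj_young \<mu>) g) * content_product f \<mu> $ d)"
proof -
  have one: "(\<Sum>\<mu>\<in>partitions n. scal (of_rat (inverse ((kappa \<mu>)\<^sup>2))) * of_rat_ring (conj_young \<mu>)) = (1 :: fperm \<Rightarrow>\<^sub>0 'a)"
    using arg_cong[OF completeness[of n], of "of_rat_ring :: _ \<Rightarrow> fperm \<Rightarrow>\<^sub>0 'a"]
    unfolding of_rat_ring_sum of_rat_ring_mult of_rat_ring_single of_rat_ring_one .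
  have "JM_product f n = JM_product f n * fps_const (\<Sum>\<mu>\<in>partitions n. scal (of_rat (inverse ((kappa \<mu>)\<^sup>2))) * of_rat_ring (conj_young \<mu>))"
    unfolding one by simp
  also have "\<dots> = (\<Sum>\<mu>\<in>partitions n. fps_const (scal (of_rat (inverse ((kappa \<mu>)\<^sup>2)))) * (JM_product f n * fps_const (of_rat_ring (conj_young \<mu>))))"
    by (rule fps_ext) (simp add: fps_sum_nth sum_distrib_left scal_commute_left)
  also have "\<dots> = (\<Sum>\<mu>\<in>partitions n. fps_const (scal (of_rat (inverse ((kappa \<mu>)\<^sup>2)))) * (lift_const (content_product f \<mu>) * fps_const (of_rat_ring (conj_young \<mu>))))"
    by (intro sum.cong refl) (simp only: JM_product_conj_young)
  finally have "JM_product f n $ d = (\<Sum>\<mu>\<in>partitions n. scal (of_rat (inverse ((kappa \<mu>)\<^sup>2))) * (scal (content_product f \<mu> $ d) * of_rat_ring (conj_young \<mu>)))"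
    by (metis (no_types, lifting) fps_sum_nth fps_mult_left_const_nth fps_mult_right_const_nth lift_const_nth sum.cong)
  then show ?thesis by (simp add: lookup_sum of_rat_mult mult_ac)
qed

section \<open>Irreducible characters\<close>

text \<open>
  The isomorphism onto the group algebra in which the irreducible modules are defined.
\<close>

definition to_galg :: "(fperm \<Rightarrow>\<^sub>0 rat) \<Rightarrow> galg"
  where "to_galg x = (\<Sum>g\<in>keys x. single (fun_of g) (lookup x g))"

lemma lookup_to_galg [simp]: "lookup (to_galg x) (fun_of g) = lookup x g"
  by (auto simp: to_galg_def lookup_sum lookup_single when_def fun_of_inject in_keys_iff)

lemma lookup_to_galg_outside: "\<not> permutation \<sigma> \<Longrightarrow> lookup (to_galg x) \<sigma> = 0"
  unfolding to_galg_def lookup_sum by (rule sum.neutral) (auto simp: lookup_single when_def)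

lemma galg_eqI:
  assumes "\<And>g. lookup a (fun_of g) = lookup (b :: galg) (fun_of g)"
    and "\<And>\<sigma>. \<not> permutation \<sigma> \<Longrightarrow> lookup a \<sigma> = lookup b \<sigma>"
  shows "a = b"
proof (rule poly_mapping_eqI)
  fix \<sigma> show "lookup a \<sigma> = lookup b \<sigma>"
    using assms(1)[of "mk_perm \<sigma>"] assms(2) by (cases "permutation \<sigma>") auto
qed

lemma to_galg_add: "to_galg (x + y) = to_galg x + to_galg y"
  by (rule galg_eqI) (simp_all add: lookup_add lookup_to_galg_outside)

lemma to_galg_zero [simp]: "to_galg 0 = 0"
  by (simp add: to_galg_def)

lemma to_galg_sum: "to_galg (sum h A) = (\<Sum>i\<in>A. to_galg (h i))"
  by (rule galg_eqI) (simp_all add: lookup_sum lookup_to_galg_outside)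

lemma to_galg_scale: "to_galg (scal c * x) = gscale c (to_galg x)"
  by (rule galg_eqI) (simp_all add: lookup_to_galg_outside)

lemma to_galg_single [simp]: "to_galg (single g a) = single (fun_of g) a"
  by (cases "a = 0") (simp_all add: to_galg_def)

lemma keys_to_galg: "keys (to_galg x) = fun_of ` keys x"
proof (rule set_eqI)
  fix \<sigma>
  show "\<sigma> \<in> keys (to_galg x) \<longleftrightarrow> \<sigma> \<in> fun_of ` keys x"
  proof (cases "permutation \<sigma>")
    case True
    then obtain g where "\<sigma> = fun_of g" by (metis fun_of_mk_perm)
    then show ?thesis by (auto simp: in_keys_iff fun_of_inject)
  qed (auto simp: in_keys_iff lookup_to_galg_outside)
qed

lemma gmult_superset:
  assumes "finite A" "finite B" "keys a \<subseteq> A" "keys b \<subseteq> B"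
  shows "a \<star> b = (\<Sum>\<sigma>\<in>A. \<Sum>\<tau>\<in>B. single (\<sigma> \<circ> \<tau>) (lookup a \<sigma> * lookup b \<tau>))"
proof -
  have "a \<star> b = (\<Sum>\<sigma>\<in>keys a. \<Sum>\<tau>\<in>B. single (\<sigma> \<circ> \<tau>) (lookup a \<sigma> * lookup b \<tau>))"
    unfolding gmult_def using assms by (intro sum.cong refl sum.mono_neutral_left) (auto simp: in_keys_iff)
  also have "\<dots> = (\<Sum>\<sigma>\<in>A. \<Sum>\<tau>\<in>B. single (\<sigma> \<circ> \<tau>) (lookup a \<sigma> * lookup b \<tau>))"
    using assms by (intro sum.mono_neutral_left) (auto simp: in_keys_iff)
  finally show ?thesis .
qed

lemma to_galg_mult: "to_galg (x * y) = to_galg x \<star> to_galg y"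
proof -
  let ?l = lookup
  have "x * y = (\<Sum>h\<in>keys x. single h (?l x h)) * (\<Sum>k\<in>keys y. single k (?l y k))"
    by (simp add: sum_single_keys)
  also have "\<dots> = (\<Sum>h\<in>keys x. \<Sum>k\<in>keys y. single (h + k) (?l x h * ?l y k))"
    by (simp add: sum_product mult_single)
  finally have "to_galg (x * y) = (\<Sum>h\<in>keys x. \<Sum>k\<in>keys y.
      single (fun_of h \<circ> fun_of k) (?l x h * ?l y k))"
    by (simp add: to_galg_sum)
  also have "\<dots> = to_galg x \<star> to_galg y"
    unfolding gmult_def keys_to_galg
    by (simp add: sum.reindex[OF inj_on_subset[OF inj_fun_of subset_UNIV]])
  finally show ?thesis .
qed

lemma gmult_add_right: "a \<star> (b + c) = a \<star> b + a \<star> c"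
proof -
  let ?B = "keys b \<union> keys c"
  show ?thesis
    using keys_add[of b c]
    by (simp add: gmult_superset[of "keys a" ?B] lookup_add distrib_left single_add sum.distrib)
qed

lemma gmult_scale_right: "a \<star> gscale r b = gscale r (a \<star> b)"
proof -
  have k: "keys (gscale r b) \<subseteq> keys b" by (auto simp: in_keys_iff)
  have s: "gscale r (sum h A) = (\<Sum>i\<in>A. gscale r (h i))" for h :: "'i \<Rightarrow> galg" and A
    by (rule poly_mapping_eqI) (simp add: lookup_sum sum_distrib_left)
  have 1: "gscale r (single k c) = single k (r * c)" for k c
    by (rule poly_mapping_eqI) (auto simp: lookup_single when_def)
  show ?thesis
    by (simp add: gmult_superset[of "keys a" "keys b"] k s 1 mult_ac)
qed

lemma group_algebra_eq: "group_algebra n = to_galg ` group_ring n"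
proof
  show "group_algebra n \<subseteq> to_galg ` group_ring n"
  proof
    fix a assume a: "a \<in> group_algebra n"
    define x where "x = (\<Sum>g\<in>SymP n. single g (lookup a (fun_of g)))"
    have "x \<in> group_ring n" unfolding x_def by (intro group_ring_sum group_ring_single)
    moreover have lx: "lookup x g = (if g \<in> SymP n then lookup a (fun_of g) else 0)" for g
      by (auto simp: x_def lookup_sum lookup_single when_def sum.If_cases)
    have "a = to_galg x"
    proof (rule galg_eqI)
      fix g show "lookup a (fun_of g) = lookup (to_galg x) (fun_of g)"
        using a by (auto simp: lx group_algebra_def SymP_def Sym_def in_keys_iff)
    next
      fix \<sigma> :: "nat \<Rightarrow> nat" assume "\<not> permutation \<sigma>"
      then have "\<sigma> \<notin> Sym n" by (auto simp: Sym_def permutation_permutes)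
      then show "lookup a \<sigma> = lookup (to_galg x) \<sigma>"
        using a \<open>\<not> permutation \<sigma>\<close> by (auto simp: lookup_to_galg_outside group_algebra_def in_keys_iff)
    qed
    ultimately show "a \<in> to_galg ` group_ring n" by blast
  qed
  show "to_galg ` group_ring n \<subseteq> group_algebra n"
    by (auto simp: group_algebra_def keys_to_galg group_ring_def SymP_def Sym_def)
qed

lemma row_group_eq: "row_group \<mu> = fun_of ` Stab (sum_list \<mu>) (rowf \<mu>)"
  and column_group_eq: "column_group \<mu> = fun_of ` Stab (sum_list \<mu>) (colf \<mu>)"
proof -
  let ?n = "sum_list \<mu>"
  have r: "(\<forall>(i, j)\<in>cells \<mu>. \<exists>j'. (i, j') \<in> cells \<mu> \<and> \<sigma> (entry \<mu> (i, j)) = entry \<mu> (i, j')) \<longleftrightarrow>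
      (\<forall>x<?n. rowf \<mu> (\<sigma> x) = rowf \<mu> x)"
   and c: "(\<forall>(i, j)\<in>cells \<mu>. \<exists>i'. (i', j) \<in> cells \<mu> \<and> \<sigma> (entry \<mu> (i, j)) = entry \<mu> (i', j)) \<longleftrightarrow>
      (\<forall>x<?n. colf \<mu> (\<sigma> x) = colf \<mu> x)" if s: "\<sigma> \<in> Sym ?n" for \<sigma>
  proof -
    have sn: "\<sigma> x < ?n" if "x < ?n" for x using s that by (simp add: Sym_def) (metis lessThan_iff permutes_in_image)
    show "(\<forall>(i, j)\<in>cells \<mu>. \<exists>j'. (i, j') \<in> cells \<mu> \<and> \<sigma> (entry \<mu> (i, j)) = entry \<mu> (i, j')) \<longleftrightarrow>
      (\<forall>x<?n. rowf \<mu> (\<sigma> x) = rowf \<mu> x)"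
    proof (intro iffI allI impI)
      fix x assume *: "\<forall>(i, j)\<in>cells \<mu>. \<exists>j'. (i, j') \<in> cells \<mu> \<and> \<sigma> (entry \<mu> (i, j)) = entry \<mu> (i, j')" and x: "x < ?n"
      then obtain j' where "(rowf \<mu> x, j') \<in> cells \<mu>" "\<sigma> x = entry \<mu> (rowf \<mu> x, j')"
        using pos_in_cells[OF x] entry_pos[OF x] by fastforce
      then show "rowf \<mu> (\<sigma> x) = rowf \<mu> x" by simp
    next
      assume *: "\<forall>x<?n. rowf \<mu> (\<sigma> x) = rowf \<mu> x"
      show "\<forall>(i, j)\<in>cells \<mu>. \<exists>j'. (i, j') \<in> cells \<mu> \<and> \<sigma> (entry \<mu> (i, j)) = entry \<mu> (i, j')"
      proof clarify
        fix i j assume ij: "(i, j) \<in> cells \<mu>"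
        let ?x = "entry \<mu> (i, j)"
        have x: "?x < ?n" using ij by (rule entry_less)
        have r: "rowf \<mu> (\<sigma> ?x) = i" using * x ij by simp
        show "\<exists>j'. (i, j') \<in> cells \<mu> \<and> \<sigma> ?x = entry \<mu> (i, j')"
          using pos_in_cells[OF sn[OF x]] entry_pos[OF sn[OF x]] unfolding r by metis
      qed
    qed
    show "(\<forall>(i, j)\<in>cells \<mu>. \<exists>i'. (i', j) \<in> cells \<mu> \<and> \<sigma> (entry \<mu> (i, j)) = entry \<mu> (i', j)) \<longleftrightarrow>
      (\<forall>x<?n. colf \<mu> (\<sigma> x) = colf \<mu> x)"
    proof (intro iffI allI impI)
      fix x assume *: "\<forall>(i, j)\<in>cells \<mu>. \<exists>i'. (i', j) \<in> cells \<mu> \<and> \<sigma> (entry \<mu> (i, j)) = entry \<mu> (i', j)" and x: "x < ?n"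
      then obtain j' where "(j', colf \<mu> x) \<in> cells \<mu>" "\<sigma> x = entry \<mu> (j', colf \<mu> x)"
        using pos_in_cells[OF x] entry_pos[OF x] by fastforce
      then show "colf \<mu> (\<sigma> x) = colf \<mu> x" by simp
    next
      assume *: "\<forall>x<?n. colf \<mu> (\<sigma> x) = colf \<mu> x"
      show "\<forall>(i, j)\<in>cells \<mu>. \<exists>i'. (i', j) \<in> cells \<mu> \<and> \<sigma> (entry \<mu> (i, j)) = entry \<mu> (i', j)"
      proof clarify
        fix i j assume ij: "(i, j) \<in> cells \<mu>"
        let ?x = "entry \<mu> (i, j)"
        have x: "?x < ?n" using ij by (rule entry_less)
        have r: "colf \<mu> (\<sigma> ?x) = j" using * x ij by simp
        show "\<exists>j'. (j', j) \<in> cells \<mu> \<and> \<sigma> ?x = entry \<mu> (j', j)"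
          using pos_in_cells[OF sn[OF x]] entry_pos[OF sn[OF x]] unfolding r by metis
      qed
    qed
  qed
  have S: "fun_of ` Stab ?n \<rho> = {\<sigma> \<in> Sym ?n. \<forall>x<?n. \<rho> (\<sigma> x) = \<rho> x}" for \<rho>
    unfolding Stab_def fun_of_SymP[symmetric] by blast
  show "row_group \<mu> = fun_of ` Stab (sum_list \<mu>) (rowf \<mu>)"
    unfolding row_group_def S using r by blast
  show "column_group \<mu> = fun_of ` Stab (sum_list \<mu>) (colf \<mu>)"
    unfolding column_group_def S using c by blast
qed

lemma young_symmetrizer_eq: "young_symmetrizer \<mu> = to_galg (young \<mu>)"
  unfolding young_symmetrizer_def young_def to_galg_mult row_group_eq column_group_eq stab_sum_def alt_sum_def to_galg_sum
  by (simp add: sum.reindex[OF inj_on_subset[OF inj_fun_of subset_UNIV]])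

text \<open>
  The vectors \<open>q t\<close> are the images of the group elements under a projection of the group algebra onto \<open>V\<close>.
  The trace of \<open>T\<close> on \<open>V\<close> is the trace of \<open>T\<close> composed with this projection, which is computed in the basis
  of group elements instead of the unspecified basis of \<open>V\<close>.
\<close>

lemma trace_on_projection:
  assumes V: "galg.subspace V" "V \<subseteq> group_algebra n"
    and q: "\<And>t. t \<in> SymP n \<Longrightarrow> q t \<in> V"
    and expand: "\<And>v. v \<in> V \<Longrightarrow> v = (\<Sum>t\<in>SymP n. gscale (lookup v (fun_of t)) (q t))"
    and T: "\<And>v. v \<in> V \<Longrightarrow> T v \<in> V" "\<And>v w. T (v + w) = T v + T w" "\<And>c v. T (gscale c v) = gscale c (T v)"
  shows "trace_on V T = (\<Sum>t\<in>SymP n. lookup (T (q t)) (fun_of t))"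
proof -
  define B where "B = (SOME B. galg.independent B \<and> galg.span B = V)"
  have "\<exists>B. galg.independent B \<and> galg.span B = V"
  proof -
    obtain B where "B \<subseteq> V" "galg.independent B" "V \<subseteq> galg.span B" using galg.basis_exists[of V] by metis
    then show ?thesis using galg.span_subspace[of B V] V(1) by blast
  qed
  then have B: "galg.independent B" "galg.span B = V" unfolding B_def by (metis (mono_tags, lifting) someI_ex)+
  have "V \<subseteq> galg.span (q ` SymP n)"
  proof
    fix v assume "v \<in> V"
    then have "v = (\<Sum>t\<in>SymP n. gscale (lookup v (fun_of t)) (q t))" by (rule expand)
    also have "\<dots> \<in> galg.span (q ` SymP n)"
      by (intro galg.span_sum galg.span_scale galg.span_base) auto
    finally show "v \<in> galg.span (q ` SymP n)" .
  qed
  then have fin: "finite B"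
    using galg.independent_span_bound[of "q ` SymP n" B] B galg.span_superset[of B] by auto
  let ?r = "galg.representation B"
  have rep: "?r v b = (\<Sum>t\<in>SymP n. lookup v (fun_of t) * ?r (q t) b)" if v: "v \<in> V" for v b
  proof -
    have "?r v = ?r (\<Sum>t\<in>SymP n. gscale (lookup v (fun_of t)) (q t))" using expand[OF v] by simp
    also have "\<dots> = (\<lambda>b. \<Sum>t\<in>SymP n. ?r (gscale (lookup v (fun_of t)) (q t)) b)"
      using q B V(1) by (intro galg.representation_sum) (auto intro: galg.subspace_scale)
    also have "\<dots> = (\<lambda>b. \<Sum>t\<in>SymP n. lookup v (fun_of t) * ?r (q t) b)"
      using q B by (intro ext sum.cong refl) (simp add: galg.representation_scale)
    finally show ?thesis by metis
  qed
  have T0: "T 0 = 0" using T(3)[of 0 0] by simp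
  have Tsum: "T (sum h A) = (\<Sum>i\<in>A. T (h i))" for h :: "galg \<Rightarrow> galg" and A
    by (induction A rule: infinite_finite_induct) (simp_all add: T0 T(2))
  have Tq: "T (q t) = (\<Sum>b\<in>B. gscale (?r (q t) b) (T b))" if t: "t \<in> SymP n" for t
  proof -
    have "q t = (\<Sum>b\<in>B. gscale (?r (q t) b) b)"
      using galg.sum_representation_eq[OF B(1) _ fin order_refl, of "q t"] q[OF t] B(2) by simp
    then have "T (q t) = T (\<Sum>b\<in>B. gscale (?r (q t) b) b)" by metis
    then show ?thesis by (simp add: Tsum T(3))
  qed
  have "trace_on V T = (\<Sum>b\<in>B. ?r (T b) b)" by (simp add: trace_on_def B_def[symmetric])
  also have "\<dots> = (\<Sum>b\<in>B. \<Sum>t\<in>SymP n. lookup (T b) (fun_of t) * ?r (q t) b)"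
    using B(2) galg.span_superset[of B] by (intro sum.cong refl rep T(1)) auto
  also have "\<dots> = (\<Sum>t\<in>SymP n. \<Sum>b\<in>B. lookup (T b) (fun_of t) * ?r (q t) b)" by (rule sum.swap)
  also have "\<dots> = (\<Sum>t\<in>SymP n. lookup (T (q t)) (fun_of t))"
    by (intro sum.cong refl) (simp add: Tq lookup_sum mult.commute)
  finally show ?thesis .
qed

lemma irrep_eq: "irrep \<mu> = (\<lambda>x. to_galg (x * young \<mu>)) ` group_ring (sum_list \<mu>)"
  unfolding irrep_def group_algebra_eq young_symmetrizer_eq by (auto simp: to_galg_mult)

text \<open>
  Right multiplication by the idempotent \<open>young \<mu> / \<kappa>\<close> projects the group algebra onto the irreducible module.
  The trace formula then sums the coefficients of \<open>young \<mu>\<close> at all conjugates of \<open>g\<^sup>-\<^sup>1\<close>.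
\<close>

theorem irr_char_eq:
  assumes \<mu>: "\<mu> \<in> partitions n" and g: "g \<in> SymP n"
  shows "irr_char \<mu> (fun_of g) = lookup (conj_young \<mu>) (- g) / kappa \<mu>"
proof -
  have n: "sum_list \<mu> = n" and s: "sorted_wrt (\<ge>) \<mu>" using \<mu> by (auto simp: partitions_def)
  let ?y = "young \<mu>" and ?V = "irrep \<mu>" and ?T = "\<lambda>v. single (fun_of g) 1 \<star> v"
  define q where "q t = to_galg (scal (inverse (kappa \<mu>)) * elt t * ?y)" for t
  have V: "?V = (\<lambda>x. to_galg (x * ?y)) ` group_ring n" by (simp add: irrep_eq n)
  have yn: "?y \<in> group_ring n" using young_group_ring[of \<mu>] n by simp
  have T: "?T (to_galg x) = to_galg (elt g * x)" for x by (simp add: to_galg_mult)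
  have "trace_on ?V ?T = (\<Sum>t\<in>SymP n. lookup (?T (q t)) (fun_of t))"
  proof (rule trace_on_projection)
    show "galg.subspace ?V"
    proof (rule galg.subspaceI)
      show "0 \<in> ?V" unfolding V by (rule image_eqI[of _ _ 0]) auto
    next
      fix v w assume "v \<in> ?V" "w \<in> ?V"
      then obtain x x' where "x \<in> group_ring n" "x' \<in> group_ring n" "v = to_galg (x * ?y)" "w = to_galg (x' * ?y)" unfolding V by blast
      then show "v + w \<in> ?V" unfolding V by (intro image_eqI[of _ _ "x + x'"]) (auto simp: distrib_right to_galg_add)
    next
      fix c v assume "v \<in> ?V"
      then obtain x where x: "x \<in> group_ring n" "v = to_galg (x * ?y)" unfolding V by blast
      then have "scal c * x \<in> group_ring n" by (intro group_ring_mult group_ring_single) auto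
      then show "gscale c v \<in> ?V" unfolding V x(2) by (intro image_eqI[of _ _ "scal c * x"]) (simp_all add: mult.assoc to_galg_scale)
    qed
    show "?V \<subseteq> group_algebra n" unfolding V group_algebra_eq using yn by auto
    show "q t \<in> ?V" if "t \<in> SymP n" for t
      unfolding V q_def by (rule image_eqI[of _ _ "scal (inverse (kappa \<mu>)) * elt t"]) (use that in \<open>auto intro!: group_ring_mult group_ring_single\<close>)
    show "?T v \<in> ?V" if "v \<in> ?V" for v
    proof -
      obtain x where x: "x \<in> group_ring n" "v = to_galg (x * ?y)" using \<open>v \<in> ?V\<close> unfolding V by blast
      then have "elt g * x \<in> group_ring n" using g by auto
      then show ?thesis unfolding V x(2) T by (intro image_eqI[of _ _ "elt g * x"]) (simp_all add: mult.assoc)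
    qed
    show "?T (v + w) = ?T v + ?T w" "?T (gscale c v) = gscale c (?T v)" for v w c
      by (simp_all add: gmult_add_right gmult_scale_right)
    show "v = (\<Sum>t\<in>SymP n. gscale (lookup v (fun_of t)) (q t))" if v: "v \<in> ?V" for v
    proof -
      obtain x where x: "x \<in> group_ring n" "v = to_galg (x * ?y)" using v unfolding V by blast
      define w where "w = x * ?y"
      have wn: "w \<in> group_ring n" using x(1) yn by (auto simp: w_def)
      have "w = scal (inverse (kappa \<mu>)) * (w * ?y)"
        unfolding w_def using young_square[OF s] kappa_nonzero[OF s]
        by (simp add: mult.assoc scal_commute_left[of x] scal_mult_left)
      also have "w * ?y = (\<Sum>t\<in>SymP n. single t (lookup w t) * ?y)"
        by (subst group_ring_expand[OF wn, symmetric]) (simp add: sum_distrib_right)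
      also have "scal (inverse (kappa \<mu>)) * \<dots> = (\<Sum>t\<in>SymP n. scal (lookup w t) * (scal (inverse (kappa \<mu>)) * elt t * ?y))"
        unfolding sum_distrib_left by (intro sum.cong refl) (simp add: mult_single mult.commute flip: mult.assoc)
      finally have "to_galg w = (\<Sum>t\<in>SymP n. gscale (lookup w t) (q t))"
        by (metis (no_types, lifting) to_galg_sum to_galg_scale q_def sum.cong)
      then show ?thesis unfolding x(2) w_def[symmetric] lookup_to_galg .
    qed
  qed
  also have "\<dots> = (\<Sum>t\<in>SymP n. inverse (kappa \<mu>) * lookup ?y (- t + - g + t))"
  proof (intro sum.cong refl)
    fix t
    have "lookup (?T (q t)) (fun_of t) = lookup (elt g * (scal (inverse (kappa \<mu>)) * (elt t * ?y))) t"
      by (simp add: q_def T mult.assoc)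
    also have "\<dots> = inverse (kappa \<mu>) * lookup ?y (- t + - g + t)"
      by (simp add: lookup_mult_single_left add.assoc diff_conv_add_uminus del: add_uminus_conv_diff)
    finally show "lookup (?T (q t)) (fun_of t) = inverse (kappa \<mu>) * lookup ?y (- t + - g + t)" .
  qed
  also have "\<dots> = lookup (conj_young \<mu>) (- g) / kappa \<mu>"
    by (simp add: conj_young_def n lookup_sum lookup_conj sum_distrib_left divide_inverse mult.commute)
  finally show ?thesis by (simp add: irr_char_def)
qed

lemma char_value_eq:
  assumes \<mu>: "\<mu> \<in> partitions n" and g: "g \<in> SymP n"
  shows "char_value \<mu> (cycle_type n (fun_of g)) = lookup (conj_young \<mu>) (- g) / kappa \<mu>"
proof -
  have n: "sum_list \<mu> = n" using \<mu> by (auto simp: partitions_def)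
  let ?\<alpha> = "cycle_type n (fun_of g)"
  have \<alpha>n: "sum_list ?\<alpha> = n" using cycle_type_partition[OF g] by (simp add: partitions_def)
  have cc: "conj_class ?\<alpha> = fun_of ` {h \<in> SymP n. cycle_type n (fun_of h) = ?\<alpha>}"
    unfolding conj_class_def \<alpha>n fun_of_SymP[symmetric] by blast
  define \<sigma> where "\<sigma> = (SOME \<sigma>. \<sigma> \<in> conj_class ?\<alpha>)"
  have "\<sigma> \<in> conj_class ?\<alpha>" unfolding \<sigma>_def by (rule someI[of _ "fun_of g"]) (use g in \<open>auto simp: cc\<close>)
  then obtain h where h: "h \<in> SymP n" "cycle_type n (fun_of h) = ?\<alpha>" "\<sigma> = fun_of h" unfolding cc by blast
  obtain t where t: "t \<in> SymP n" "h = t + g - t" using cycle_type_eq_imp_conj[OF g h(1)] h(2) by metis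
  have "- h = t + - g - t" by (simp add: t(2) diff_conv_add_uminus minus_add add.assoc del: add_uminus_conv_diff)
  then have "lookup (conj_young \<mu>) (- h) = lookup (conj_young \<mu>) (- g)"
    using lookup_conj_young_conj[of t \<mu> "- g"] t(1) n by simp
  then show ?thesis
    unfolding char_value_def \<sigma>_def[symmetric] h(3) irr_char_eq[OF \<mu> h(1)] by simp
qed

lemma cycle_type_id: "cycle_type n (fun_of 0) = replicate n 1"
proof -
  have "orbs n 0 = (\<lambda>x. {x}) ` {..<n}"
    by (simp add: orbs_def orbit_eq_singleton_iff[THEN iffD2])
  then have "set (cycle_type n (fun_of 0)) \<subseteq> {1}" by (auto simp: cycle_type_def orbs_def[of n 0, simplified, symmetric])
  moreover have "sum_list (cycle_type n (fun_of 0)) = n" using cycle_type_partition[OF SymP_zero] by (auto simp: partitions_def)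
  moreover have "set xs \<subseteq> {1} \<Longrightarrow> xs = replicate (sum_list xs) 1" for xs :: "nat list"
    by (induction xs) auto
  ultimately show ?thesis by metis
qed

lemma dim_eq: "\<mu> \<in> partitions n \<Longrightarrow> char_value \<mu> (replicate n 1) = fact n / kappa \<mu>"
  using char_value_eq[of \<mu> n 0] lookup_conj_young_zero[of \<mu>] by (simp add: cycle_type_id partitions_def del: fun_of_zero)

section \<open>The content series as a sum over permutations\<close>

lemma pprod_single: "(pprod \<alpha> :: 'r::comm_semiring_1 ppoly) = single (pexp \<alpha>) 1"
  by (induction \<alpha>) (simp_all add: pprod_def pexp_def pvar_def mult_single)

lemma pconst_pprod: "pconst c * pprod \<alpha> = (single (pexp \<alpha>) c :: 'r::comm_semiring_1 ppoly)"
  by (simp add: pprod_single pconst_def mult_single)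

lemma schur_eq:
  assumes \<mu>: "\<mu> \<in> partitions n"
  shows "schur \<mu> = (\<Sum>g\<in>SymP n. single (pexp (cycle_type n (fun_of g))) (lookup (conj_young \<mu>) (- g) / (fact n * kappa \<mu>)))"
proof -
  have n: "sum_list \<mu> = n" using \<mu> by (auto simp: partitions_def)
  let ?C = "\<lambda>\<alpha>. {g \<in> SymP n. cycle_type n (fun_of g) = \<alpha>}"
  have "schur \<mu> = (\<Sum>\<alpha>\<in>partitions n. \<Sum>g\<in>?C \<alpha>. single (pexp (cycle_type n (fun_of g))) (lookup (conj_young \<mu>) (- g) / (fact n * kappa \<mu>)))"
    unfolding schur_def n
  proof (intro sum.cong refl)
    fix \<alpha> assume "\<alpha> \<in> partitions n"
    then have "conj_class \<alpha> = fun_of ` ?C \<alpha>"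
      unfolding conj_class_def by (auto simp: partitions_def fun_of_SymP[symmetric])
    then have card: "card (conj_class \<alpha>) = card (?C \<alpha>)"
      by (simp add: card_image inj_on_subset[OF inj_fun_of])
    have "(\<Sum>g\<in>?C \<alpha>. single (pexp (cycle_type n (fun_of g))) (lookup (conj_young \<mu>) (- g) / (fact n * kappa \<mu>))) =
        (\<Sum>g\<in>?C \<alpha>. single (pexp \<alpha>) (char_value \<mu> \<alpha> / fact n))"
    proof (intro sum.cong refl)
      fix g assume "g \<in> ?C \<alpha>"
      then have "char_value \<mu> \<alpha> = lookup (conj_young \<mu>) (- g) / kappa \<mu>" "cycle_type n (fun_of g) = \<alpha>"
        using char_value_eq[OF \<mu>, of g] by auto
      then show "single (pexp (cycle_type n (fun_of g))) (lookup (conj_young \<mu>) (- g) / (fact n * kappa \<mu>)) =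
          single (pexp \<alpha>) (char_value \<mu> \<alpha> / fact n)"
        by (simp add: mult.commute)
    qed
    also have "\<dots> = single (pexp \<alpha>) (\<Sum>g\<in>?C \<alpha>. char_value \<mu> \<alpha> / fact n)"
      by (rule single_sum[symmetric])
    also have "\<dots> = single (pexp \<alpha>) (of_nat (card (conj_class \<alpha>)) / fact n * char_value \<mu> \<alpha>)"
      by (simp add: card)
    finally show "pconst (of_nat (card (conj_class \<alpha>)) / fact n * char_value \<mu> \<alpha>) * pprod \<alpha> =
      (\<Sum>g\<in>?C \<alpha>. single (pexp (cycle_type n (fun_of g))) (lookup (conj_young \<mu>) (- g) / (fact n * kappa \<mu>)))"
      by (simp add: pconst_pprod)
  qed
  also have "\<dots> = (\<Sum>g\<in>SymP n. single (pexp (cycle_type n (fun_of g))) (lookup (conj_young \<mu>) (- g) / (fact n * kappa \<mu>)))"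
    by (rule sum.group) (auto simp: cycle_type_partition)
  finally show ?thesis .
qed

definition coeff_fps :: "(fperm \<Rightarrow>\<^sub>0 'a::zero) fps \<Rightarrow> fperm \<Rightarrow> 'a fps"
  where "coeff_fps x g = Abs_fps (\<lambda>d. lookup (x $ d) g)"

lemma coeff_fps_nth [simp]: "coeff_fps x g $ d = lookup (x $ d) g"
  by (simp add: coeff_fps_def)

definition cycle_type_sum :: "nat \<Rightarrow> (fperm \<Rightarrow>\<^sub>0 'a::field_char_0) fps \<Rightarrow> 'a fps ppoly"
  where "cycle_type_sum n x = (\<Sum>g\<in>SymP n. single (pexp (cycle_type n (fun_of g))) (coeff_fps x g))"

text \<open>
  The characters in \<open>\<Phi>\<close> occur with a factor \<open>1 / \<kappa>\<^sup>2\<close>, one factor from the dimension and one from the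
  Schur function, which is exactly the coefficient of \<open>conj_young \<mu>\<close> in the decomposition of 1.
\<close>

theorem content_series_nth:
  fixes f :: "'a::field_char_0 fps"
  shows "content_series f $ n = pconst (fps_const (inverse (fact n))) * cycle_type_sum n (JM_product f n)"
proof -
  let ?p = "\<lambda>g. pexp (cycle_type n (fun_of g))"
  let ?m = "Poly_Mapping.map (\<lambda>q. fps_const (of_rat q :: 'a))"
  have lm: "lookup (?m x) k = fps_const (of_rat (lookup x k))" for x :: "rat ppoly" and k
    by (simp add: Poly_Mapping.map.rep_eq when_def)
  have m_sum: "?m (sum h A) = (\<Sum>i\<in>A. ?m (h i))" for h :: "fperm \<Rightarrow> rat ppoly" and A
    by (rule poly_mapping_eqI) (simp add: lm lookup_sum of_rat_sum fps_const_sum)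
  have m_single: "?m (single k a) = single k (fps_const (of_rat a))" for k :: "nat \<Rightarrow>\<^sub>0 nat" and a
    by (rule poly_mapping_eqI) (auto simp: lm when_def lookup_single)
  have "content_series f $ n = (\<Sum>\<mu>\<in>partitions n. pconst (fps_const (of_rat (fact n / kappa \<mu> / fact n)) * content_product f \<mu>) *
      (\<Sum>g\<in>SymP n. single (?p g) (fps_const (of_rat (lookup (conj_young \<mu>) (- g) / (fact n * kappa \<mu>))))))"
    unfolding content_series_def fps_nth_Abs_fps
    by (intro sum.cong refl) (simp add: dim_eq[unfolded One_nat_def] schur_eq m_sum m_single content_product_def content_factor_def)
  also have "\<dots> = (\<Sum>\<mu>\<in>partitions n. \<Sum>g\<in>SymP n. single (?p g)
      (fps_const (of_rat (fact n / kappa \<mu> / fact n)) * content_product f \<mu> * fps_const (of_rat (lookup (conj_young \<mu>) (- g) / (fact n * kappa \<mu>)))))"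
    by (simp add: pconst_def sum_distrib_left mult_single)
  also have "\<dots> = (\<Sum>g\<in>SymP n. single (?p g) (\<Sum>\<mu>\<in>partitions n.
      fps_const (of_rat (fact n / kappa \<mu> / fact n)) * content_product f \<mu> * fps_const (of_rat (lookup (conj_young \<mu>) (- g) / (fact n * kappa \<mu>)))))"
    by (subst sum.swap) (simp add: single_sum)
  also have "\<dots> = (\<Sum>g\<in>SymP n. single (?p g) (fps_const (inverse (fact n)) * coeff_fps (JM_product f n) (- g)))"
  proof (intro sum.cong refl arg_cong[of _ _ "single _"] fps_ext)
    fix g d
    have "(\<Sum>\<mu>\<in>partitions n. fps_const (of_rat (fact n / kappa \<mu> / fact n)) * content_product f \<mu> *
        fps_const (of_rat (lookup (conj_young \<mu>) (- g) / (fact n * kappa \<mu>)))) $ d =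
      (\<Sum>\<mu>\<in>partitions n. of_rat (fact n / kappa \<mu> / fact n * (lookup (conj_young \<mu>) (- g) / (fact n * kappa \<mu>))) * content_product f \<mu> $ d)"
      unfolding fps_sum_nth
      by (intro sum.cong refl) (simp only: fps_mult_left_const_nth fps_mult_right_const_nth of_rat_mult, simp only: mult_ac)
    also have "\<dots> = (\<Sum>\<mu>\<in>partitions n. inverse (fact n) * (of_rat (inverse ((kappa \<mu>)\<^sup>2) * lookup (conj_young \<mu>) (- g)) * content_product f \<mu> $ d))"
    proof (intro sum.cong refl)
      fix \<mu>
      have "fact n / kappa \<mu> / fact n * (lookup (conj_young \<mu>) (- g) / (fact n * kappa \<mu>)) =
          inverse (fact n) * (inverse ((kappa \<mu>)\<^sup>2) * lookup (conj_young \<mu>) (- g))"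
        by (simp add: power2_eq_square divide_inverse)
      then show "of_rat (fact n / kappa \<mu> / fact n * (lookup (conj_young \<mu>) (- g) / (fact n * kappa \<mu>))) * content_product f \<mu> $ d =
          inverse (fact n) * (of_rat (inverse ((kappa \<mu>)\<^sup>2) * lookup (conj_young \<mu>) (- g)) * content_product f \<mu> $ d)"
        using of_rat_of_nat_eq[of "fact n", where 'a = 'a] by (simp add: of_rat_mult of_rat_inverse)
    qed
    also have "\<dots> = (fps_const (inverse (fact n)) * coeff_fps (JM_product f n) (- g)) $ d"
      by (simp add: JM_product_eq_character_sum sum_distrib_left)
    finally show "(\<Sum>\<mu>\<in>partitions n. fps_const (of_rat (fact n / kappa \<mu> / fact n)) * content_product f \<mu> *
        fps_const (of_rat (lookup (conj_young \<mu>) (- g) / (fact n * kappa \<mu>)))) $ d = (fps_const (inverse (fact n)) * coeff_fps (JM_product f n) (- g)) $ d" .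
  qed
  also have "\<dots> = (\<Sum>g\<in>SymP n. single (?p (- g)) (fps_const (inverse (fact n)) * coeff_fps (JM_product f n) (- g)))"
    by (simp only: cycle_type_uminus)
  also have "\<dots> = (\<Sum>g\<in>SymP n. single (?p g) (fps_const (inverse (fact n)) * coeff_fps (JM_product f n) g))"
    using sum.reindex_bij_betw[OF bij_SymP_uminus, of "\<lambda>g. single (?p g) (fps_const (inverse (fact n)) * coeff_fps (JM_product f n) g)"] .
  also have "\<dots> = pconst (fps_const (inverse (fact n))) * cycle_type_sum n (JM_product f n)"
    by (simp add: cycle_type_sum_def pconst_def sum_distrib_left mult_single)
  finally show ?thesis .
qed

section \<open>Cut and join\<close>

lemma orb_avoid:
  assumes "l \<notin> orb g x" "m \<notin> orb g x"
  shows "orb (g + transp l m) x = orb g x"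
proof (rule orbit_cong0[of _ "orb g x"])
  show "fun_of (g + transp l m) y = fun_of g y" if "y \<in> orb g x" for y
    using that assms by (auto simp: Transposition.transpose_def)
  then show "fun_of (g + transp l m) \<in> orb g x \<rightarrow> orb g x"
    by (auto simp del: fun_of_plus intro: orbit.step)
qed simp

lemma funpow_card_orb: "(fun_of g ^^ card (orb g x)) x = x"
  using funpow_orb_eq_iff[of "card (orb g x)" g x 0] by simp

lemma funpow_orb_inj: "inj_on (\<lambda>k. (fun_of g ^^ k) x) {..<card (orb g x)}"
  by (rule inj_onI) (simp add: funpow_orb_eq_iff)

lemma orb_funpow_image: "orb g x = (\<lambda>k. (fun_of g ^^ k) x) ` {..<card (orb g x)}"
  using orbit_altdef_bounded[OF funpow_card_orb card_orb_pos, of g x] by auto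

text \<open>
  As long as an orbit of \<open>g\<close> avoids the points where \<open>h\<close> differs from \<open>g\<close>, the map \<open>h\<close> follows it.
\<close>

lemma funpow_path:
  assumes "0 < j" "h y = (g ^^ Suc k) x"
    and "\<And>t. 0 < t \<Longrightarrow> t < j \<Longrightarrow> h ((g ^^ (k + t)) x) = g ((g ^^ (k + t)) x)"
  shows "(h ^^ j) y = (g ^^ (k + j)) x"
  using assms(1,3)
proof (induction j rule: nat_induct_non_zero)
  case 1
  then show ?case using assms(2) by simp
next
  case (Suc j)
  have "(h ^^ j) y = (g ^^ (k + j)) x" by (rule Suc.IH) (use Suc.prems in auto)
  then show ?case using Suc.prems[of j] Suc.hyps by simp
qed

lemma orb_bounded_image:
  assumes "(fun_of h ^^ N) y = y" "0 < N"
  shows "orb h y = (\<lambda>j. (fun_of h ^^ j) y) ` {1..N}"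
proof -
  have "orb h y = (\<lambda>j. (fun_of h ^^ j) y) ` {..<N}"
    using orbit_altdef_bounded[OF assms] by auto
  also have "\<dots> = (\<lambda>j. (fun_of h ^^ j) y) ` {1..N}"
  proof -
    have "{..<N} = insert 0 {1..<N}" "{1..N} = insert N {1..<N}" using assms(2) by auto
    then show ?thesis using assms(1) by simp
  qed
  finally show ?thesis .
qed

text \<open>
  The cycle \<open>n, g n, g\<^sup>2 n, \<dots>\<close> is cut at \<open>l = g\<^sup>k n\<close>. The ranges of exponents exclude 0 and include the length
  of the cycle, so that \<open>n\<close> appears as the last point of its new cycle.
\<close>

lemma transp_split:
  assumes k: "0 < k" "k < card (orb g n)" and l: "l = (fun_of g ^^ k) n"
  defines "h \<equiv> g + transp l n"
  shows "orb h n = (\<lambda>j. (fun_of g ^^ j) n) ` {Suc k..card (orb g n)}" (is ?A)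
    and "orb h l = (\<lambda>j. (fun_of g ^^ j) n) ` {1..k}" (is ?B)
    and "card (orb h n) = card (orb g n) - k" (is ?C)
    and "card (orb h l) = k" (is ?D)
proof -
  let ?i = "card (orb g n)" and ?p = "\<lambda>j. (fun_of g ^^ j) n"
  have inj: "inj_on ?p {1..?i}"
  proof (rule inj_onI)
    fix a b assume ab: "a \<in> {1..?i}" "b \<in> {1..?i}" "?p a = ?p b"
    then have "a mod ?i = b mod ?i" by (simp add: funpow_orb_eq_iff)
    then show "a = b" using ab(1,2) by (cases "a = ?i"; cases "b = ?i") auto
  qed
  have pi: "?p ?i = n" by (rule funpow_card_orb)
  have hl: "fun_of h l = ?p (Suc 0)" and hn: "fun_of h n = ?p (Suc k)"
    by (simp_all add: h_def l)
  have he: "fun_of h (?p j) = fun_of g (?p j)" if "0 < j" "j < ?i" "j \<noteq> k" for j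
  proof -
    have "?p j \<noteq> ?p ?i" "?p j \<noteq> ?p k" using inj_on_eq_iff[OF inj, of j] k that by auto
    then show ?thesis unfolding pi l[symmetric] by (simp add: h_def Transposition.transpose_def)
  qed
  have pn: "(fun_of h ^^ j) n = ?p (k + j)" if "0 < j" "j \<le> ?i - k" for j
    by (rule funpow_path[where g = "fun_of g" and k = k and x = n and h = "fun_of h" and y = n, OF that(1) hn]) (use he that in auto)
  have pl: "(fun_of h ^^ j) l = ?p (0 + j)" if "0 < j" "j \<le> k" for j
    by (rule funpow_path[where g = "fun_of g" and k = 0 and x = n and h = "fun_of h" and y = l, OF that(1) hl]) (use he that k in auto)
  have "orb h n = (\<lambda>j. (fun_of h ^^ j) n) ` {1..?i - k}"
    by (rule orb_bounded_image) (use pn[of "?i - k"] k pi in auto)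
  also have "\<dots> = (\<lambda>j. ?p (k + j)) ` {1..?i - k}" by (intro image_cong refl) (use pn in auto)
  also have "\<dots> = ?p ` ((+) k ` {1..?i - k})" by (simp only: image_image)
  also have "(+) k ` {1..?i - k} = {Suc k..?i}" using k by (simp add: image_add_atLeastAtMost)
  finally show A: ?A .
  have "orb h l = (\<lambda>j. (fun_of h ^^ j) l) ` {1..k}"
    by (rule orb_bounded_image) (use pl[of k] k l in auto)
  also have "\<dots> = ?p ` {1..k}" by (intro image_cong refl) (use pl in auto)
  finally show B: ?B .
  show ?C unfolding A using k by (subst card_image[OF inj_on_subset[OF inj]]) auto
  show ?D unfolding B using k by (subst card_image[OF inj_on_subset[OF inj]]) auto
qed

definition var_exp :: "nat \<Rightarrow> nat \<Rightarrow>\<^sub>0 nat"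
  where "var_exp i = single (i - 1) 1"

text \<open>
  The exponent of the cycles of a permutation of \<open>n + 1\<close> points other than the marked one, which contains
  \<open>n\<close>.
\<close>

definition rest_type :: "nat \<Rightarrow> fperm \<Rightarrow> nat \<Rightarrow>\<^sub>0 nat"
  where "rest_type n g = (\<Sum>A\<in>orbs (Suc n) g - {orb g n}. var_exp (card A))"

lemma pexp_cycle_type: "pexp (cycle_type n (fun_of g)) = (\<Sum>A\<in>orbs n g. var_exp (card A))"
proof -
  have "pexp \<alpha> = sum_mset (image_mset var_exp (mset \<alpha>))" for \<alpha>
    by (induction \<alpha>) (simp_all add: pexp_def var_exp_def)
  then have "pexp (cycle_type n (fun_of g)) = sum_mset (image_mset var_exp (image_mset card (mset_set (orbs n g))))"
    by (simp add: cycle_type_def orbs_def)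
  then show ?thesis by (simp add: sum_unfold_sum_mset multiset.map_comp comp_def)
qed

lemma pexp_cycle_type_Suc: "pexp (cycle_type (Suc n) (fun_of g)) = var_exp (card (orb g n)) + rest_type n g"
  unfolding pexp_cycle_type rest_type_def by (rule sum.remove) (auto simp: orbs_def)

lemma split_rest_type:
  assumes g: "g \<in> SymP (Suc n)" and l: "l \<in> orb g n" "l \<noteq> n"
  defines "h \<equiv> g + transp l n"
  shows "card (orb g n) = card (orb h n) + card (orb h l)" "rest_type n h = rest_type n g + var_exp (card (orb h l))"
proof -
  let ?i = "card (orb g n)" and ?p = "\<lambda>j. (fun_of g ^^ j) n"
  obtain k where k: "k < ?i" "l = ?p k" using l(1) orb_funpow_image[of g n] by auto
  have k0: "0 < k" using l(2) k(2) by (cases k) auto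
  note sp = transp_split[OF k0 k, folded h_def]
  show "card (orb g n) = card (orb h n) + card (orb h l)" using sp(3,4) k by simp
  have un: "orb g n = orb h n \<union> orb h l"
  proof -
    have "orb g n = ?p ` {1..?i}" by (rule orb_bounded_image) (simp_all add: funpow_card_orb)
    also have "{1..?i} = {Suc k..?i} \<union> {1..k}" using k k0 by auto
    finally show ?thesis unfolding sp(1,2) image_Un .
  qed
  have ne: "orb h n \<noteq> orb h l"
  proof
    assume e: "orb h n = orb h l"
    have "inj_on ?p {..<?i}" by (rule funpow_orb_inj)
    have "?p k \<in> ?p ` {Suc k..?i}" using e sp(1) k(2) self_orb[of l h] by simp
    then obtain j where j: "Suc k \<le> j" "j \<le> ?i" "?p k = ?p j" by auto
    then have "k mod ?i = j mod ?i" by (simp add: funpow_orb_eq_iff)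
    then show False using j k k0 by (cases "j = ?i") auto
  qed
  have away: "orb h x = orb g x" if "x \<notin> orb g n" for x
    unfolding h_def by (rule orb_avoid) (use that l(1) orb_eq self_orb in metis)+
  have ln: "l < Suc n" using orb_subset[OF g, of n] l(1) by auto
  have O: "orbs (Suc n) h - {orb h n} = insert (orb h l) (orbs (Suc n) g - {orb g n})"
  proof (intro equalityI subsetI)
    fix A assume A: "A \<in> orbs (Suc n) h - {orb h n}"
    then obtain x where x: "x < Suc n" "A = orb h x" by (auto simp: orbs_def)
    show "A \<in> insert (orb h l) (orbs (Suc n) g - {orb g n})"
    proof (cases "x \<in> orb g n")
      case True
      then have "x \<in> orb h l" using un A x orb_eq by blast
      then show ?thesis using x orb_eq by simp
    next
      case False
      then show ?thesis using x away[OF False] orb_eq_iff by (auto simp: orbs_def)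
    qed
  next
    fix A assume "A \<in> insert (orb h l) (orbs (Suc n) g - {orb g n})"
    then consider "A = orb h l" | x where "x < Suc n" "A = orb g x" "A \<noteq> orb g n" by (auto simp: orbs_def)
    then show "A \<in> orbs (Suc n) h - {orb h n}"
    proof cases
      case 1
      then show ?thesis using ne ln by (auto simp: orbs_def)
    next
      case 2
      then have xn: "x \<notin> orb g n" using orb_eq by metis
      then have "x \<notin> orb h n" using un by blast
      then have "orb h x \<noteq> orb h n" using self_orb by metis
      then show ?thesis using 2 away[OF xn] by (auto simp: orbs_def)
    qed
  qed
  have "orb h l \<notin> orbs (Suc n) g - {orb g n}"
  proof
    assume "orb h l \<in> orbs (Suc n) g - {orb g n}"
    then have "orb h l = orb g l" using orbs_mem[of "orb h l" "Suc n" g l] by simp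
    moreover have "orb g l = orb g n" using l(1) by (rule orb_eq)
    ultimately show False using \<open>orb h l \<in> _\<close> by simp
  qed
  then show "rest_type n h = rest_type n g + var_exp (card (orb h l))"
    unfolding rest_type_def O by (subst sum.insert) (auto simp: add.commute)
qed

text \<open>
  Multiplying by the same transposition again undoes the join, and this cuts the joined cycle.
\<close>

lemma join_rest_type:
  assumes g: "g \<in> SymP (Suc n)" and l: "l \<notin> orb g n" "l < Suc n"
  defines "h \<equiv> g + transp l n"
  shows "card (orb h n) = card (orb g n) + card (orb g l)" "rest_type n g = rest_type n h + var_exp (card (orb g l))"
proof -
  have hS: "h \<in> SymP (Suc n)" unfolding h_def using g l by auto
  have ln: "l \<noteq> n" using l(1) by auto
  let ?j = "card (orb g l)"
  have nl: "n \<notin> orb g l" using l(1) orb_eq self_orb by metis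
  have "(fun_of h ^^ ?j) n = (fun_of g ^^ (0 + ?j)) l"
  proof (rule funpow_path)
    show "fun_of h n = (fun_of g ^^ Suc 0) l" by (simp add: h_def)
    fix t assume t: "0 < t" "t < ?j"
    have "(fun_of g ^^ t) l \<noteq> n" using nl funpow_in_orb[of t g l] by metis
    moreover have "(fun_of g ^^ t) l \<noteq> l" using funpow_orb_eq_iff[of t g l 0] t by simp
    ultimately show "fun_of h ((fun_of g ^^ (0 + t)) l) = fun_of g ((fun_of g ^^ (0 + t)) l)"
      by (simp add: h_def Transposition.transpose_def)
  qed simp
  then have "l \<in> orb h n" using funpow_in_orb[of ?j h n] funpow_card_orb[of g l] by simp
  moreover have "h + transp l n = g" by (simp add: h_def add.assoc)
  ultimately show "card (orb h n) = card (orb g n) + card (orb g l)" "rest_type n g = rest_type n h + var_exp (card (orb g l))"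
    using split_rest_type[OF hS _ ln] by simp_all
qed

subsection \<open>The cut-and-join operator on marked cycles\<close>

lemma perp_superset:
  assumes "finite A" "keys P \<subseteq> A"
  shows "perp i P = (\<Sum>m\<in>A. single (m - var_exp i) (of_nat i * of_nat (lookup m (i - 1)) * lookup P m))"
  unfolding perp_def var_exp_def[symmetric] using assms
  by (intro sum.mono_neutral_left) (auto simp: in_keys_iff)

lemma perp_single: "perp i (single m c) = single (m - var_exp i) (of_nat i * of_nat (lookup m (i - 1)) * c)"
  by (subst perp_superset[of "{m}"]) auto

lemma perp_add: "perp i (P + Q) = perp i P + perp i (Q :: 'r::comm_semiring_1 ppoly)"
proof -
  let ?A = "keys P \<union> keys Q"
  show ?thesis using keys_add[of P Q]
    by (simp add: perp_superset[of ?A] lookup_add distrib_left single_add sum.distrib)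
qed

lemma perp_zero [simp]: "perp i 0 = 0"
  by (simp add: perp_def)

lemma perp_sum: "perp i (sum h A) = (\<Sum>x\<in>A. perp i (h x))"
  by (induction A rule: infinite_finite_induct) (simp_all add: perp_add)

lemma perp_const_mult: "perp i (pconst c * P) = pconst c * perp i (P :: 'r::comm_semiring_1 ppoly)"
proof -
  have "P = (\<Sum>m\<in>keys P. single m (lookup P m))" by (simp add: sum_single_keys)
  also have "perp i (pconst c * \<dots>) = pconst c * perp i \<dots>"
    by (simp add: sum_distrib_left perp_sum perp_single pconst_def mult_single mult_ac)
  finally show ?thesis .
qed

text \<open>
  The cut-and-join operator on states of a marked cycle: \<open>v i\<close> collects the permutations whose marked cycle
  has length \<open>i\<close>. The first sum describes cuts, the second joins. The bound \<open>N\<close> keeps the first sum finite; any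
  \<open>N\<close> at least as large as the number of points gives the same result. No cycle has length 0.
\<close>

definition cut_join :: "nat \<Rightarrow> (nat \<Rightarrow> 'r::comm_ring_1 ppoly) \<Rightarrow> nat \<Rightarrow> 'r ppoly"
  where "cut_join N v a = (if a = 0 then 0 else (\<Sum>i\<in>{a<..a + N}. pvar (i - a) * v i) + (\<Sum>j\<in>{1..<a}. perp j (v (a - j))))"

definition marked_sum :: "nat \<Rightarrow> (fperm \<Rightarrow>\<^sub>0 'a::field_char_0) fps \<Rightarrow> nat \<Rightarrow> 'a fps ppoly"
  where "marked_sum n x a = (\<Sum>g\<in>SymP (Suc n). if card (orb g n) = a then single (rest_type n g) (coeff_fps x g) else 0)"

lemma pvar_single: "pvar i * single m c = (single (m + var_exp i) c :: 'r::comm_ring_1 ppoly)"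
  by (simp add: pvar_def mult_single var_exp_def add.commute)

lemma card_orb_le: "g \<in> SymP (Suc n) \<Longrightarrow> card (orb g n) \<le> Suc n"
  using card_mono[OF _ orb_subset[of g "Suc n" n]] by simp

lemma lookup_rest_type: "0 < j \<Longrightarrow> lookup (rest_type n g) (j - 1) = card {A \<in> orbs (Suc n) g - {orb g n}. card A = j}"
proof -
  assume j: "0 < j"
  have pos: "0 < card A" if "A \<in> orbs (Suc n) g" for A using that by (auto simp: orbs_def)
  have "lookup (rest_type n g) (j - 1) = (\<Sum>A\<in>orbs (Suc n) g - {orb g n}. if card A = j then 1 else 0)"
    unfolding rest_type_def lookup_sum
  proof (intro sum.cong refl)
    fix A assume "A \<in> orbs (Suc n) g - {orb g n}"
    then have "card A - 1 = j - 1 \<longleftrightarrow> card A = j" using pos[of A] j by auto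
    then show "lookup (var_exp (card A)) (j - 1) = (if card A = j then 1 else 0)"
      by (simp add: var_exp_def lookup_single when_def)
  qed
  then show ?thesis by (simp add: sum.If_cases Int_def)
qed

text \<open>
  Summing over the points \<open>l\<close> of the marked cycle gives each way of cutting it once. Summing over the points of the
  other cycles counts each of them with its length times its multiplicity, which are the two factors produced
  by \<open>p\<^sub>i\<^sup>\<bottom> = i \<partial>/\<partial>p\<^sub>i\<close>.
\<close>

lemma cut_and_join:
  fixes c :: "'r::comm_ring_1"
  assumes g: "g \<in> SymP (Suc n)"
  defines "i \<equiv> card (orb g n)"
  shows "(\<Sum>l<n. if card (orb (g + transp l n) n) = a then single (rest_type n (g + transp l n)) c else 0) =
    (if 0 < a \<and> a < i then pvar (i - a) * single (rest_type n g) c else 0) +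
    (if i < a then perp (a - i) (single (rest_type n g) c) else 0)" (is "sum ?F _ = _")
proof -
  let ?p = "\<lambda>j. (fun_of g ^^ j) n"
  have sub: "orb g n \<subseteq> {..<Suc n}" by (rule orb_subset[OF g]) simp
  have i0: "0 < i" by (simp add: i_def)
  have cut: "sum ?F (orb g n - {n}) = (if 0 < a \<and> a < i then pvar (i - a) * single (rest_type n g) c else 0)"
  proof -
    have o: "orb g n - {n} = ?p ` {1..<i}"
    proof -
      have "orb g n = ?p ` {..<i}" unfolding i_def by (rule orb_funpow_image)
      also have "{..<i} = insert 0 {1..<i}" using i0 by auto
      finally have "orb g n = insert n (?p ` {1..<i})" by simp
      moreover have "n \<notin> ?p ` {1..<i}"
      proof
        assume "n \<in> ?p ` {1..<i}"
        then obtain k where k: "k \<in> {1..<i}" "?p k = n" by force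
        then have "k mod i = 0" using funpow_orb_eq_iff[of k g n 0] by (simp add: i_def)
        then show False using k(1) by simp
      qed
      ultimately show ?thesis by blast
    qed
    have "inj_on ?p {1..<i}" by (rule inj_on_subset[OF funpow_orb_inj[of g n]]) (auto simp: i_def)
    then have "sum ?F (orb g n - {n}) = (\<Sum>k\<in>{1..<i}. ?F (?p k))" unfolding o by (simp add: sum.reindex)
    also have "\<dots> = (\<Sum>k\<in>{1..<i}. if i - k = a then single (rest_type n g + var_exp k) c else 0)"
    proof (intro sum.cong refl)
      fix k assume k: "k \<in> {1..<i}"
      then have "?p k \<in> orb g n - {n}" unfolding o by (rule imageI)
      then have l: "?p k \<in> orb g n" "?p k \<noteq> n" by auto
      have "card (orb (g + transp (?p k) n) n) = i - k" "card (orb (g + transp (?p k) n) (?p k)) = k"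
        using transp_split(3,4)[of k g n "?p k"] k by (auto simp: i_def)
      then show "?F (?p k) = (if i - k = a then single (rest_type n g + var_exp k) c else 0)"
        using split_rest_type(2)[OF g l] by simp
    qed
    also have "\<dots> = (\<Sum>k\<in>{1..<i}. if k = i - a then (if 0 < a \<and> a < i then single (rest_type n g + var_exp (i - a)) c else 0) else 0)"
      by (intro sum.cong refl) auto
    also have "\<dots> = (if 0 < a \<and> a < i then single (rest_type n g + var_exp (i - a)) c else 0)"
      by (subst sum.delta) auto
    finally show ?thesis by (simp add: pvar_single)
  qed
  let ?O = "orbs (Suc n) g - {orb g n}"
  have join: "sum ?F ({..<n} - orb g n) = (if i < a then perp (a - i) (single (rest_type n g) c) else 0)"
  proof -
    let ?G = "\<lambda>A. if i + card A = a then single (rest_type n g - var_exp (card A)) c else 0"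
    have "sum ?F ({..<n} - orb g n) = (\<Sum>l\<in>{..<n} - orb g n. ?G (orb g l))"
    proof (intro sum.cong refl)
      fix l assume l: "l \<in> {..<n} - orb g n"
      then have "rest_type n (g + transp l n) = rest_type n g - var_exp (card (orb g l))"
        using join_rest_type(2)[OF g, of l] by simp
      then show "?F l = ?G (orb g l)" using join_rest_type(1)[OF g, of l] l by (simp add: i_def)
    qed
    also have "\<dots> = (\<Sum>A\<in>?O. \<Sum>l\<in>{l \<in> {..<n} - orb g n. orb g l = A}. ?G (orb g l))"
      by (rule sum.group[symmetric]) (auto simp: orbs_def dest: orb_eq_iff[THEN iffD1])
    also have "\<dots> = (\<Sum>A\<in>?O. of_nat (card A) * ?G A)"
    proof (intro sum.cong refl)
      fix A assume A: "A \<in> ?O"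
      then obtain x where x: "x < Suc n" "A = orb g x" "A \<noteq> orb g n" by (auto simp: orbs_def)
      have "{l \<in> {..<n} - orb g n. orb g l = A} = A"
      proof (intro equalityI subsetI)
        fix l assume "l \<in> A"
        then have "orb g l = A" "l < Suc n" using x orb_eq orb_subset[OF g x(1)] by auto
        moreover from this have "l \<notin> orb g n" using x(3) orb_eq by metis
        moreover from this have "l \<noteq> n" by auto
        ultimately show "l \<in> {l \<in> {..<n} - orb g n. orb g l = A}" by auto
      qed auto
      moreover have "(\<Sum>l\<in>{l \<in> {..<n} - orb g n. orb g l = A}. ?G (orb g l)) = (\<Sum>l\<in>{l \<in> {..<n} - orb g n. orb g l = A}. ?G A)"
        by (intro sum.cong refl) auto
      ultimately show "(\<Sum>l\<in>{l \<in> {..<n} - orb g n. orb g l = A}. ?G (orb g l)) = of_nat (card A) * ?G A"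
        by (simp only: sum_constant)
    qed
    also have "\<dots> = (\<Sum>A\<in>?O. if i < a \<and> card A = a - i then of_nat (a - i) * single (rest_type n g - var_exp (a - i)) c else 0)"
    proof (intro sum.cong refl)
      fix A assume "A \<in> ?O"
      then obtain x where "A = orb g x" by (auto simp: orbs_def)
      then have "0 < card A" by (metis card_orb_pos)
      then have "i + card A = a \<longleftrightarrow> i < a \<and> card A = a - i" by auto
      then show "of_nat (card A) * ?G A = (if i < a \<and> card A = a - i then of_nat (a - i) * single (rest_type n g - var_exp (a - i)) c else 0)"
        by simp
    qed
    also have "\<dots> = (if i < a then of_nat (card {A \<in> ?O. card A = a - i}) * (of_nat (a - i) * single (rest_type n g - var_exp (a - i)) c) else 0)"
      by (cases "i < a") (simp_all add: sum.If_cases Int_def)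
    also have "\<dots> = (if i < a then perp (a - i) (single (rest_type n g) c) else 0)"
    proof (cases "i < a")
      case True
      have "of_nat x * (of_nat y * single m c) = single m (of_nat y * of_nat x * c)" for x y and m :: "nat \<Rightarrow>\<^sub>0 nat"
        by (simp add: single_of_nat[symmetric] mult_single mult_ac del: single_of_nat)
      then show ?thesis using True by (simp only: if_True perp_single lookup_rest_type zero_less_diff)
    qed simp
    finally show ?thesis .
  qed
  have "{..<n} = (orb g n - {n}) \<union> ({..<n} - orb g n)" using sub by auto
  then have "sum ?F {..<n} = sum ?F (orb g n - {n}) + sum ?F ({..<n} - orb g n)"
    by (metis (no_types, lifting) finite_Diff finite_orb finite_lessThan sum.union_disjoint Diff_disjoint Int_Diff Int_commute inf_bot_left)
  then show ?thesis unfolding cut join .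
qed

lemma coeff_fps_JM: "coeff_fps (x * fps_const (JM n)) g = (\<Sum>l<n. coeff_fps x (g + transp l n))"
proof (rule fps_ext)
  fix d
  have "g - transp l n = g + transp l n" for l
    by (metis diff_conv_add_uminus uminus_transp)
  then show "coeff_fps (x * fps_const (JM n)) g $ d = (\<Sum>l<n. coeff_fps x (g + transp l n)) $ d"
    by (simp add: JM_def sum_distrib_left lookup_sum lookup_mult_single_right fps_sum_nth del: add_uminus_conv_diff)
qed

lemma marked_sum_JM:
  assumes N: "Suc n \<le> N"
  shows "marked_sum n (x * fps_const (JM n)) = cut_join N (marked_sum n x)"
proof
  fix a
  let ?S = "SymP (Suc n)"
  let ?s = "\<lambda>g c. if card (orb g n) = a then single (rest_type n g) c else 0"
  have "marked_sum n (x * fps_const (JM n)) a = (\<Sum>g\<in>?S. \<Sum>l<n. ?s g (coeff_fps x (g + transp l n)))"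
    unfolding marked_sum_def coeff_fps_JM by (intro sum.cong refl) (simp add: single_sum)
  also have "\<dots> = (\<Sum>l<n. \<Sum>g\<in>?S. ?s g (coeff_fps x (g + transp l n)))" by (rule sum.swap)
  also have "\<dots> = (\<Sum>l<n. \<Sum>g\<in>?S. ?s (g + transp l n) (coeff_fps x g))"
  proof (rule sum.cong[OF refl])
    fix l assume "l \<in> {..<n}"
    then have "transp l n \<in> ?S" by auto
    from sum.reindex_bij_betw[OF bij_SymP_plus_right[OF this], of "\<lambda>g. ?s g (coeff_fps x (g + transp l n))"]
    show "(\<Sum>g\<in>?S. ?s g (coeff_fps x (g + transp l n))) = (\<Sum>g\<in>?S. ?s (g + transp l n) (coeff_fps x g))"
      by (simp only: add.assoc transp_plus_self add_0_right)
  qed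
  also have "\<dots> = (\<Sum>g\<in>?S. \<Sum>l<n. ?s (g + transp l n) (coeff_fps x g))" by (rule sum.swap)
  also have "\<dots> = (\<Sum>g\<in>?S. (if 0 < a \<and> a < card (orb g n) then pvar (card (orb g n) - a) * single (rest_type n g) (coeff_fps x g) else 0) +
    (if card (orb g n) < a then perp (a - card (orb g n)) (single (rest_type n g) (coeff_fps x g)) else 0))"
    by (rule sum.cong[OF refl cut_and_join])
  also have "\<dots> = cut_join N (marked_sum n x) a"
  proof (cases "a = 0")
    case False
    have 1: "(\<Sum>i\<in>{a<..a + N}. pvar (i - a) * marked_sum n x i) =
        (\<Sum>g\<in>?S. if 0 < a \<and> a < card (orb g n) then pvar (card (orb g n) - a) * single (rest_type n g) (coeff_fps x g) else 0)"
    proof -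
      have "(\<Sum>i\<in>{a<..a + N}. pvar (i - a) * marked_sum n x i) = (\<Sum>g\<in>?S. \<Sum>i\<in>{a<..a + N}.
          if i = card (orb g n) then pvar (card (orb g n) - a) * single (rest_type n g) (coeff_fps x g) else 0)"
        unfolding marked_sum_def sum_distrib_left by (subst sum.swap) (intro sum.cong refl, auto)
      also have "\<dots> = (\<Sum>g\<in>?S. if 0 < a \<and> a < card (orb g n) then pvar (card (orb g n) - a) * single (rest_type n g) (coeff_fps x g) else 0)"
        by (intro sum.cong refl) (use False N in \<open>auto simp: sum.delta dest!: card_orb_le\<close>)
      finally show ?thesis .
    qed
    have 2: "(\<Sum>j\<in>{1..<a}. perp j (marked_sum n x (a - j))) =
        (\<Sum>g\<in>?S. if card (orb g n) < a then perp (a - card (orb g n)) (single (rest_type n g) (coeff_fps x g)) else 0)"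
    proof -
      have "(\<Sum>j\<in>{1..<a}. perp j (marked_sum n x (a - j))) = (\<Sum>g\<in>?S. \<Sum>j\<in>{1..<a}.
          if j = a - card (orb g n) then (if card (orb g n) < a then perp (a - card (orb g n)) (single (rest_type n g) (coeff_fps x g)) else 0) else 0)"
        unfolding marked_sum_def perp_sum by (subst sum.swap) (intro sum.cong refl, auto)
      also have "\<dots> = (\<Sum>g\<in>?S. if card (orb g n) < a then perp (a - card (orb g n)) (single (rest_type n g) (coeff_fps x g)) else 0)"
      proof (intro sum.cong refl)
        fix g
        have "0 < card (orb g n)" by simp
        then show "(\<Sum>j\<in>{1..<a}. if j = a - card (orb g n) then (if card (orb g n) < a then perp (a - card (orb g n)) (single (rest_type n g) (coeff_fps x g)) else 0) else 0) =
            (if card (orb g n) < a then perp (a - card (orb g n)) (single (rest_type n g) (coeff_fps x g)) else 0)"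
          using False by (subst sum.delta) auto
      qed
      finally show ?thesis .
    qed
    show ?thesis using False unfolding cut_join_def 1 2 by (simp add: sum.distrib)
  qed (simp add: cut_join_def)
  finally show "marked_sum n (x * fps_const (JM n)) a = cut_join N (marked_sum n x) a" .
qed

lemma marked_sum_add: "marked_sum n (x + y) a = marked_sum n x a + marked_sum n y a"
proof -
  have "coeff_fps (x + y) g = coeff_fps x g + coeff_fps y g" for g by (rule fps_ext) (simp add: lookup_add)
  then show ?thesis unfolding marked_sum_def sum.distrib[symmetric] by (intro sum.cong refl) (simp add: single_add)
qed

lemma marked_sum_sum:
  fixes h :: "'b \<Rightarrow> (fperm \<Rightarrow>\<^sub>0 'a::field_char_0) fps"
  shows "marked_sum n (sum h A) a = (\<Sum>i\<in>A. marked_sum n (h i) a)"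
proof -
  have "marked_sum n (0 :: (fperm \<Rightarrow>\<^sub>0 'a) fps) a = 0" unfolding marked_sum_def
  proof (intro sum.neutral ballI)
    fix g have "coeff_fps (0 :: (fperm \<Rightarrow>\<^sub>0 'a) fps) g = 0" by (rule fps_ext) simp
    then show "(if card (orb g n) = a then single (rest_type n g) (coeff_fps (0 :: (fperm \<Rightarrow>\<^sub>0 'a) fps) g) else 0) = 0" by simp
  qed
  then show ?thesis by (induction A rule: infinite_finite_induct) (simp_all add: marked_sum_add)
qed

lemma marked_sum_scale:
  assumes "\<And>g. coeff_fps y g = c * coeff_fps x g"
  shows "marked_sum n y a = pconst c * marked_sum n x a"
  unfolding marked_sum_def sum_distrib_left by (intro sum.cong refl) (simp add: assms pconst_def mult_single)

lemma marked_sum_JM_power: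
  assumes "Suc n \<le> N"
  shows "marked_sum n (x * fps_const (JM n ^ k)) = (cut_join N ^^ k) (marked_sum n x)"
proof (induction k)
  case (Suc k)
  have "x * fps_const (JM n ^ Suc k) = x * fps_const (JM n ^ k) * fps_const (JM n)"
    by (simp add: mult.assoc power_commutes)
  then show ?case using Suc by (simp add: marked_sum_JM[OF assms])
qed simp

lemma cycle_type_sum_Suc:
  assumes N: "Suc n \<le> N"
  shows "cycle_type_sum (Suc n) x = (\<Sum>a\<in>{1..N}. pvar a * marked_sum n x a)"
proof -
  have "(\<Sum>a\<in>{1..N}. pvar a * marked_sum n x a) = (\<Sum>g\<in>SymP (Suc n). \<Sum>a\<in>{1..N}.
      if a = card (orb g n) then single (rest_type n g + var_exp (card (orb g n))) (coeff_fps x g) else 0)"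
    unfolding marked_sum_def sum_distrib_left by (subst sum.swap) (intro sum.cong refl, auto simp: pvar_single)
  also have "\<dots> = (\<Sum>g\<in>SymP (Suc n). single (rest_type n g + var_exp (card (orb g n))) (coeff_fps x g))"
  proof (intro sum.cong refl)
    fix g assume "g \<in> SymP (Suc n)"
    then have "card (orb g n) \<in> {1..N}" using N card_orb_le[of g n] card_orb_pos[of g n] by (auto simp: Suc_le_eq simp del: card_orb_pos)
    then show "(\<Sum>a\<in>{1..N}. if a = card (orb g n) then single (rest_type n g + var_exp (card (orb g n))) (coeff_fps x g) else 0) =
        single (rest_type n g + var_exp (card (orb g n))) (coeff_fps x g)" by simp
  qed
  finally show ?thesis by (simp add: cycle_type_sum_def pexp_cycle_type_Suc add.commute)
qed

text \<open>
  A permutation of the first \<open>n\<close> points fixes the new point, whose cycle has length 1.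
\<close>

lemma marked_sum_start:
  assumes x: "\<And>d. x $ d \<in> group_ring n"
  shows "marked_sum n x = (\<lambda>a. if a = 1 then cycle_type_sum n x else 0)"
proof
  fix a
  have z: "coeff_fps x g = 0" if "g \<notin> SymP n" for g
    using x that by (intro fps_ext) (simp add: group_ring_iff)
  have o: "orb g n = {n}" if "g \<in> SymP n" for g
    using SymP_fix[OF that, of n] by (simp add: orbit_eq_singleton_iff)
  have r: "rest_type n g = pexp (cycle_type n (fun_of g))" if g: "g \<in> SymP n" for g
  proof -
    have "orbs (Suc n) g = insert {n} (orbs n g)" by (simp add: orbs_def lessThan_Suc o[OF g])
    moreover have "{n} \<notin> orbs n g" using Union_orbs[OF g] by (metis UnionI lessThan_iff less_irrefl singletonI)
    ultimately have "orbs (Suc n) g - {orb g n} = orbs n g" by (simp add: o[OF g])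
    then show ?thesis by (simp add: rest_type_def pexp_cycle_type)
  qed
  have "marked_sum n x a = (\<Sum>g\<in>SymP n. if card (orb g n) = a then single (rest_type n g) (coeff_fps x g) else 0)"
    unfolding marked_sum_def using SymP_mono[of n "Suc n"] z by (intro sum.mono_neutral_right) auto
  also have "\<dots> = (\<Sum>g\<in>SymP n. if a = 1 then single (pexp (cycle_type n (fun_of g))) (coeff_fps x g) else 0)"
    by (intro sum.cong refl) (auto simp: o r)
  also have "\<dots> = (if a = 1 then cycle_type_sum n x else 0)" by (simp add: cycle_type_sum_def)
  finally show "marked_sum n x a = (if a = 1 then cycle_type_sum n x else 0)" .
qed

lemma JM_series_nth_group_ring: "JM_series f n $ d \<in> group_ring (Suc n)"
  unfolding JM_series_def fps_nth_Abs_fps by (intro group_ring_mult group_ring_single group_ring_power JM_group_ring) auto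

lemma JM_product_group_ring: "JM_product f n $ d \<in> group_ring n"
proof (induction n arbitrary: d)
  case 0
  then show ?case by (simp add: fps_one_nth)
next
  case (Suc n)
  have "JM_product f n $ i \<in> group_ring (Suc n)" for i using group_ring_mono[OF _ Suc] by simp
  then show ?case by (auto simp: fps_mult_nth intro!: group_ring_sum group_ring_mult JM_series_nth_group_ring)
qed

lemma cut_join_scale: "cut_join N (\<lambda>i. pconst c * v i) a = pconst c * cut_join N v a"
  by (simp add: cut_join_def distrib_left sum_distrib_left perp_const_mult mult.left_commute)

lemma cut_join_pow_scale: "(cut_join N ^^ k) (\<lambda>i. pconst c * v i) = (\<lambda>a. pconst c * (cut_join N ^^ k) v a)"
  by (induction k) (auto simp: cut_join_scale)

lemma coeff_fps_X: "coeff_fps (y * fps_X ^ k) g = fps_X ^ k * coeff_fps (y :: (fperm \<Rightarrow>\<^sub>0 'a::field_char_0) fps) g"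
  by (rule fps_ext) (simp add: fps_X_power_mult_right_nth fps_X_power_mult_nth)

lemma coeff_fps_scal: "coeff_fps (fps_const (scal c) * y) g = fps_const c * coeff_fps (y :: (fperm \<Rightarrow>\<^sub>0 'a::field_char_0) fps) g"
  by (rule fps_ext) simp

lemma coeff_fps_term:
  "coeff_fps (x * (fps_const (scal c * J) * fps_X ^ k)) g = fps_const c * fps_X ^ k * coeff_fps (x * fps_const J) g"
  for c :: "'a::field_char_0"
proof -
  have "x * fps_const (scal c * J) = fps_const (scal c) * (x * fps_const J)"
    by (rule fps_ext) (simp add: scal_commute_left)
  then have "x * (fps_const (scal c * J) * fps_X ^ k) = fps_const (scal c) * ((x * fps_const J) * fps_X ^ k)"
    by (simp add: mult.assoc[symmetric])
  then show ?thesis by (simp only: coeff_fps_scal coeff_fps_X) (rule mult.assoc[symmetric])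
qed

lemma scaled_sum_swap:
  fixes c Y :: "'r::comm_ring_1"
  shows "c * (\<Sum>a\<in>A. p a * ((\<Sum>k\<in>B. q k * T k a) + Y * W a)) =
    (\<Sum>k\<in>B. q k * (\<Sum>a\<in>A. p a * (c * T k a))) + Y * (c * (\<Sum>a\<in>A. p a * W a))"
proof -
  have "(\<Sum>a\<in>A. \<Sum>k\<in>B. c * (p a * (q k * T k a))) = (\<Sum>k\<in>B. \<Sum>a\<in>A. q k * (p a * (c * T k a)))"
    by (subst sum.swap) (simp add: mult_ac)
  moreover have "(\<Sum>a\<in>A. c * (p a * (Y * W a))) = (\<Sum>a\<in>A. Y * (c * (p a * W a)))"
    by (simp add: mult_ac)
  ultimately show ?thesis by (simp add: sum_distrib_left distrib_left sum.distrib)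
qed

text \<open>
  The recurrence involves all coefficients of \<open>f\<close>. It is stated modulo \<open>y\<^sup>M\<close> so that only finite sums over \<open>k\<close>
  occur.
\<close>

theorem content_series_recurrence:
  fixes f :: "'a::field_char_0 fps"
  defines "\<Phi> \<equiv> content_series f"
  assumes N: "Suc n \<le> N"
  shows "\<exists>R. of_nat (Suc n) * \<Phi> $ Suc n =
    (\<Sum>k<M. pconst (fps_const (f $ k) * fps_X ^ k) *
      (\<Sum>a\<in>{1..N}. pvar a * (cut_join N ^^ k) (\<lambda>a. if a = 1 then \<Phi> $ n else 0) a)) + pconst (fps_X ^ M) * R"
proof -
  let ?c = "fps_const (inverse (fact n)) :: 'a fps"
  let ?v = "\<lambda>a. if a = 1 then cycle_type_sum n (JM_product f n) else 0"
  have "JM_product f (Suc n) = JM_product f n * (fps_shift M (JM_series f n) * fps_X ^ M + fps_cutoff M (JM_series f n))"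
    by (simp add: fps_shift_cutoff)
  also have "fps_cutoff M (JM_series f n) = (\<Sum>k<M. fps_const (scal (f $ k) * JM n ^ k) * fps_X ^ k)"
    by (rule fps_ext) (simp add: fps_sum_nth JM_series_def fps_X_power_mult_right_nth if_distrib sum.If_cases cong: if_cong)
  finally have Z: "JM_product f (Suc n) = (\<Sum>k<M. JM_product f n * (fps_const (scal (f $ k) * JM n ^ k) * fps_X ^ k)) + JM_product f n * fps_shift M (JM_series f n) * fps_X ^ M"
    by (simp add: distrib_left sum_distrib_left mult.assoc add.commute)
  have t: "marked_sum n (JM_product f n * (fps_const (scal (f $ k) * JM n ^ k) * fps_X ^ k)) a =
      pconst (fps_const (f $ k) * fps_X ^ k) * (cut_join N ^^ k) ?v a" for k a
    by (subst marked_sum_scale[OF coeff_fps_term]) (simp add: marked_sum_JM_power[OF N] marked_sum_start[OF JM_product_group_ring])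
  have V: "marked_sum n (JM_product f (Suc n)) a = (\<Sum>k<M. pconst (fps_const (f $ k) * fps_X ^ k) * (cut_join N ^^ k) ?v a)
      + pconst (fps_X ^ M) * marked_sum n (JM_product f n * fps_shift M (JM_series f n)) a" for a
    unfolding Z marked_sum_add marked_sum_sum t by (subst marked_sum_scale[OF coeff_fps_X]) (rule refl)
  have "of_nat (Suc n) * \<Phi> $ Suc n = pconst ?c * cycle_type_sum (Suc n) (JM_product f (Suc n))"
  proof -
    have "of_nat (Suc n) * pconst (fps_const (inverse (fact (Suc n)))) = (pconst ?c :: 'a fps ppoly)"
    proof -
      have "(of_nat (Suc n) :: 'a fps ppoly) = pconst (fps_const (of_nat (Suc n)))"
        by (simp add: pconst_def fps_of_nat single_of_nat del: of_nat_Suc)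
      then have "of_nat (Suc n) * pconst (fps_const (inverse (fact (Suc n)))) = (pconst (fps_const (of_nat (Suc n) * inverse (fact (Suc n)))) :: 'a fps ppoly)"
        by (simp add: pconst_def mult_single del: of_nat_Suc)
      also have "of_nat (Suc n) * inverse (fact (Suc n)) = (inverse (fact n) :: 'a)"
        by (simp add: field_simps del: of_nat_Suc)
      finally show ?thesis .
    qed
    then show ?thesis by (simp only: \<Phi>_def content_series_nth mult.assoc[symmetric])
  qed
  also have "\<dots> = (\<Sum>k<M. pconst (fps_const (f $ k) * fps_X ^ k) * (\<Sum>a\<in>{1..N}. pvar a * (pconst ?c * (cut_join N ^^ k) ?v a)))
      + pconst (fps_X ^ M) * (pconst ?c * (\<Sum>a\<in>{1..N}. pvar a * marked_sum n (JM_product f n * fps_shift M (JM_series f n)) a))"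
    unfolding cycle_type_sum_Suc[OF N] V by (rule scaled_sum_swap)
  also have "(\<lambda>k a. pconst ?c * (cut_join N ^^ k) ?v a) = (\<lambda>k a. (cut_join N ^^ k) (\<lambda>a. if a = 1 then \<Phi> $ n else 0) a)"
  proof (intro ext)
    fix k a
    have *: "(\<lambda>a. pconst ?c * ?v a) = (\<lambda>a. if a = 1 then \<Phi> $ n else 0)" by (auto simp: \<Phi>_def content_series_nth)
    show "pconst ?c * (cut_join N ^^ k) ?v a = (cut_join N ^^ k) (\<lambda>a. if a = 1 then \<Phi> $ n else 0) a"
      using fun_cong[OF cut_join_pow_scale[of k N ?c ?v], of a] unfolding * by (rule sym)
  qed
  finally show ?thesis by blast
qed

section \<open>The logarithm of the content series\<close>

lemma zperp_nth [simp]: "zperp j F $ n = perp j (F $ n)"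
  by (simp add: zperp_def)

lemma var_exp_minus_add: "lookup m (i - 1) \<noteq> 0 \<Longrightarrow> m + k - var_exp i = (m - var_exp i) + k"
proof (rule poly_mapping_eqI)
  fix t assume "lookup m (i - 1) \<noteq> 0"
  then show "lookup (m + k - var_exp i) t = lookup (m - var_exp i + k) t"
    by (auto simp: var_exp_def lookup_add lookup_minus lookup_single when_def)
qed

lemma perp_single_mult:
  fixes a b :: "'r::comm_semiring_1"
  shows "perp i (single m a * single k b) =
    perp i (single m a) * single k b + single m a * perp i (single k b)"
proof -
  have 1: "single (m + k - var_exp i) (of_nat i * of_nat (lookup m (i - 1)) * (a * b)) =
      single (m - var_exp i + k) (of_nat i * of_nat (lookup m (i - 1)) * (a * b))"
    using var_exp_minus_add[of m i k] by (cases "lookup m (i - 1) = 0") simp_all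
  have 2: "single (m + k - var_exp i) (of_nat i * of_nat (lookup k (i - 1)) * (a * b)) =
      single (m + (k - var_exp i)) (of_nat i * of_nat (lookup k (i - 1)) * (a * b))"
    using var_exp_minus_add[of k i m] by (cases "lookup k (i - 1) = 0") (simp_all add: add.commute)
  show ?thesis
    using 1 2 by (simp add: mult_single perp_single lookup_add distrib_left distrib_right single_add mult_ac add_ac)
qed

lemma perp_mult: "perp i (P * Q) = perp i P * Q + P * perp i (Q :: 'r::comm_semiring_1 ppoly)"
proof -
  let ?s = "\<lambda>P m. single m (lookup P m) :: 'r ppoly"
  have "perp i ((\<Sum>m\<in>keys P. ?s P m) * (\<Sum>k\<in>keys Q. ?s Q k)) =
      perp i (\<Sum>m\<in>keys P. ?s P m) * (\<Sum>k\<in>keys Q. ?s Q k) +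
      (\<Sum>m\<in>keys P. ?s P m) * perp i (\<Sum>k\<in>keys Q. ?s Q k)"
    by (simp add: sum_product perp_sum perp_single_mult sum.distrib)
  then show ?thesis by (simp add: sum_single_keys)
qed

lemma zperp_mult: "zperp j (F * G) = zperp j F * G + F * zperp j (G :: 'r::comm_semiring_1 ppoly fps)"
  by (rule fps_ext) (simp add: fps_mult_nth perp_sum perp_mult sum.distrib)

lemma zperp_const_mult: "zperp j (fps_const (pconst c) * F) = fps_const (pconst c) * zperp j (F :: 'r::comm_semiring_1 ppoly fps)"
  by (rule fps_ext) (simp add: perp_const_mult)

lemma zperp_deriv: "zperp j (fps_deriv F) = fps_deriv (zperp j (F :: 'r::comm_ring_1 ppoly fps))"
proof (rule fps_ext)
  fix n
  have "(of_nat (Suc n) :: 'r ppoly) = pconst (of_nat (Suc n))"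
    by (simp add: pconst_def single_of_nat del: of_nat_Suc)
  then show "zperp j (fps_deriv F) $ n = fps_deriv (zperp j F) $ n"
    by (simp add: perp_const_mult del: of_nat_Suc)
qed

text \<open>
  This replaces the chain rule for the derivations \<open>p\<^sub>j\<^sup>\<bottom>\<close>: it suffices to differentiate both sides of the expected
  identity with respect to \<open>z\<close>.
\<close>

lemma fps_linear_ode_zero:
  fixes Q A :: "'r::{idom,semiring_char_0} fps"
  assumes "fps_deriv Q = A * Q" "Q $ 0 = 0"
  shows "Q = 0"
proof -
  have "Q $ n = 0" for n
  proof (induction n rule: less_induct)
    case (less n)
    show ?case
    proof (cases n)
      case (Suc k)
      have "of_nat (Suc k) * Q $ Suc k = (A * Q) $ k" using assms(1) by (metis fps_deriv_nth Suc_eq_plus1)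
      also have "\<dots> = 0" unfolding fps_mult_nth by (rule sum.neutral) (use less Suc in auto)
      finally show ?thesis using Suc by (simp del: of_nat_Suc)
    qed (use assms(2) in simp)
  qed
  then show ?thesis by (intro fps_ext) simp
qed

text \<open>
  The logarithm enters through its constant term and through the logarithmic derivatives \<open>F L' = F'\<close> in \<open>z\<close> and
  along \<open>p\<^sub>j\<^sup>\<bottom>\<close>.
\<close>

locale log_content =
  fixes F L :: "'a::field_char_0 fps ppoly fps"
  assumes F0: "F $ 0 = 1" and L_def: "L = log_series F"
begin

lemma L0: "L $ 0 = 0"
  by (simp add: L_def log_series_def pconst_def)

lemma F_deriv: "F * fps_deriv L = fps_deriv F"
proof -
  define A :: "'a fps ppoly fps" where "A = Abs_fps (\<lambda>k. pconst (fps_const (fps_ln 1 $ k)))"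
  have z: "(F - 1) $ 0 = 0" using F0 by simp
  have A1: "(1 + fps_X) * fps_deriv A = 1"
  proof (rule fps_ext)
    fix n
    have homogeneous: "pconst (fps_const a) + pconst (fps_const b) = (pconst (fps_const (a + b)) :: 'a fps ppoly)"
       "of_nat k * pconst (fps_const a) = (pconst (fps_const (of_nat k * a)) :: 'a fps ppoly)" for a b :: 'a and k
    proof -
      show "pconst (fps_const a) + pconst (fps_const b) = (pconst (fps_const (a + b)) :: 'a fps ppoly)"
        by (simp add: pconst_def flip: single_add)
      have "(of_nat k :: 'a fps ppoly) = pconst (fps_const (of_nat k))"
        by (simp add: pconst_def fps_of_nat single_of_nat)
      then show "of_nat k * pconst (fps_const a) = (pconst (fps_const (of_nat k * a)) :: 'a fps ppoly)"
        by (simp add: pconst_def mult_single)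
    qed
    have d: "fps_deriv A $ k = pconst (fps_const ((-1) ^ k))" for k
      by (simp add: A_def homogeneous fps_ln_nth del: of_nat_Suc)
    show "((1 + fps_X) * fps_deriv A) $ n = (1 :: 'a fps ppoly fps) $ n"
      by (cases n) (simp_all add: distrib_right d homogeneous pconst_def del: fps_deriv_nth flip: single_add)
  qed
  have "fps_deriv L = (fps_deriv A oo (F - 1)) * fps_deriv (F - 1)"
    unfolding L_def log_series_def A_def[symmetric] by (rule fps_compose_deriv[OF z])
  moreover have "F * (fps_deriv A oo (F - 1)) = 1"
  proof -
    have "((1 + fps_X) oo (F - 1)) = F" using z by (simp add: fps_compose_add_distrib fps_X_fps_compose_startby0)
    then have "F * (fps_deriv A oo (F - 1)) = ((1 + fps_X) * fps_deriv A) oo (F - 1)"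
      using fps_compose_mult_distrib[OF z, of "1 + fps_X" "fps_deriv A"] by simp
    then show ?thesis using A1 by simp
  qed
  ultimately show ?thesis by (metis (no_types, lifting) fps_deriv_sub fps_deriv_1 diff_zero mult.assoc mult_1)
qed

lemma F_perp: "F * zperp j L = zperp j F"
proof -
  \<comment> \<open>\<open>Q\<close> satisfies \<open>Q' = L' Q\<close> and vanishes at \<open>z = 0\<close>.\<close>
  define Q where "Q = F * zperp j L - zperp j F"
  have "fps_deriv Q = fps_deriv L * Q"
  proof -
    have "fps_deriv (zperp j F) = zperp j F * fps_deriv L + F * fps_deriv (zperp j L)"
      unfolding zperp_deriv[symmetric] F_deriv[symmetric] zperp_mult ..
    then have "fps_deriv Q = fps_deriv F * zperp j L - zperp j F * fps_deriv L"
      by (simp add: Q_def)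
    then show ?thesis unfolding F_deriv[symmetric] by (simp add: Q_def algebra_simps)
  qed
  moreover have "Q $ 0 = 0"
  proof -
    have "perp j (1 :: 'a fps ppoly) = 0" using perp_single[of j 0 "1 :: 'a fps"] by simp
    then show ?thesis by (simp add: Q_def fps_mult_nth L0 F0)
  qed
  ultimately have "Q = 0" by (rule fps_linear_ode_zero)
  then show ?thesis by (simp add: Q_def)
qed

end

subsection \<open>Marked cycles on the logarithmic level\<close>

text \<open>
  The operator acting on series in \<open>z\<close>, followed by its conjugate under multiplication by \<open>F\<close>, where \<open>L\<close> is the
  logarithm of \<open>F\<close>.
\<close>

definition cut_join_z :: "nat \<Rightarrow> (nat \<Rightarrow> 'r::comm_ring_1 ppoly fps) \<Rightarrow> nat \<Rightarrow> 'r ppoly fps"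
  where "cut_join_z M w a = (if a = 0 then 0 else (\<Sum>i\<in>{a<..a + M}. fps_const (pvar (i - a)) * w i) + (\<Sum>j\<in>{1..<a}. zperp j (w (a - j))))"

definition cut_join_log :: "nat \<Rightarrow> 'r::comm_ring_1 ppoly fps \<Rightarrow> (nat \<Rightarrow> 'r ppoly fps) \<Rightarrow> nat \<Rightarrow> 'r ppoly fps"
  where "cut_join_log M L w a = (if a = 0 then 0 else (\<Sum>i\<in>{a<..a + M}. fps_const (pvar (i - a)) * w i) +
    (\<Sum>j\<in>{1..<a}. zperp j (w (a - j)) + zperp j L * w (a - j)))"

text \<open>
  A new point starts as a marked cycle of length 1; at the end \<open>unmark\<close> turns the marked cycle of length \<open>a\<close>
  into a factor \<open>p\<^sub>a\<close>.
\<close>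

definition unit_state :: "'r::zero \<Rightarrow> nat \<Rightarrow> 'r"
  where "unit_state F a = (if a = 1 then F else 0)"

definition unmark :: "nat \<Rightarrow> (nat \<Rightarrow> 'r::comm_ring_1 ppoly fps) \<Rightarrow> 'r ppoly fps"
  where "unmark M w = (\<Sum>a\<in>{1..M}. fps_const (pvar a) * w a)"

lemma cut_join_z_nth: "cut_join_z M w a $ n = cut_join M (\<lambda>i. w i $ n) a"
  by (simp add: cut_join_z_def cut_join_def fps_sum_nth)

lemma cut_join_z_pow_nth: "(cut_join_z M ^^ k) w a $ n = (cut_join M ^^ k) (\<lambda>i. w i $ n) a"
  by (induction k arbitrary: a) (simp_all add: cut_join_z_nth)

context log_content
begin

lemma cut_join_z_F: "cut_join_z M (\<lambda>i. F * w i) a = F * cut_join_log M L w a"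
  by (simp add: cut_join_z_def cut_join_log_def zperp_mult F_perp[symmetric] distrib_left sum_distrib_left sum.distrib mult_ac add.commute)

lemma cut_join_z_pow_F: "(cut_join_z M ^^ k) (\<lambda>i. F * w i) = (\<lambda>a. F * (cut_join_log M L ^^ k) w a)"
  by (induction k) (auto simp: cut_join_z_F)

lemma unmark_F: "unmark M (\<lambda>a. F * w a) = F * unmark M w"
  by (simp add: unmark_def sum_distrib_left mult_ac)

end

text \<open>
  Only coefficients below \<open>M\<close> are controlled, so one cannot simply divide by \<open>F\<close>.
\<close>

lemma dvd_coeff_if_unit:
  fixes F D :: "'r::comm_ring_1 fps"
  assumes "F $ 0 = 1" "\<And>n. n < M \<Longrightarrow> y dvd (F * D) $ n"
  shows "n < M \<Longrightarrow> y dvd D $ n"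
proof (induction n rule: less_induct)
  case (less n)
  have "(F * D) $ n = D $ n + (\<Sum>i\<in>{1..n}. F $ i * D $ (n - i))"
    unfolding fps_mult_nth by (subst sum.atLeast_Suc_atMost) (simp_all add: assms(1))
  moreover have "y dvd (\<Sum>i\<in>{1..n}. F $ i * D $ (n - i))"
    by (intro dvd_sum dvd_mult less.IH) (use less.prems in auto)
  ultimately show ?case using assms(2)[OF less.prems] by (metis dvd_add_left_iff)
qed

lemma content_series_0: "content_series f $ 0 = 1"
proof -
  have "SymP 0 = {0}"
  proof -
    have "g = 0" if "g \<in> SymP 0" for g
      using that by (auto simp: fun_of_inject[symmetric] fun_eq_iff SymP_fix)
    then show ?thesis by auto
  qed
  moreover have "coeff_fps (1 :: (fperm \<Rightarrow>\<^sub>0 'a) fps) 0 = 1"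
    by (rule fps_ext) (simp add: fps_one_nth)
  moreover have "pexp (cycle_type 0 (fun_of 0)) = 0"
    unfolding cycle_type_id by (simp add: pexp_def)
  ultimately show ?thesis by (simp add: content_series_nth cycle_type_sum_def pconst_def del: fun_of_zero)
qed

abbreviation ymon :: "'a::field_char_0 \<Rightarrow> nat \<Rightarrow> 'a fps ppoly"
  where "ymon c k \<equiv> pconst (fps_const c * fps_X ^ k)"

text \<open>
  Both sides are multiplied by \<open>F\<close>, which turns the equation for \<open>L\<close> into the recurrence for \<open>F\<close>.
\<close>

theorem log_content_equation:
  fixes f :: "'a::field_char_0 fps"
  defines "L \<equiv> log_series (content_series f)"
  assumes n: "n < M"
  shows "pconst (fps_X ^ B) dvd
    (fps_deriv L - (\<Sum>k<B. fps_const (ymon (f $ k) k) * unmark M ((cut_join_log M L ^^ k) (unit_state 1)))) $ n"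
proof -
  interpret log_content "content_series f" L
    by unfold_locales (simp_all add: content_series_0 L_def)
  let ?F = "content_series f"
  let ?D = "fps_deriv L - (\<Sum>k<B. fps_const (ymon (f $ k) k) * unmark M ((cut_join_log M L ^^ k) (unit_state 1)))"
  have u: "unit_state ?F = (\<lambda>i. ?F * unit_state 1 i)" by (auto simp: unit_state_def)
  have FD: "?F * ?D = fps_deriv ?F - (\<Sum>k<B. fps_const (ymon (f $ k) k) * unmark M ((cut_join_z M ^^ k) (unit_state ?F)))"
    unfolding u cut_join_z_pow_F unmark_F by (simp add: right_diff_distrib F_deriv sum_distrib_left mult.left_commute)
  have "pconst (fps_X ^ B) dvd (?F * ?D) $ n" if n: "n < M" for n
  proof -
    obtain R where R: "of_nat (Suc n) * ?F $ Suc n =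
      (\<Sum>k<B. ymon (f $ k) k * (\<Sum>a\<in>{1..M}. pvar a * (cut_join M ^^ k) (\<lambda>a. if a = 1 then ?F $ n else 0) a)) + pconst (fps_X ^ B) * R"
      using content_series_recurrence[of n M f B] n by auto
    have us: "(\<lambda>i. unit_state ?F i $ n) = (\<lambda>a. if a = 1 then ?F $ n else 0)" by (auto simp: unit_state_def)
    have "(\<Sum>k<B. fps_const (ymon (f $ k) k) * unmark M ((cut_join_z M ^^ k) (unit_state ?F))) $ n =
      (\<Sum>k<B. ymon (f $ k) k * (\<Sum>a\<in>{1..M}. pvar a * (cut_join M ^^ k) (\<lambda>a. if a = 1 then ?F $ n else 0) a))"
      unfolding fps_sum_nth fps_mult_left_const_nth unmark_def cut_join_z_pow_nth us ..
    then have "(?F * ?D) $ n = pconst (fps_X ^ B) * R"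
      unfolding FD fps_sub_nth fps_deriv_nth Suc_eq_plus1[symmetric] R by simp
    then show ?thesis by simp
  qed
  then show ?thesis by (rule dvd_coeff_if_unit[OF content_series_0 _ n])
qed

subsection \<open>Homogeneity\<close>

text \<open>
  Homogeneous of degree \<open>n\<close> when \<open>p\<^sub>i\<close> has degree \<open>i\<close>.
\<close>

definition homogeneous :: "nat \<Rightarrow> 'r::zero ppoly \<Rightarrow> bool"
  where "homogeneous n P \<longleftrightarrow> keys P \<subseteq> {pexp \<alpha> |\<alpha>. 0 \<notin> set \<alpha> \<and> sum_list \<alpha> = n}"

lemma pexp_append: "pexp (\<alpha> @ \<beta>) = pexp \<alpha> + pexp \<beta>"
  by (simp add: pexp_def)

lemma homogeneous_mult: "homogeneous n P \<Longrightarrow> homogeneous m Q \<Longrightarrow> homogeneous (n + m) (P * Q :: 'r::comm_semiring_1 ppoly)"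
proof -
  assume *: "homogeneous n P" "homogeneous m Q"
  show ?thesis unfolding homogeneous_def
  proof
    fix k assume "k \<in> keys (P * Q)"
    then obtain a b where ab: "a \<in> keys P" "b \<in> keys Q" "k = a + b"
      using keys_mult[of P Q] by auto
    then obtain \<alpha> \<beta> where "a = pexp \<alpha>" "0 \<notin> set \<alpha>" "sum_list \<alpha> = n" "b = pexp \<beta>" "0 \<notin> set \<beta>" "sum_list \<beta> = m"
      using * unfolding homogeneous_def by blast
    then show "k \<in> {pexp \<alpha> |\<alpha>. 0 \<notin> set \<alpha> \<and> sum_list \<alpha> = n + m}"
      using ab(3) by (auto simp: pexp_append[symmetric] intro!: exI[of _ "\<alpha> @ \<beta>"])
  qed
qed

lemma homogeneous_zero [simp]: "homogeneous n 0"
  by (simp add: homogeneous_def)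

lemma homogeneous_add: "homogeneous n P \<Longrightarrow> homogeneous n Q \<Longrightarrow> homogeneous n (P + Q :: 'r::comm_monoid_add ppoly)"
  using keys_add[of P Q] unfolding homogeneous_def by blast

lemma homogeneous_sum: "(\<And>i. i \<in> A \<Longrightarrow> homogeneous n (h i)) \<Longrightarrow> homogeneous n (sum h A :: 'r::comm_monoid_add ppoly)"
  by (induction A rule: infinite_finite_induct) (auto intro: homogeneous_add)

lemma homogeneous_minus: "homogeneous n P \<Longrightarrow> homogeneous n Q \<Longrightarrow> homogeneous n (P - Q :: 'r::ab_group_add ppoly)"
  using keys_diff[of P Q] unfolding homogeneous_def by blast

lemma homogeneous_const: "homogeneous 0 (pconst c)"
  by (auto simp: homogeneous_def pconst_def pexp_def intro!: exI[of _ "[]"])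

lemma homogeneous_const_mult: "homogeneous n P \<Longrightarrow> homogeneous n (pconst c * P :: 'r::comm_semiring_1 ppoly)"
  using homogeneous_mult[OF homogeneous_const, of n P c] by simp

lemma lookup_of_nat_mult: "lookup (of_nat n * P) m = of_nat n * lookup (P :: 'r::comm_semiring_1 ppoly) m"
  by (induction n) (simp_all add: lookup_add distrib_right)

lemma homogeneous_of_nat_cancel:
  fixes P :: "'r::{idom,semiring_char_0} ppoly"
  assumes "homogeneous n (of_nat (Suc k) * P)"
  shows "homogeneous n P"
  using assms unfolding homogeneous_def by (auto simp: in_keys_iff lookup_of_nat_mult subset_iff simp del: of_nat_Suc)

lemma content_series_homogeneous: "homogeneous n (content_series f $ n)"
proof -
  have "homogeneous n (cycle_type_sum n (JM_product f n))"
    unfolding cycle_type_sum_def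
  proof (rule homogeneous_sum)
    fix g assume "g \<in> SymP n"
    then have "cycle_type n (fun_of g) \<in> partitions n" by (rule cycle_type_partition)
    then show "homogeneous n (single (pexp (cycle_type n (fun_of g))) (coeff_fps (JM_product f n) g))"
      by (auto simp: homogeneous_def partitions_def)
  qed
  then show ?thesis unfolding content_series_nth by (rule homogeneous_const_mult)
qed

lemma log_content_homogeneous: "homogeneous n (log_series (content_series f) $ n)"
proof -
  define F where "F = content_series f"
  define L where "L = log_series F"
  interpret log_content F L by unfold_locales (simp_all add: content_series_0 L_def F_def)
  have Fh: "homogeneous n (F $ n)" for n unfolding F_def by (rule content_series_homogeneous)
  have "homogeneous n (L $ n)" for n
  proof (induction n rule: less_induct)
    case (less n)
    show ?case
    proof (cases n)
      case (Suc k)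
      have "of_nat (Suc k) * F $ Suc k = (\<Sum>i=0..k. F $ i * (of_nat (Suc (k - i)) * L $ Suc (k - i)))"
        using arg_cong[OF F_deriv, of "\<lambda>h. h $ k"] by (simp add: fps_mult_nth del: of_nat_Suc)
      also have "\<dots> = of_nat (Suc k) * L $ Suc k + (\<Sum>i\<in>{1..k}. F $ i * (of_nat (Suc (k - i)) * L $ Suc (k - i)))"
        by (subst sum.atLeast_Suc_atMost) (simp_all add: F0)
      finally have "of_nat (Suc k) * L $ Suc k = of_nat (Suc k) * F $ Suc k - (\<Sum>i\<in>{1..k}. F $ i * (of_nat (Suc (k - i)) * L $ Suc (k - i)))"
        by simp
      moreover have "homogeneous n \<dots>"
      proof (intro homogeneous_minus homogeneous_sum)
        have of_nat_homogeneous: "homogeneous m (of_nat j * P)" if "homogeneous m P" for m j and P :: "'a fps ppoly"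
          using that unfolding homogeneous_def by (auto simp: in_keys_iff lookup_of_nat_mult subset_iff)
        show "homogeneous n (of_nat (Suc k) * F $ Suc k)" using Fh Suc by (intro of_nat_homogeneous) simp
        fix i assume i: "i \<in> {1..k}"
        then have "homogeneous (i + Suc (k - i)) (F $ i * (of_nat (Suc (k - i)) * L $ Suc (k - i)))"
          using Suc by (intro homogeneous_mult Fh of_nat_homogeneous less.IH) auto
        then show "homogeneous n (F $ i * (of_nat (Suc (k - i)) * L $ Suc (k - i)))" using i Suc by simp
      qed
      ultimately have "homogeneous n (of_nat (Suc k) * L $ n)" using Suc by (simp only:)
      then show ?thesis by (rule homogeneous_of_nat_cancel)
    qed (simp add: L0)
  qed
  then show ?thesis by (simp add: L_def F_def)
qed

section \<open>The genus zero part\<close>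

subsection \<open>Leading coefficients\<close>

definition tdeg :: "(nat \<Rightarrow>\<^sub>0 nat) \<Rightarrow> nat"
  where "tdeg m = (\<Sum>i\<in>keys m. lookup m i)"

lemma tdeg_superset: "finite A \<Longrightarrow> keys m \<subseteq> A \<Longrightarrow> tdeg m = (\<Sum>i\<in>A. lookup m i)"
  unfolding tdeg_def by (rule sum.mono_neutral_left) (auto simp: in_keys_iff)

lemma tdeg_add: "tdeg (m + k) = tdeg m + tdeg k"
proof -
  let ?A = "keys m \<union> keys k"
  have "finite ?A" by simp
  then show ?thesis
    using keys_add[of m k] tdeg_superset[of ?A "m + k"] tdeg_superset[of ?A m] tdeg_superset[of ?A k]
    by (simp add: lookup_add sum.distrib)
qed

lemma tdeg_zero [simp]: "tdeg 0 = 0"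
  by (simp add: tdeg_def)

lemma tdeg_var_exp [simp]: "tdeg (var_exp i) = 1"
  by (simp add: tdeg_def var_exp_def)

lemma pexp_Cons: "pexp (i # \<alpha>) = var_exp i + pexp \<alpha>"
  by (simp add: pexp_def var_exp_def)

lemma tdeg_pexp: "tdeg (pexp \<alpha>) = length \<alpha>"
  by (induction \<alpha>) (simp_all add: pexp_Cons tdeg_add, simp add: pexp_def)

lemma minus_var_exp_add: "lookup m (i - 1) \<noteq> 0 \<Longrightarrow> m - var_exp i + var_exp i = m"
proof (rule poly_mapping_eqI)
  fix t assume "lookup m (i - 1) \<noteq> 0"
  then show "lookup (m - var_exp i + var_exp i) t = lookup m t"
    by (auto simp: var_exp_def lookup_add lookup_minus lookup_single when_def)
qed

lemma tdeg_minus_var_exp: "lookup m (i - 1) \<noteq> 0 \<Longrightarrow> tdeg m = Suc (tdeg (m - var_exp i))"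
  using tdeg_add[of "m - var_exp i" "var_exp i"] minus_var_exp_add[of m i] by simp

text \<open>
  That is, \<open>f = c y\<^sup>a + O(y\<^sup>a\<^sup>+\<^sup>1)\<close>. Negative \<open>a\<close> must be allowed,
  because \<open>p\<^sub>i\<^sup>\<bottom>\<close> and multiplication by \<open>p\<^sub>i\<close> shift the bounds; then \<open>c = 0\<close>, so that leading coefficients multiply
  as expected.
\<close>

definition lead1 :: "int \<Rightarrow> 'a::field_char_0 fps \<Rightarrow> 'a \<Rightarrow> bool"
  where "lead1 a f c \<longleftrightarrow> (\<forall>e. int e \<le> a \<longrightarrow> f $ e = (if int e = a then c else 0)) \<and> (a < 0 \<longrightarrow> c = 0)"

lemma lead1_add: "lead1 a f c \<Longrightarrow> lead1 a g c' \<Longrightarrow> lead1 a (f + g) (c + c')"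
  by (simp add: lead1_def)

lemma lead1_zero [simp]: "lead1 a 0 0"
  by (simp add: lead1_def)

lemma lead1_weaken: "lead1 a f c \<Longrightarrow> b < a \<Longrightarrow> lead1 b f 0"
  by (auto simp: lead1_def)

lemma lead1_mult:
  assumes f: "lead1 a f c" and g: "lead1 b g c'"
  shows "lead1 (a + b) (f * g) (c * c')"
proof -
  have t: "f $ i * g $ (e - i) = (if int i = a \<and> int (e - i) = b then c * c' else 0)"
    if e: "int e \<le> a + b" and i: "i \<le> e" for i e
  proof -
    consider "int i < a" | "int i = a" | "int i > a" by linarith
    then show ?thesis
    proof cases
      case 1
      then show ?thesis using f by (simp add: lead1_def)
    next
      case 2
      then have "int (e - i) \<le> b" using e i by (simp add: of_nat_diff)
      then show ?thesis using f g 2 by (simp add: lead1_def)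
    next
      case 3
      then have "int (e - i) < b" using e i by (simp add: of_nat_diff)
      then show ?thesis using g 3 by (simp add: lead1_def)
    qed
  qed
  have "(f * g) $ e = (if int e = a + b then c * c' else 0)" if e: "int e \<le> a + b" for e
  proof -
    have s: "(f * g) $ e = (\<Sum>i=0..e. if int i = a \<and> int (e - i) = b then c * c' else 0)"
      unfolding fps_mult_nth by (intro sum.cong refl t e) simp
    show ?thesis
    proof (cases "int e = a + b \<and> 0 \<le> a \<and> 0 \<le> b")
      case True
      have "(f * g) $ e = (\<Sum>i=0..e. if i = nat a then c * c' else 0)"
        unfolding s
      proof (rule sum.cong[OF refl])
        fix i assume "i \<in> {0..e}"
        then have "int i = a \<and> int (e - i) = b \<longleftrightarrow> i = nat a" using True by (auto simp: of_nat_diff)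
        then show "(if int i = a \<and> int (e - i) = b then c * c' else 0) = (if i = nat a then c * c' else 0)" by simp
      qed
      also have "\<dots> = c * c'" using True by (subst sum.delta) auto
      finally show ?thesis using True by simp
    next
      case False
      have z: "c * c' = 0" if "a < 0 \<or> b < 0" using f g that by (auto simp: lead1_def)
      have "(f * g) $ e = 0"
        unfolding s
      proof (intro sum.neutral ballI)
        fix i assume "i \<in> {0..e}"
        then have "\<not> (int i = a \<and> int (e - i) = b)" using False by (auto simp: of_nat_diff)
        then show "(if int i = a \<and> int (e - i) = b then c * c' else 0) = 0" by (rule if_not_P)
      qed
      then show ?thesis using False z by auto
    qed
  qed
  moreover have "c * c' = 0" if "a + b < 0" using f g that by (auto simp: lead1_def)
  ultimately show ?thesis by (simp add: lead1_def)
qed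

lemma lead1_const: "lead1 0 (fps_const c) c"
  by (simp add: lead1_def)

lemma lead1_const_mult: "lead1 a f c \<Longrightarrow> lead1 a (fps_const d * f) (d * c)"
  using lead1_mult[OF lead1_const, of a f c d] by simp

text \<open>
  In \<open>LeadP\<close> and \<open>LeadF\<close> the bound on the exponent of \<open>y\<close> is \<open>d\<close> plus the number of variables in the monomial,
  plus the exponent of \<open>z\<close> for a series. With \<open>d = -2\<close> this is the exponent of the genus zero part.
\<close>

definition LeadP :: "int \<Rightarrow> 'a::field_char_0 fps ppoly \<Rightarrow> 'a ppoly \<Rightarrow> bool"
  where "LeadP d P Q \<longleftrightarrow> (\<forall>m. lead1 (int (tdeg m) + d) (lookup P m) (lookup Q m))"

lemma LeadP_add: "LeadP d P Q \<Longrightarrow> LeadP d P' Q' \<Longrightarrow> LeadP d (P + P') (Q + Q')"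
  by (simp add: LeadP_def lookup_add lead1_add)

lemma LeadP_zero [simp]: "LeadP d 0 0"
  by (simp add: LeadP_def)

lemma LeadP_sum: "(\<And>i. i \<in> A \<Longrightarrow> LeadP d (P i) (Q i)) \<Longrightarrow> LeadP d (sum P A) (sum Q A)"
  by (induction A rule: infinite_finite_induct) (auto intro: LeadP_add)

lemma LeadP_single: "lead1 (int (tdeg m) + d) a b \<Longrightarrow> LeadP d (single m a) (single m b)"
  by (auto simp: LeadP_def lookup_single when_def)

lemma LeadP_weaken: "LeadP d P Q \<Longrightarrow> d' < d \<Longrightarrow> LeadP d' P 0"
  unfolding LeadP_def by (intro allI) (simp, rule lead1_weaken, auto)

lemma LeadP_expand:
  fixes P :: "'a::field_char_0 fps ppoly" and Q :: "'a ppoly"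
  obtains A where "finite A" "P = (\<Sum>m\<in>A. single m (lookup P m))"
    "Q = (\<Sum>m\<in>A. single m (lookup Q m))"
  by (rule that[of "keys P \<union> keys Q"]) (simp_all add: sum_single_superset)

lemma LeadP_mult:
  assumes P: "LeadP d P Q" and P': "LeadP d' P' Q'"
  shows "LeadP (d + d') (P * P') (Q * Q')"
proof -
  let ?s = "\<lambda>P m. single m (lookup P m)"
  obtain A where A: "P = (\<Sum>m\<in>A. ?s P m)" "Q = (\<Sum>m\<in>A. single m (lookup Q m))"
    using LeadP_expand by metis
  obtain B where B: "P' = (\<Sum>m\<in>B. ?s P' m)" "Q' = (\<Sum>m\<in>B. single m (lookup Q' m))"
    using LeadP_expand by metis
  have "LeadP (d + d') (\<Sum>m\<in>A. \<Sum>k\<in>B. single (m + k) (lookup P m * lookup P' k))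
    (\<Sum>m\<in>A. \<Sum>k\<in>B. single (m + k) (lookup Q m * lookup Q' k))"
  proof (intro LeadP_sum LeadP_single)
    fix m k
    have "lead1 (int (tdeg m) + d + (int (tdeg k) + d')) (lookup P m * lookup P' k) (lookup Q m * lookup Q' k)"
      using P P' by (intro lead1_mult) (simp_all add: LeadP_def)
    then show "lead1 (int (tdeg (m + k)) + (d + d')) (lookup P m * lookup P' k) (lookup Q m * lookup Q' k)"
      by (simp add: tdeg_add algebra_simps)
  qed
  moreover have "P * P' = (\<Sum>m\<in>A. \<Sum>k\<in>B. single (m + k) (lookup P m * lookup P' k))"
    by (subst A(1), subst B(1)) (simp add: sum_product mult_single)
  moreover have "Q * Q' = (\<Sum>m\<in>A. \<Sum>k\<in>B. single (m + k) (lookup Q m * lookup Q' k))"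
    by (subst A(2), subst B(2)) (simp add: sum_product mult_single)
  ultimately show ?thesis by simp
qed

lemma LeadP_perp:
  assumes P: "LeadP d P Q"
  shows "LeadP (d + 1) (perp i P) (perp i Q)"
proof -
  obtain A where A: "P = (\<Sum>m\<in>A. single m (lookup P m))" "Q = (\<Sum>m\<in>A. single m (lookup Q m))"
    using LeadP_expand by metis
  have "LeadP (d + 1) (\<Sum>m\<in>A. perp i (single m (lookup P m))) (\<Sum>m\<in>A. perp i (single m (lookup Q m)))"
  proof (intro LeadP_sum)
    fix m
    show "LeadP (d + 1) (perp i (single m (lookup P m))) (perp i (single m (lookup Q m)))"
    proof (cases "lookup m (i - 1) = 0")
      case False
      have *: "lead1 (int (tdeg m) + d) (lookup P m) (lookup Q m)" using P by (simp add: LeadP_def)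
      have t: "int (tdeg (m - var_exp i)) + (d + 1) = int (tdeg m) + d" using tdeg_minus_var_exp[OF False] by simp
      have "(of_nat i * of_nat (lookup m (i - 1)) :: 'a fps) = fps_const (of_nat i * of_nat (lookup m (i - 1)))"
        by (simp only: fps_of_nat[symmetric] fps_const_mult)
      then show ?thesis unfolding perp_single
        by (intro LeadP_single) (simp only: t, rule lead1_const_mult[OF *])
    qed (simp add: perp_single)
  qed
  moreover have "perp i P = (\<Sum>m\<in>A. perp i (single m (lookup P m)))"
    by (subst A(1)) (rule perp_sum)
  moreover have "perp i Q = (\<Sum>m\<in>A. perp i (single m (lookup Q m)))"
    by (subst A(2)) (rule perp_sum)
  ultimately show ?thesis by simp
qed

text \<open>
  Only the first coefficients are described, because the bound for \<open>log \<Phi>\<close> is proved by induction on the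
  exponent of \<open>z\<close>.
\<close>

definition LeadF :: "nat \<Rightarrow> int \<Rightarrow> 'a::field_char_0 fps ppoly fps \<Rightarrow> 'a ppoly fps \<Rightarrow> bool"
  where "LeadF N d F G \<longleftrightarrow> (\<forall>n\<le>N. LeadP (int n + d) (F $ n) (G $ n))"

lemma LeadF_add: "LeadF N d F G \<Longrightarrow> LeadF N d F' G' \<Longrightarrow> LeadF N d (F + F') (G + G')"
  by (simp add: LeadF_def LeadP_add)

lemma LeadF_zero [simp]: "LeadF N d 0 0"
  by (simp add: LeadF_def)

lemma LeadF_sum: "(\<And>i. i \<in> A \<Longrightarrow> LeadF N d (P i) (Q i)) \<Longrightarrow> LeadF N d (sum P A) (sum Q A)"
  by (induction A rule: infinite_finite_induct) (auto intro: LeadF_add)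

lemma LeadF_weaken: "LeadF N d P Q \<Longrightarrow> d' < d \<Longrightarrow> LeadF N d' P 0"
  unfolding LeadF_def using LeadP_weaken by fastforce

lemma LeadF_mult:
  assumes "LeadF N d F G" "LeadF N d' F' G'"
  shows "LeadF N (d + d') (F * F') (G * G')"
  unfolding LeadF_def fps_mult_nth
proof (intro allI impI LeadP_sum)
  fix n i assume n: "n \<le> N" and i: "i \<in> {0..n}"
  have "LeadP ((int i + d) + (int (n - i) + d')) (F $ i * F' $ (n - i)) (G $ i * G' $ (n - i))"
  proof (rule LeadP_mult)
    show "LeadP (int i + d) (F $ i) (G $ i)" using assms(1) n i unfolding LeadF_def by auto
    show "LeadP (int (n - i) + d') (F' $ (n - i)) (G' $ (n - i))"
      using assms(2) n unfolding LeadF_def by (meson diff_le_self le_trans)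
  qed
  then show "LeadP (int n + (d + d')) (F $ i * F' $ (n - i)) (G $ i * G' $ (n - i))"
    using i by (simp add: of_nat_diff algebra_simps)
qed

lemma LeadF_zperp: "LeadF N d F G \<Longrightarrow> LeadF N (d + 1) (zperp i F) (zperp i G)"
  unfolding LeadF_def using LeadP_perp by (fastforce simp: algebra_simps)

lemma LeadF_fps_const: "LeadP d P Q \<Longrightarrow> LeadF N d (fps_const P) (fps_const Q)"
  by (simp add: LeadF_def fps_const_def)

lemma LeadP_pvar: "LeadP (- 1) (pvar i) (pvar i)"
  unfolding pvar_def var_exp_def[symmetric] by (rule LeadP_single) (simp add: lead1_const[of 1, simplified])

lemma LeadP_ymon: "LeadP (int k) (ymon c k) (pconst c)"
  unfolding pconst_def by (rule LeadP_single) (auto simp: lead1_def fps_X_power_mult_right_nth)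

subsection \<open>Leading coefficients of the equation\<close>

text \<open>
  The part of \<open>cut_join_log\<close> that survives in lowest order.
\<close>

definition cut_join_lead :: "nat \<Rightarrow> 'r::comm_ring_1 ppoly fps \<Rightarrow> (nat \<Rightarrow> 'r ppoly fps) \<Rightarrow> nat \<Rightarrow> 'r ppoly fps"
  where "cut_join_lead M G w a = (if a = 0 then 0 else (\<Sum>i\<in>{a<..a + M}. fps_const (pvar (i - a)) * w i) +
    (\<Sum>j\<in>{1..<a}. zperp j G * w (a - j)))"

text \<open>
  Here \<open>zperp j L\<close> has \<open>d = -1\<close>, as has multiplication by a variable, whereas \<open>zperp j\<close> applied to a state
  only raises \<open>d\<close>. The factor \<open>y\<close> compensates the \<open>-1\<close>.
\<close>

lemma LeadF_cut_join_log:
  assumes L: "LeadF N (- 2) L G" and w: "\<And>a. LeadF N 0 (w a) (w' a)"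
  shows "LeadF N 0 (fps_const (ymon 1 1) * cut_join_log M L w a) (cut_join_lead M G w' a)"
proof (cases "a = 0")
  case False
  have Y: "LeadF N 1 (fps_const (ymon (1::'a) 1)) (fps_const (pconst 1))" using LeadF_fps_const[OF LeadP_ymon[of 1 1]] by simp
  have "LeadF N (- 1) (\<Sum>i\<in>{a<..a + M}. fps_const (pvar (i - a)) * w i) (\<Sum>i\<in>{a<..a + M}. fps_const (pvar (i - a)) * w' i)"
    by (rule LeadF_sum) (use LeadF_mult[OF LeadF_fps_const[OF LeadP_pvar] w] in simp)
  moreover have "LeadF N (- 1) (\<Sum>j\<in>{1..<a}. zperp j (w (a - j)) + zperp j L * w (a - j)) (\<Sum>j\<in>{1..<a}. 0 + zperp j G * w' (a - j))"
  proof (intro LeadF_sum LeadF_add)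
    fix j
    show "LeadF N (- 1) (zperp j (w (a - j))) 0" by (rule LeadF_weaken[OF LeadF_zperp[OF w]]) simp
    show "LeadF N (- 1) (zperp j L * w (a - j)) (zperp j G * w' (a - j))"
      using LeadF_mult[OF LeadF_zperp[OF L] w] by simp
  qed
  ultimately have "LeadF N (- 1) (cut_join_log M L w a) (cut_join_lead M G w' a)"
    unfolding cut_join_log_def cut_join_lead_def using False LeadF_add by fastforce
  from LeadF_mult[OF Y this] show ?thesis by (simp add: pconst_def)
qed (simp add: cut_join_log_def cut_join_lead_def)

lemma cut_join_log_scale: "cut_join_log M L (\<lambda>a. fps_const (pconst c) * w a) a = fps_const (pconst c) * cut_join_log M L w a"
  by (simp add: cut_join_log_def zperp_const_mult distrib_left sum_distrib_left mult_ac)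

lemma ymon_mult: "fps_const (ymon c k) * fps_const (ymon d l) = fps_const (ymon (c * d :: 'a::field_char_0) (k + l))"
proof -
  have "fps_const c * fps_X ^ k * (fps_const d * fps_X ^ l) = fps_const (c * d) * fps_X ^ (k + l)"
    by (simp add: power_add mult_ac fps_const_mult[symmetric] del: fps_const_mult)
  then show ?thesis by (simp only: pconst_def mult_single fps_const_mult add_0_left)
qed

lemma LeadF_cut_join_log_pow:
  assumes L: "LeadF N (- 2) L G"
  shows "LeadF N 0 (fps_const (ymon 1 k) * (cut_join_log M L ^^ k) (unit_state 1) a) ((cut_join_lead M G ^^ k) (unit_state 1) a)"
proof (induction k arbitrary: a)
  case 0
  have "LeadP 0 (1 :: 'a fps ppoly) 1" using LeadP_single[of 0 0 "1 :: 'a fps" 1] lead1_const[of "1 :: 'a"] by simp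
  then have "LeadF N 0 (1 :: 'a fps ppoly fps) 1" using LeadF_fps_const[of 0 1 1 N] by simp
  then show ?case by (simp add: unit_state_def pconst_def)
next
  case (Suc k)
  have "fps_const (ymon 1 (Suc k)) * (cut_join_log M L ^^ Suc k) (unit_state 1) a =
      fps_const (ymon 1 1) * cut_join_log M L (\<lambda>a. fps_const (ymon 1 k) * (cut_join_log M L ^^ k) (unit_state 1) a) a"
    unfolding cut_join_log_scale mult.assoc[symmetric] ymon_mult by simp
  then show ?case using LeadF_cut_join_log[OF L Suc] by simp
qed

lemma LeadF_sum_unmark:
  assumes L: "LeadF N (- 2) L G"
  shows "LeadF N (- 1) (\<Sum>k<B. fps_const (ymon (f $ k) k) * unmark M ((cut_join_log M L ^^ k) (unit_state 1)))
    (\<Sum>k<B. fps_const (pconst (f $ k)) * unmark M ((cut_join_lead M G ^^ k) (unit_state 1)))"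
proof (rule LeadF_sum)
  fix k
  have "LeadF N (- 1) (\<Sum>a\<in>{1..M}. fps_const (pvar a) * (fps_const (ymon 1 k) * (cut_join_log M L ^^ k) (unit_state 1) a)) (unmark M ((cut_join_lead M G ^^ k) (unit_state 1)))"
    unfolding unmark_def by (rule LeadF_sum) (use LeadF_mult[OF LeadF_fps_const[OF LeadP_pvar] LeadF_cut_join_log_pow[OF L]] in simp)
  from LeadF_mult[OF LeadF_fps_const[OF LeadP_ymon[of 0 "f $ k"]] this]
  have *: "LeadF N (- 1) (fps_const (ymon (f $ k) 0) * (\<Sum>a\<in>{1..M}. fps_const (pvar a) * (fps_const (ymon 1 k) * (cut_join_log M L ^^ k) (unit_state 1) a)))
      (fps_const (pconst (f $ k)) * unmark M ((cut_join_lead M G ^^ k) (unit_state 1)))"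
    by simp
  have ymon: "fps_const (ymon (f $ k) k) = fps_const (ymon (f $ k) 0) * fps_const (ymon 1 k)" unfolding ymon_mult by simp
  have "fps_const (ymon (f $ k) k) * unmark M ((cut_join_log M L ^^ k) (unit_state 1)) =
      fps_const (ymon (f $ k) 0) * (\<Sum>a\<in>{1..M}. fps_const (pvar a) * (fps_const (ymon 1 k) * (cut_join_log M L ^^ k) (unit_state 1) a))"
    unfolding ymon unmark_def sum_distrib_left by (simp only: mult_ac)
  with * show "LeadF N (- 1) (fps_const (ymon (f $ k) k) * unmark M ((cut_join_log M L ^^ k) (unit_state 1))) (fps_const (pconst (f $ k)) * unmark M ((cut_join_lead M G ^^ k) (unit_state 1)))"
    by (simp only:)
qed

subsection \<open>The coefficients of the genus zero series\<close>

lemma lookup_pexp: "0 \<notin> set \<alpha> \<Longrightarrow> lookup (pexp \<alpha>) i = count (mset \<alpha>) (Suc i)"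
proof (induction \<alpha>)
  case (Cons a \<alpha>)
  then have "a - 1 = i \<longleftrightarrow> a = Suc i" by auto
  then show ?case using Cons by (auto simp: pexp_Cons lookup_add var_exp_def lookup_single when_def)
qed (simp add: pexp_def)

lemma inj_on_pexp: "inj_on pexp (partitions n)"
proof (rule inj_onI)
  fix \<alpha> \<beta> assume a: "\<alpha> \<in> partitions n" and b: "\<beta> \<in> partitions n" and e: "pexp \<alpha> = pexp \<beta>"
  have "mset \<alpha> = mset \<beta>"
  proof (rule multiset_eqI)
    fix i
    have "count (mset \<alpha>) 0 = 0" "count (mset \<beta>) 0 = 0" using a b by (auto simp: partitions_def count_eq_zero_iff)
    moreover have "count (mset \<alpha>) (Suc j) = count (mset \<beta>) (Suc j)" for j
      using lookup_pexp[of \<alpha> j] lookup_pexp[of \<beta> j] a b e by (simp add: partitions_def)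
    ultimately show "count (mset \<alpha>) i = count (mset \<beta>) i" by (metis not0_implies_Suc)
  qed
  moreover have "rev \<alpha> = sort \<alpha>" if "\<alpha> \<in> partitions n" for \<alpha>
    using that by (intro properties_for_sort[symmetric]) (simp_all add: partitions_def sorted_wrt_rev)
  ultimately show "\<alpha> = \<beta>" using a b by (metis mset_sort rev_rev_ident sorted_list_of_multiset_mset)
qed

lemma homogeneous_keys: "homogeneous n P \<Longrightarrow> keys P \<subseteq> pexp ` partitions n"
proof
  fix m assume "homogeneous n P" "m \<in> keys P"
  then obtain \<alpha> where \<alpha>: "m = pexp \<alpha>" "0 \<notin> set \<alpha>" "sum_list \<alpha> = n" unfolding homogeneous_def by blast
  let ?\<beta> = "rev (sort \<alpha>)"
  have m: "mset ?\<beta> = mset \<alpha>" by simp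
  have s: "sum_list ?\<beta> = n" using \<alpha>(3) by (metis m sum_mset_sum_list)
  have "?\<beta> \<in> partitions n" using \<alpha>(2) s by (simp add: partitions_def sorted_wrt_rev)
  moreover have "pexp ?\<beta> = m"
    by (rule poly_mapping_eqI) (use \<alpha> lookup_pexp[of \<alpha>] lookup_pexp[of ?\<beta>] in simp)
  ultimately show "m \<in> pexp ` partitions n" by blast
qed

lemma fps_eval_monom: "fps_eval (fps_const c * fps_X ^ e) 1 = c"
proof -
  have n: "(fps_const c * fps_X ^ e) $ d = (if d = e then c else 0)" for d
    by (auto simp: fps_X_power_mult_right_nth)
  show ?thesis unfolding fps_eval_def n by (cases "c = 0") simp_all
qed

text \<open>
  The genus zero series collects the coefficients of \<open>log \<Phi>\<close> at the lowest possible exponents of \<open>y\<close>. By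
  homogeneity, all monomials of \<open>log \<Phi>\<close> are of the form that the definition runs over.
\<close>

lemma lookup_Psi0_hat:
  fixes f :: "'a::field_char_0 fps"
  defines "L \<equiv> log_series (content_series f)"
  shows "lookup (Psi0_hat f $ n) m =
    (if int n + int (tdeg m) - 2 < 0 then 0 else lookup (L $ n) m $ nat (int n + int (tdeg m) - 2))"
proof -
  have ev0: "fps_eval 0 1 = (0 :: 'a)" by (simp add: fps_eval_def)
  have ev: "lookup (Psi0_hat f $ n) m = fps_eval (lookup (Psi 0 f $ n) m) 1"
    by (simp add: Psi0_hat_def Poly_Mapping.map.rep_eq when_def ev0)
  have h: "homogeneous n (L $ n)" unfolding L_def by (rule log_content_homogeneous)
  show ?thesis
  proof (cases "n = 0")
    case True
    have "L $ 0 = 0" by (simp add: L_def log_series_def pconst_def)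
    moreover have "Psi 0 f $ n = 0" using True by (simp add: Psi_def)
    ultimately show ?thesis unfolding ev using True by (simp add: ev0)
  next
    case False
    let ?c = "\<lambda>\<beta>. fps_const (lookup (L $ n) (pexp \<beta>) $ (n + length \<beta> - 2)) * fps_X ^ (n + length \<beta> - 2)"
    have P: "Psi 0 f $ n = (\<Sum>\<beta>\<in>partitions n. single (pexp \<beta>) (?c \<beta>))"
      using False by (simp add: Psi_def pconst_pprod pcoeff_def L_def Let_def)
    show ?thesis
    proof (cases "m \<in> pexp ` partitions n")
      case True
      then obtain \<beta> where \<beta>: "\<beta> \<in> partitions n" "m = pexp \<beta>" by blast
      have "lookup (Psi 0 f $ n) m = (\<Sum>\<gamma>\<in>partitions n. if \<gamma> = \<beta> then ?c \<beta> else 0)"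
        unfolding P lookup_sum \<beta>(2)
        by (intro sum.cong refl) (use inj_onD[OF inj_on_pexp _ _ \<beta>(1)] in \<open>auto simp: lookup_single when_def\<close>)
      also have "\<dots> = ?c \<beta>" using \<beta>(1) by simp
      finally have v: "lookup (Psi0_hat f $ n) m = lookup (L $ n) m $ (n + length \<beta> - 2)"
        unfolding ev by (simp only: fps_eval_monom \<beta>(2))
      have "\<beta> \<noteq> []" using \<beta>(1) False by (auto simp: partitions_def)
      then have "length \<beta> \<ge> 1" by (cases \<beta>) auto
      then have "\<not> int n + int (tdeg m) - 2 < 0" "nat (int n + int (tdeg m) - 2) = n + length \<beta> - 2"
        using False by (simp_all add: \<beta>(2) tdeg_pexp nat_diff_distrib nat_int_add)
      then show ?thesis using v by simp
    next
      case no: False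
      then have "lookup (L $ n) m = 0" using homogeneous_keys[OF h] by (auto simp: in_keys_iff)
      moreover have "lookup (Psi 0 f $ n) m = 0"
        unfolding P lookup_sum by (rule sum.neutral) (use no in \<open>auto simp: lookup_single when_def\<close>)
      ultimately show ?thesis by (simp add: ev ev0)
    qed
  qed
qed

lemma Psi0_hat_homogeneous: "homogeneous n (Psi0_hat f $ n)"
proof -
  have "keys (Psi0_hat f $ n) \<subseteq> keys (log_series (content_series f) $ n)"
  proof
    fix m assume "m \<in> keys (Psi0_hat f $ n)"
    then have "lookup (Psi0_hat f $ n) m \<noteq> 0" by (simp add: in_keys_iff)
    then have "lookup (log_series (content_series f) $ n) m \<noteq> 0"
      unfolding lookup_Psi0_hat by (metis fps_zero_nth)
    then show "m \<in> keys (log_series (content_series f) $ n)" by (simp add: in_keys_iff)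
  qed
  then show ?thesis using log_content_homogeneous[of n f] unfolding homogeneous_def by blast
qed

lemma lookup_dvd_X_power:
  assumes "pconst (fps_X ^ B) dvd P" "e < B"
  shows "lookup P m $ e = 0"
proof -
  obtain R where "P = pconst (fps_X ^ B) * R" using assms(1) by (elim dvdE)
  moreover have "lookup (pconst c * R) m = c * lookup R m" for c
  proof -
    have "pconst c * R = Poly_Mapping.map ((*) c) R" by (simp add: pconst_def mult_map_scale_conv_mult)
    then show ?thesis by (simp add: Poly_Mapping.map.rep_eq when_def)
  qed
  ultimately show ?thesis using assms(2) by (simp add: fps_X_power_mult_nth)
qed

text \<open>
  The bound for the coefficient of \<open>z\<^sup>n\<^sup>+\<^sup>1\<close> follows from the bounds up to \<open>z\<^sup>n\<close> by the equation for \<open>log \<Phi>\<close>,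
  and comparing the coefficients of lowest order gives the equation for the genus zero series. The
  equation for \<open>log \<Phi>\<close> holds modulo \<open>y\<^sup>B\<close> only, so \<open>B\<close> has to exceed the exponent in question.
\<close>

theorem genus_zero_leading:
  fixes f :: "'a::field_char_0 fps"
  defines "L \<equiv> log_series (content_series f)" and "G \<equiv> Psi0_hat f"
  shows "LeadF N (- 2) L G"
    and "n < M \<Longrightarrow> \<exists>B0. \<forall>B\<ge>B0. of_nat (Suc n) * lookup (G $ Suc n) m =
      lookup ((\<Sum>k<B. fps_const (pconst (f $ k)) * unmark M ((cut_join_lead M G ^^ k) (unit_state 1))) $ n) m"
proof -
  let ?T = "\<lambda>B M. \<Sum>k<B. fps_const (ymon (f $ k) k) * unmark M ((cut_join_log M L ^^ k) (unit_state 1))"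
  let ?S = "\<lambda>B M. \<Sum>k<B. fps_const (pconst (f $ k)) * unmark M ((cut_join_lead M G ^^ k) (unit_state 1))"
  have step: "lead1 (int (tdeg m) + (int (Suc n) - 2)) (fps_const (of_nat (Suc n)) * lookup (L $ Suc n) m) (lookup (?S B M $ n) m)"
    if lead: "LeadF n (- 2) L G" and M: "n < M" and B: "int (tdeg m) + (int (Suc n) - 2) < int B" for n m M B
  proof -
    have 1: "pconst (fps_X ^ B) dvd (fps_deriv L - ?T B M) $ n" unfolding L_def by (rule log_content_equation[OF M])
    have 2: "lead1 (int (tdeg m) + (int (Suc n) - 2)) (lookup (?T B M $ n) m) (lookup (?S B M $ n) m)"
      using LeadF_sum_unmark[OF lead, where f = f and B = B and M = M]
      by (simp add: LeadF_def LeadP_def algebra_simps)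
    have 3: "fps_const (of_nat (Suc n)) * lookup (L $ Suc n) m = lookup (fps_deriv L $ n) m"
      unfolding fps_deriv_nth Suc_eq_plus1[symmetric] lookup_of_nat_mult fps_of_nat ..
    have "lookup (fps_deriv L $ n) m $ e = lookup (?T B M $ n) m $ e" if "int e \<le> int (tdeg m) + (int (Suc n) - 2)" for e
      using lookup_dvd_X_power[OF 1, of e m] that B unfolding fps_sub_nth lookup_minus by (simp add: lookup_minus)
    then show ?thesis using 2 unfolding 3 lead1_def by auto
  qed
  show LF: "LeadF N (- 2) L G" for N
  proof (induction N)
    case 0
    have "L $ 0 = 0" by (simp add: L_def log_series_def pconst_def)
    moreover have "G $ 0 = 0"
      by (rule poly_mapping_eqI) (simp add: G_def lookup_Psi0_hat L_def[symmetric] \<open>L $ 0 = 0\<close>)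
    ultimately show ?case by (simp add: LeadF_def)
  next
    case (Suc N)
    have "LeadP (int (Suc N) + - 2) (L $ Suc N) (G $ Suc N)"
      unfolding LeadP_def
    proof
      fix m
      define a where "a = int (tdeg m) + (int (Suc N) + - 2)"
      define B where "B = Suc (nat a)"
      have "lead1 (int (tdeg m) + (int (Suc N) - 2)) (fps_const (of_nat (Suc N)) * lookup (L $ Suc N) m)
          (lookup (?S B (Suc N) $ N) m)"
        by (rule step[OF Suc]) (simp_all add: B_def a_def)
      then obtain v where "lead1 a (fps_const (of_nat (Suc N)) * lookup (L $ Suc N) m) v"
        unfolding a_def diff_conv_add_uminus by blast
      then have "of_nat (Suc N) * lookup (L $ Suc N) m $ e = 0" if "int e < a" for e
        using that by (auto simp: lead1_def simp del: of_nat_Suc)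
      then have "lookup (L $ Suc N) m $ e = 0" if "int e < a" for e
        using that by (metis mult_eq_0_iff of_nat_eq_0_iff nat.distinct(1))
      moreover have "lookup (G $ Suc N) m = (if a < 0 then 0 else lookup (L $ Suc N) m $ nat a)"
      proof -
        have "int (Suc N) + int (tdeg m) - 2 = a" by (simp add: a_def)
        then show ?thesis unfolding G_def lookup_Psi0_hat L_def by simp
      qed
      ultimately have "lead1 a (lookup (L $ Suc N) m) (lookup (G $ Suc N) m)"
        by (auto simp: lead1_def)
      then show "lead1 (int (tdeg m) + (int (Suc N) + - 2)) (lookup (L $ Suc N) m) (lookup (G $ Suc N) m)"
        by (simp only: a_def)
    qed
    then show ?case using Suc by (auto simp: LeadF_def le_Suc_eq)
  qed
  show "\<exists>B0. \<forall>B\<ge>B0. of_nat (Suc n) * lookup (G $ Suc n) m = lookup (?S B M $ n) m" if M: "n < M"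
  proof (intro exI allI impI)
    fix B assume B: "n + tdeg m \<le> B"
    let ?a = "int (tdeg m) + (int (Suc n) - 2)"
    have 1: "lead1 ?a (fps_const (of_nat (Suc n)) * lookup (L $ Suc n) m) (lookup (?S B M $ n) m)"
      by (rule step[OF LF M]) (use B in simp)
    have "LeadP (int (Suc n) + - 2) (L $ Suc n) (G $ Suc n)" using LF[of "Suc n"] unfolding LeadF_def by blast
    then have "lead1 ?a (lookup (L $ Suc n) m) (lookup (G $ Suc n) m)"
      unfolding LeadP_def diff_conv_add_uminus by blast
    then have 2: "lead1 ?a (fps_const (of_nat (Suc n)) * lookup (L $ Suc n) m) (of_nat (Suc n) * lookup (G $ Suc n) m)"
      by (rule lead1_const_mult)
    have "c = c'" if "lead1 a h c" "lead1 a h c'" for a c c' and h :: "'a fps"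
      using that by (cases "a < 0") (auto simp: lead1_def dest: spec[of _ "nat a"])
    from this[OF 2 1] show "of_nat (Suc n) * lookup (G $ Suc n) m = lookup (?S B M $ n) m" .
  qed
qed

section \<open>The cycle lemma\<close>

text \<open>
  A step \<open>x - M\<close> is encoded by the natural number \<open>x\<close>, so that the steps can be exponents of a power
  series; \<open>-M\<close> is the lowest step.
\<close>

definition height :: "nat \<Rightarrow> nat list \<Rightarrow> nat \<Rightarrow> int"
  where "height M v t = (\<Sum>s<t. int (v ! s) - int M)"

definition excursion :: "nat \<Rightarrow> nat list \<Rightarrow> bool"
  where "excursion M v \<longleftrightarrow> (\<forall>t<length v. height M v t \<ge> 0)"

lemma height_rotate:
  assumes r: "r < length v" and t: "t < length v" and tot: "height M v (length v) = - 1"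
  shows "height M (rotate r v) t =
    (if r + t < length v then height M v (r + t) - height M v r else height M v (r + t - length v) - 1 - height M v r)"
proof -
  let ?n = "length v" and ?g = "\<lambda>s. int (v ! (s mod length v)) - int M"
  have "height M (rotate r v) t = (\<Sum>s<t. ?g (r + s))"
    unfolding height_def by (intro sum.cong refl) (use t in \<open>simp add: nth_rotate\<close>)
  also have "\<dots> = (\<Sum>s\<in>{r..<r + t}. ?g s)"
    by (rule sum.reindex_bij_witness[of _ "\<lambda>s. s - r" "\<lambda>s. r + s"]) auto
  moreover have cat: "(\<Sum>s<p. ?g s) + (\<Sum>s\<in>{p..<p + q}. ?g s) = (\<Sum>s<p + q. ?g s)" for p q
    unfolding lessThan_atLeast0 by (rule sum.atLeastLessThan_concat) simp_all
  ultimately have e: "height M (rotate r v) t = (\<Sum>s<r + t. ?g s) - (\<Sum>s<r. ?g s)"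
    using cat[of r t] by linarith
  have small: "(\<Sum>s<q. ?g s) = height M v q" if "q \<le> ?n" for q
    unfolding height_def by (intro sum.cong refl) (use that in auto)
  show ?thesis
  proof (cases "r + t < ?n")
    case True
    then show ?thesis using e small[of r] small[of "r + t"] r by simp
  next
    case False
    define q where "q = r + t - ?n"
    have q: "r + t = ?n + q" "q < ?n" using False r t by (auto simp: q_def)
    have "(\<Sum>s<?n + q. ?g s) = (\<Sum>s<?n. ?g s) + (\<Sum>s\<in>{?n..<?n + q}. ?g s)"
      by (rule cat[symmetric])
    also have "(\<Sum>s\<in>{?n..<?n + q}. ?g s) = (\<Sum>s<q. ?g s)"
      by (rule sum.reindex_bij_witness[of _ "\<lambda>s. s + ?n" "\<lambda>s. s - ?n"]) (auto simp: mod_if)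
    finally show ?thesis using e small[of r] small[of ?n] small[of q] r q tot False by simp
  qed
qed

text \<open>
  The rotation that starts at the first minimum of the path is the only one that stays nonnegative before its last
  step.
\<close>

lemma cycle_lemma:
  assumes tot: "height M v (length v) = - 1"
  shows "card {r. r < length v \<and> excursion M (rotate r v)} = 1"
proof -
  let ?n = "length v" and ?h = "height M v"
  have n0: "?n > 0" using tot by (cases v) (auto simp: height_def)
  have char: "excursion M (rotate r v) \<longleftrightarrow> (\<forall>q<?n. (q < r \<longrightarrow> ?h r < ?h q) \<and> (r < q \<longrightarrow> ?h r \<le> ?h q))" if r: "r < ?n" for r
  proof
    assume ex: "excursion M (rotate r v)"
    show "\<forall>q<?n. (q < r \<longrightarrow> ?h r < ?h q) \<and> (r < q \<longrightarrow> ?h r \<le> ?h q)"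
    proof (intro allI impI conjI)
      fix q assume q: "q < ?n" "q < r"
      have "0 \<le> height M (rotate r v) (?n + q - r)" using ex q r by (simp add: excursion_def)
      then show "?h r < ?h q" using height_rotate[OF r _ tot, of "?n + q - r"] q r by simp
    next
      fix q assume q: "q < ?n" "r < q"
      have "0 \<le> height M (rotate r v) (q - r)" using ex q r by (simp add: excursion_def)
      then show "?h r \<le> ?h q" using height_rotate[OF r _ tot, of "q - r"] q r by simp
    qed
  next
    assume *: "\<forall>q<?n. (q < r \<longrightarrow> ?h r < ?h q) \<and> (r < q \<longrightarrow> ?h r \<le> ?h q)"
    show "excursion M (rotate r v)"
      unfolding excursion_def
    proof (intro allI impI)
      fix t assume "t < length (rotate r v)"
      then have t: "t < ?n" by simp
      have a: "?h r \<le> ?h (r + t)" if "r + t < ?n" using * that by (cases "t = 0") auto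
      have b: "?h r < ?h (r + t - ?n)" if "\<not> r + t < ?n"
      proof -
        have "r + t - ?n < ?n" "r + t - ?n < r" using that t r by auto
        then show ?thesis using * by blast
      qed
      show "0 \<le> height M (rotate r v) t" using a b by (auto simp: height_rotate[OF r t tot])
    qed
  qed
  define m where "m = Min (?h ` {..<?n})"
  have fin: "finite (?h ` {..<?n})" "?h ` {..<?n} \<noteq> {}" using n0 by auto
  have m: "m \<in> ?h ` {..<?n}" unfolding m_def by (rule Min_in[OF fin])
  have ml: "m \<le> ?h q" if "q < ?n" for q unfolding m_def using that by (intro Min_le fin) auto
  define r0 where "r0 = (LEAST r. r < ?n \<and> ?h r = m)"
  have r0: "r0 < ?n \<and> ?h r0 = m" unfolding r0_def by (rule LeastI_ex) (use m in auto)
  have r0l: "\<not> (q < ?n \<and> ?h q = m)" if "q < r0" for q using not_less_Least that unfolding r0_def by blast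
  have "{r. r < ?n \<and> excursion M (rotate r v)} = {r0}"
  proof (intro equalityI subsetI)
    fix r assume "r \<in> {r. r < ?n \<and> excursion M (rotate r v)}"
    then have r: "r < ?n" and e: "\<forall>q<?n. (q < r \<longrightarrow> ?h r < ?h q) \<and> (r < q \<longrightarrow> ?h r \<le> ?h q)" using char by auto
    have "\<not> r0 < r" using e r0 ml[OF r] by fastforce
    moreover have "\<not> r < r0"
    proof
      assume "r < r0"
      then have "?h r \<le> m" using e r0 by auto
      then show False using ml[OF r] r0l[OF \<open>r < r0\<close>] r by simp
    qed
    ultimately show "r \<in> {r0}" by simp
  next
    fix r assume "r \<in> {r0}"
    moreover have "?h r0 < ?h q" if "q < ?n" "q < r0" for q
      using r0l[OF that(2)] ml[OF that(1)] r0 that(1) by (metis order_le_less)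
    ultimately show "r \<in> {r. r < ?n \<and> excursion M (rotate r v)}" using char[of r0] r0 ml by auto
  qed
  then show ?thesis by simp
qed

lemma mset_rotate_eq: "mset (rotate r v) = mset v"
  unfolding rotate_drop_take mset_append by (metis add.commute append_take_drop_id mset_append)

lemma rotate_bij_natpermute: "bij_betw (rotate r) (natpermute N k) (natpermute N k)"
proof (rule bij_betw_byWitness[of _ "\<lambda>v. rotate (k - r mod k) v"])
  have sum: "sum_list (rotate r v) = sum_list v" for r and v :: "nat list"
    by (metis mset_rotate_eq sum_mset_sum_list)
  show "rotate r ` natpermute N k \<subseteq> natpermute N k" "rotate (k - r mod k) ` natpermute N k \<subseteq> natpermute N k"
    by (auto simp: natpermute_def sum)
  have k: "(k - r mod k + r) mod k = 0" if "k > 0"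
    by (metis add.commute add_diff_cancel_left' le_add_diff_inverse2 mod_add_left_eq mod_le_divisor mod_self that mod_add_right_eq)
  have *: "rotate s v = v" if "s mod length v = 0" for s and v :: "nat list"
    using that by (metis rotate_conv_mod rotate0 id_apply)
  show "\<forall>v\<in>natpermute N k. rotate (k - r mod k) (rotate r v) = v"
  proof
    fix v assume "v \<in> natpermute N k"
    then have l: "length v = k" by (simp add: natpermute_def)
    show "rotate (k - r mod k) (rotate r v) = v"
      unfolding rotate_rotate using k * l by (cases "k = 0") auto
  qed
  show "\<forall>v\<in>natpermute N k. rotate r (rotate (k - r mod k) v) = v"
  proof
    fix v assume "v \<in> natpermute N k"
    then have l: "length v = k" by (simp add: natpermute_def)
    show "rotate r (rotate (k - r mod k) v) = v"
      unfolding rotate_rotate using k * l by (cases "k = 0") (auto simp: add.commute)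
  qed
qed

lemma natpermute_height:
  assumes "v \<in> natpermute (M * Suc k - 1) (Suc k)" "M > 0"
  shows "length v = Suc k" "height M v (length v) = - 1"
proof -
  show l: "length v = Suc k" using assms(1) by (simp add: natpermute_def)
  have "height M v (length v) = int (sum_list v) - int (length v) * int M"
    by (simp add: height_def sum_subtractf sum_list_sum_nth lessThan_atLeast0)
  also have "sum_list v = M * Suc k - 1" using assms(1) by (simp add: natpermute_def)
  finally show "height M v (length v) = - 1" using assms(2) by (simp add: l of_nat_diff algebra_simps)
qed

text \<open>
  The coefficient sums the weights of all sequences of steps with total \<open>-1\<close>. The weight is invariant under
  rotation, and each sequence has exactly one rotation that is an excursion.
\<close>

lemma power_coeff_excursions:
  fixes H :: "'r::comm_ring_1 fps"
  assumes M: "M > 0"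
  shows "H ^ Suc k $ (M * Suc k - 1) = of_nat (Suc k) *
    (\<Sum>v\<in>{v \<in> natpermute (M * Suc k - 1) (Suc k). excursion M v}. \<Prod>s<Suc k. H $ (v ! s))"
proof -
  let ?P = "natpermute (M * Suc k - 1) (Suc k)" and ?w = "\<lambda>v. \<Prod>s<Suc k. H $ (v ! s)"
  let ?e = "\<lambda>v. if excursion M v then ?w v else 0"
  have fin: "finite ?P" by (rule natpermute_finite)
  have w: "?w (rotate r v) = ?w v" if v: "v \<in> ?P" for r v
  proof -
    have W: "?w v = prod_mset (image_mset (\<lambda>x. H $ x) (mset v))" if "length v = Suc k" for v
    proof -
      have "?w v = prod_list (map (\<lambda>x. H $ x) v)"
        using that by (simp add: prod.list_conv_set_nth lessThan_atLeast0 del: prod.atLeast0_lessThan_Suc)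
      then show ?thesis by (metis mset_map prod_mset_prod_list)
    qed
    have "length v = Suc k" using v by (simp add: natpermute_def)
    then show ?thesis using W[of v] W[of "rotate r v"] by (simp add: mset_rotate_eq)
  qed
  have "H ^ Suc k $ (M * Suc k - 1) = (\<Sum>v\<in>?P. ?w v)"
    unfolding fps_power_nth by (simp add: lessThan_Suc_atMost atLeast0AtMost)
  also have "\<dots> = (\<Sum>v\<in>?P. \<Sum>r<Suc k. ?e (rotate r v))"
  proof (rule sum.cong[OF refl])
    fix v assume v: "v \<in> ?P"
    have "(\<Sum>r<Suc k. ?e (rotate r v)) = (\<Sum>r<Suc k. if excursion M (rotate r v) then ?w v else 0)"
      by (rule sum.cong[OF refl]) (simp only: w[OF v])
    also have "\<dots> = of_nat (card {r. r < Suc k \<and> excursion M (rotate r v)}) * ?w v"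
      by (simp add: sum.If_cases Int_def del: sum.lessThan_Suc prod.lessThan_Suc)
    also have "card {r. r < Suc k \<and> excursion M (rotate r v)} = 1"
      using cycle_lemma[OF natpermute_height(2)[OF v M]] unfolding natpermute_height(1)[OF v M] .
    finally show "?w v = (\<Sum>r<Suc k. ?e (rotate r v))" by simp
  qed
  also have "\<dots> = (\<Sum>r<Suc k. \<Sum>v\<in>?P. ?e (rotate r v))" by (rule sum.swap)
  also have "\<dots> = (\<Sum>r<Suc k. \<Sum>v\<in>?P. ?e v)"
    by (rule sum.cong[OF refl]) (rule sum.reindex_bij_betw[OF rotate_bij_natpermute])
  also have "\<dots> = of_nat (Suc k) * (\<Sum>v\<in>?P. ?e v)" by simp
  also have "(\<Sum>v\<in>?P. ?e v) = (\<Sum>v\<in>{v \<in> ?P. excursion M v}. ?w v)"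
    using fin by (simp add: sum.inter_filter[symmetric])
  finally show ?thesis .
qed

subsection \<open>Iterating the leading operator\<close>

text \<open>
  The generating series of the steps, shifted by \<open>M\<close>: the exponent \<open>v\<close> stands for a step \<open>v - M\<close>, which is a
  cut if it is negative and a join if it is positive.
\<close>

definition step_series :: "nat \<Rightarrow> 'r::comm_ring_1 ppoly fps \<Rightarrow> 'r ppoly fps fps"
  where "step_series M G = Abs_fps (\<lambda>v. if v < M then fps_const (pvar (M - v)) else if v = M then 0 else zperp (v - M) G)"

lemma cut_join_lead_eq_step_series: "cut_join_lead M G w a = (if a = 0 then 0 else \<Sum>v<a + M. step_series M G $ v * w (a + M - v))"
proof (cases "a = 0")
  case False
  have eq: "{..<a + M} = {..<M} \<union> insert M {M<..<a + M}" using False by auto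
  have "(\<Sum>v<a + M. step_series M G $ v * w (a + M - v)) =
      (\<Sum>v<M. step_series M G $ v * w (a + M - v)) + (\<Sum>v\<in>insert M {M<..<a + M}. step_series M G $ v * w (a + M - v))"
    unfolding eq by (rule sum.union_disjoint) auto
  also have "(\<Sum>v<M. step_series M G $ v * w (a + M - v)) = (\<Sum>i\<in>{a<..a + M}. fps_const (pvar (i - a)) * w i)"
    by (rule sum.reindex_bij_witness[of _ "\<lambda>i. a + M - i" "\<lambda>v. a + M - v"]) (auto simp: step_series_def)
  also have "(\<Sum>v\<in>insert M {M<..<a + M}. step_series M G $ v * w (a + M - v)) = (\<Sum>v\<in>{M<..<a + M}. step_series M G $ v * w (a + M - v))"
    by (simp add: step_series_def)
  also have "\<dots> = (\<Sum>j\<in>{1..<a}. zperp j G * w (a - j))"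
    by (rule sum.reindex_bij_witness[of _ "\<lambda>j. j + M" "\<lambda>v. v - M"]) (auto simp: step_series_def)
  finally show ?thesis using False by (simp add: cut_join_lead_def)
qed (simp add: cut_join_lead_def)

lemma unmark_eq_step_series: "unmark M w = (\<Sum>v<M. step_series M G $ v * w (M - v))"
  unfolding unmark_def by (rule sum.reindex_bij_witness[of _ "\<lambda>v. M - v" "\<lambda>i. M - i"]) (auto simp: step_series_def)

definition paths :: "nat \<Rightarrow> nat \<Rightarrow> int \<Rightarrow> nat list set"
  where "paths M k a = {v. length v = k \<and> excursion M v \<and> height M v k = a}"

lemma height_snoc: "t \<le> length v \<Longrightarrow> height M (v @ [x]) t = height M v t"
  unfolding height_def by (rule sum.cong) (auto simp: nth_append)

lemma height_snoc_full: "height M (v @ [x]) (Suc (length v)) = height M v (length v) + (int x - int M)"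
proof -
  have "height M (v @ [x]) (Suc (length v)) = height M (v @ [x]) (length v) + (int x - int M)"
    by (simp add: height_def)
  then show ?thesis by (simp add: height_snoc)
qed

lemma excursion_snoc: "excursion M (v @ [x]) \<longleftrightarrow> excursion M v \<and> height M v (length v) \<ge> 0"
  unfolding excursion_def by (auto simp: height_snoc less_Suc_eq)

lemma paths_Suc:
  "paths M (Suc k) a = (\<Union>b\<in>{b. 0 \<le> b \<and> b \<le> a + int M}. (\<lambda>v. v @ [nat (a + int M - b)]) ` paths M k b)"
proof (intro equalityI subsetI)
  fix u assume u: "u \<in> paths M (Suc k) a"
  then obtain v x where vx: "u = v @ [x]" "length v = k"
    by (auto simp: paths_def length_Suc_conv_rev)
  define b where "b = height M v k"
  have "0 \<le> b" "excursion M v" "b + (int x - int M) = a"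
    using u height_snoc_full[of M v x] by (auto simp: paths_def vx b_def excursion_snoc)
  then show "u \<in> (\<Union>b\<in>{b. 0 \<le> b \<and> b \<le> a + int M}. (\<lambda>v. v @ [nat (a + int M - b)]) ` paths M k b)"
    using vx by (intro UN_I[of b]) (auto simp: paths_def b_def intro!: image_eqI[of _ _ v])
next
  fix u assume "u \<in> (\<Union>b\<in>{b. 0 \<le> b \<and> b \<le> a + int M}. (\<lambda>v. v @ [nat (a + int M - b)]) ` paths M k b)"
  then obtain b v where "0 \<le> b" "b \<le> a + int M" "v \<in> paths M k b" "u = v @ [nat (a + int M - b)]" by blast
  then show "u \<in> paths M (Suc k) a"
    using height_snoc_full[of M v "nat (a + int M - b)"] by (auto simp: paths_def excursion_snoc)
qed

lemma finite_paths: "finite (paths M k a)"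
proof (induction k arbitrary: a)
  case 0
  show ?case by (rule finite_subset[of _ "{[]}"]) (auto simp: paths_def)
next
  case (Suc k)
  have "{b. 0 \<le> b \<and> b \<le> a + int M} = {0..a + int M}" by auto
  then have "finite {b. 0 \<le> b \<and> b \<le> a + int M}" by simp
  then show ?case unfolding paths_Suc using Suc by blast
qed

lemma sum_paths_Suc:
  fixes H :: "'r::comm_ring_1 fps"
  shows "(\<Sum>u\<in>paths M (Suc k) a. \<Prod>s<Suc k. H $ (u ! s)) =
    (\<Sum>b\<in>{0..a + int M}. H $ nat (a + int M - b) * (\<Sum>v\<in>paths M k b. \<Prod>s<k. H $ (v ! s)))"
proof -
  have I: "{b. 0 \<le> b \<and> b \<le> a + int M} = {0..a + int M}" by auto
  have "(\<Sum>u\<in>paths M (Suc k) a. \<Prod>s<Suc k. H $ (u ! s)) =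
      (\<Sum>b\<in>{0..a + int M}. \<Sum>u\<in>(\<lambda>v. v @ [nat (a + int M - b)]) ` paths M k b. \<Prod>s<Suc k. H $ (u ! s))"
    unfolding paths_Suc I
  proof (rule sum.UNION_disjoint)
    show "\<forall>i\<in>{0..a + int M}. \<forall>j\<in>{0..a + int M}. i \<noteq> j \<longrightarrow>
        (\<lambda>v. v @ [nat (a + int M - i)]) ` paths M k i \<inter> (\<lambda>v. v @ [nat (a + int M - j)]) ` paths M k j = {}"
      by (auto simp: paths_def)
  qed (auto intro: finite_paths)
  also have "\<dots> = (\<Sum>b\<in>{0..a + int M}. H $ nat (a + int M - b) * (\<Sum>v\<in>paths M k b. \<Prod>s<k. H $ (v ! s)))"
  proof (rule sum.cong[OF refl])
    fix b
    have "inj_on (\<lambda>v. v @ [nat (a + int M - b)]) (paths M k b)" by (auto intro: inj_onI)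
    then have "(\<Sum>u\<in>(\<lambda>v. v @ [nat (a + int M - b)]) ` paths M k b. \<Prod>s<Suc k. H $ (u ! s)) =
        (\<Sum>v\<in>paths M k b. \<Prod>s<Suc k. H $ ((v @ [nat (a + int M - b)]) ! s))"
      by (simp only: sum.reindex comp_def)
    also have "\<dots> = (\<Sum>v\<in>paths M k b. H $ nat (a + int M - b) * (\<Prod>s<k. H $ (v ! s)))"
    proof (rule sum.cong[OF refl])
      fix v assume "v \<in> paths M k b"
      then have l: "length v = k" by (simp add: paths_def)
      have "(\<Prod>s<k. H $ ((v @ [nat (a + int M - b)]) ! s)) = (\<Prod>s<k. H $ (v ! s))"
        by (rule prod.cong) (auto simp: nth_append l)
      then show "(\<Prod>s<Suc k. H $ ((v @ [nat (a + int M - b)]) ! s)) = H $ nat (a + int M - b) * (\<Prod>s<k. H $ (v ! s))"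
        by (simp add: l[symmetric] mult.commute)
    qed
    finally show "(\<Sum>u\<in>(\<lambda>v. v @ [nat (a + int M - b)]) ` paths M k b. \<Prod>s<Suc k. H $ (u ! s)) =
        H $ nat (a + int M - b) * (\<Sum>v\<in>paths M k b. \<Prod>s<k. H $ (v ! s))"
      by (simp add: sum_distrib_left)
  qed
  finally show ?thesis .
qed

text \<open>
  A marked cycle of length \<open>a\<close> corresponds to the height \<open>a - 1\<close>.
\<close>

lemma cut_join_lead_pow_paths:
  "a > 0 \<Longrightarrow> (cut_join_lead M G ^^ k) (unit_state 1) a = (\<Sum>v\<in>paths M k (int a - 1). \<Prod>s<k. step_series M G $ (v ! s))"
proof (induction k arbitrary: a)
  case 0
  have "paths M 0 (int a - 1) = (if a = 1 then {[]} else {})" by (auto simp: paths_def excursion_def height_def)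
  then show ?case by (simp add: unit_state_def)
next
  case (Suc k)
  have "(cut_join_lead M G ^^ Suc k) (unit_state 1) a = (\<Sum>v<a + M. step_series M G $ v * (cut_join_lead M G ^^ k) (unit_state 1) (a + M - v))"
    using Suc.prems by (simp add: cut_join_lead_eq_step_series)
  also have "\<dots> = (\<Sum>v<a + M. step_series M G $ v * (\<Sum>u\<in>paths M k (int (a + M - v) - 1). \<Prod>s<k. step_series M G $ (u ! s)))"
    by (intro sum.cong refl) (simp add: Suc.IH)
  also have "\<dots> = (\<Sum>b\<in>{0..int a - 1 + int M}. step_series M G $ nat (int a - 1 + int M - b) * (\<Sum>v\<in>paths M k b. \<Prod>s<k. step_series M G $ (v ! s)))"
    using Suc.prems
    by (intro sum.reindex_bij_witness[of _ "\<lambda>b. nat (int a - 1 + int M - b)" "\<lambda>v. int (a + M - v) - 1"]) (auto simp: of_nat_diff)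
  finally show ?case unfolding sum_paths_Suc .
qed

lemma paths_natpermute:
  assumes "M > 0"
  shows "paths M (Suc k) (- 1) = {v \<in> natpermute (M * Suc k - 1) (Suc k). excursion M v}"
proof (intro equalityI subsetI)
  fix v assume v: "v \<in> paths M (Suc k) (- 1)"
  then have l: "length v = Suc k" by (simp add: paths_def)
  have "height M v (length v) = int (sum_list v) - int (length v) * int M"
    by (simp add: height_def sum_subtractf sum_list_sum_nth lessThan_atLeast0)
  then have "int (sum_list v) = int (Suc k) * int M - 1" using v l by (simp add: paths_def)
  then have "int (sum_list v + 1) = int (M * Suc k)" by (simp add: algebra_simps)
  then have "sum_list v + 1 = M * Suc k" by (simp only: of_nat_eq_iff)
  then have "sum_list v = M * Suc k - 1" by simp
  then show "v \<in> {v \<in> natpermute (M * Suc k - 1) (Suc k). excursion M v}" using v l by (simp add: natpermute_def paths_def)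
next
  fix v assume "v \<in> {v \<in> natpermute (M * Suc k - 1) (Suc k). excursion M v}"
  then show "v \<in> paths M (Suc k) (- 1)"
    using natpermute_height[of v M k] assms by (simp add: paths_def)
qed

text \<open>
  Unmarking is one more step, from height \<open>a - 1\<close> down to \<open>-1\<close>.
\<close>

theorem unmark_cut_join_lead_power:
  assumes M: "M > 0"
  shows "of_nat (Suc k) * unmark M ((cut_join_lead M G ^^ k) (unit_state 1)) = step_series M G ^ Suc k $ (M * Suc k - 1)"
proof -
  have "unmark M ((cut_join_lead M G ^^ k) (unit_state 1)) = (\<Sum>v<M. step_series M G $ v * (\<Sum>u\<in>paths M k (int (M - v) - 1). \<Prod>s<k. step_series M G $ (u ! s)))"
    unfolding unmark_eq_step_series[of M _ G] by (intro sum.cong refl) (simp add: cut_join_lead_pow_paths)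
  also have "\<dots> = (\<Sum>b\<in>{0..- 1 + int M}. step_series M G $ nat (- 1 + int M - b) * (\<Sum>v\<in>paths M k b. \<Prod>s<k. step_series M G $ (v ! s)))"
    by (intro sum.reindex_bij_witness[of _ "\<lambda>b. nat (- 1 + int M - b)" "\<lambda>v. int (M - v) - 1"]) (auto simp: of_nat_diff)
  also have "\<dots> = (\<Sum>u\<in>paths M (Suc k) (- 1). \<Prod>s<Suc k. step_series M G $ (u ! s))" by (rule sum_paths_Suc[symmetric])
  finally show ?thesis unfolding power_coeff_excursions[OF M] paths_natpermute[OF M] by simp
qed

section \<open>The differential equation\<close>

text \<open>
  Convergence coefficient by coefficient is convergence in the topology of formal power series.
\<close>

lemma fps_suminf_nth:
  fixes h :: "nat \<Rightarrow> 'r::ab_group_add fps"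
  assumes conv: "\<And>n. \<exists>C. \<forall>k\<ge>C. h k $ n = 0" and C: "\<forall>k\<ge>C. h k $ n = 0"
  shows "suminf h $ n = (\<Sum>k<C. h k $ n)"
proof -
  obtain N where N: "\<And>n k. N n \<le> k \<Longrightarrow> h k $ n = 0" using conv by metis
  have eq: "(\<Sum>k<B. h k $ n) = (\<Sum>k<A. h k $ n)" if "A \<le> B" "\<forall>k\<ge>A. h k $ n = 0" for n A B
    using that by (intro sum.mono_neutral_right) auto
  have "h sums Abs_fps (\<lambda>n. \<Sum>k<N n. h k $ n)"
    unfolding sums_def
  proof (rule tendsto_fpsI)
    fix n
    have "\<forall>B\<ge>N n. (\<Sum>k<B. h k) $ n = Abs_fps (\<lambda>n. \<Sum>k<N n. h k $ n) $ n"
      unfolding fps_sum_nth fps_nth_Abs_fps by (intro allI impI eq) (use N in auto)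
    then show "\<forall>\<^sub>F B in sequentially. (\<Sum>k<B. h k) $ n = Abs_fps (\<lambda>n. \<Sum>k<N n. h k $ n) $ n"
      unfolding eventually_sequentially by blast
  qed
  then have "suminf h $ n = (\<Sum>k<N n. h k $ n)" by (simp add: sums_unique[symmetric])
  also have "\<dots> = (\<Sum>k<C. h k $ n)"
    using eq[of "N n" "max C (N n)" n] eq[of C "max C (N n)" n] C N by simp
  finally show ?thesis .
qed

subsection \<open>Degrees of the powers of the gradient series\<close>

lemma perp_series_0 [simp]: "perp_series G $ 0 = 0"
  by (simp add: perp_series_def)

lemma perp_series_nth: "i > 0 \<Longrightarrow> perp_series G $ i $ n = perp i (G $ n)"
  by (simp add: perp_series_def)

lemma power_Suc_nth_nth:
  fixes P :: "'r::comm_semiring_1 fps fps"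
  shows "P ^ Suc m $ l $ n = (\<Sum>i=0..l. \<Sum>t=0..n. P $ i $ t * P ^ m $ (l - i) $ (n - t))"
  by (simp add: fps_mult_nth fps_sum_nth)

text \<open>
  This and the next two lemmas bound the range of \<open>u\<close>-exponents and of \<open>z\<close>-exponents in the powers of
  \<open>\<Sum>\<^sub>i (p\<^sub>i\<^sup>\<bottom> G) u\<^sup>i\<close>. They show that the infinite sums of the equation are finite in each degree of \<open>z\<close>.
\<close>

lemma power_u_bound:
  fixes P :: "'r::comm_semiring_1 fps fps"
  assumes "\<And>i t. t \<le> n \<Longrightarrow> B < i \<Longrightarrow> P $ i $ t = 0"
  shows "t \<le> n \<Longrightarrow> m * B < l \<Longrightarrow> P ^ m $ l $ t = 0"
proof (induction m arbitrary: l t)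
  case (Suc m)
  show ?case unfolding power_Suc_nth_nth
  proof (intro sum.neutral ballI)
    fix i s assume i: "i \<in> {0..l}" and s: "s \<in> {0..t}"
    show "P $ i $ s * P ^ m $ (l - i) $ (t - s) = 0"
    proof (cases "B < i")
      case True
      then show ?thesis using assms[of s i] s Suc.prems by simp
    next
      case False
      then have "m * B < l - i" using Suc.prems by simp
      then show ?thesis using Suc.IH[of "t - s" "l - i"] Suc.prems by simp
    qed
  qed
qed (cases l, simp_all)

lemma power_z_bound:
  fixes P :: "'r::comm_semiring_1 fps fps"
  assumes "\<And>i. P $ i $ 0 = 0"
  shows "t < m \<Longrightarrow> P ^ m $ l $ t = 0"
proof (induction m arbitrary: l t)
  case (Suc m)
  show ?case unfolding power_Suc_nth_nth
  proof (intro sum.neutral ballI)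
    fix i s assume "i \<in> {0..l}" "s \<in> {0..t}"
    then show "P $ i $ s * P ^ m $ (l - i) $ (t - s) = 0"
      using Suc.IH[of "t - s" "l - i"] Suc.prems assms by (cases "s = 0") auto
  qed
qed simp

lemma power_triangular:
  fixes P :: "'r::comm_semiring_1 fps fps"
  assumes "\<And>i t. t < i \<Longrightarrow> P $ i $ t = 0"
  shows "t < l \<Longrightarrow> P ^ m $ l $ t = 0"
proof (induction m arbitrary: l t)
  case (Suc m)
  show ?case unfolding power_Suc_nth_nth
  proof (intro sum.neutral ballI)
    fix i s assume i: "i \<in> {0..l}" and s: "s \<in> {0..t}"
    show "P $ i $ s * P ^ m $ (l - i) $ (t - s) = 0"
    proof (cases "s < i")
      case False
      then have "t - s < l - i" using i s Suc.prems by auto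
      then show ?thesis using Suc.IH by simp
    qed (simp add: assms)
  qed
qed (cases l, simp_all)

lemma power_nth_cong:
  fixes P Q :: "'r::comm_semiring_1 fps fps"
  assumes "\<And>i t. t \<le> n \<Longrightarrow> P $ i $ t = Q $ i $ t"
  shows "t \<le> n \<Longrightarrow> P ^ m $ l $ t = Q ^ m $ l $ t"
proof (induction m arbitrary: l t)
  case (Suc m)
  show ?case unfolding power_Suc_nth_nth
    by (intro sum.cong refl arg_cong2[of _ _ _ _ "(*)"] assms Suc.IH) (use Suc.prems in auto)
qed simp

lemma perp_eq_0:
  assumes "\<And>m. m \<in> keys P \<Longrightarrow> lookup m (i - 1) = 0"
  shows "perp i P = 0"
  unfolding perp_def
  by (intro sum.neutral ballI) (simp only: assms of_nat_0 mult_zero_left mult_zero_right single_zero)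

lemma perp_bound: "\<exists>B. \<forall>t\<le>n. \<forall>i>B. perp i ((G :: 'r::comm_semiring_1 ppoly fps) $ t) = 0"
proof (induction n)
  have single: "\<exists>B. \<forall>i>B. perp i P = 0" for P :: "'r ppoly"
  proof -
    let ?S = "\<Union>m\<in>keys P. keys m"
    have "finite ?S" by simp
    then obtain B where B: "\<And>i. i \<in> ?S \<Longrightarrow> i < B" by (meson finite_nat_set_iff_bounded)
    have "perp i P = 0" if "i > B" for i
    proof (rule perp_eq_0)
      fix m assume "m \<in> keys P"
      then show "lookup m (i - 1) = 0" using B[of "i - 1"] that by (fastforce simp: in_keys_iff)
    qed
    then show ?thesis by blast
  qed
  {
    case 0
    then show ?case using single[of "G $ 0"] by simp
  next
    case (Suc n)
    then obtain B where B: "\<forall>t\<le>n. \<forall>i>B. perp i (G $ t) = 0" by blast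
    obtain B' where B': "\<forall>i>B'. perp i (G $ Suc n) = 0" using single by blast
    show ?case by (rule exI[of _ "max B B'"]) (use B B' in \<open>auto simp: le_Suc_eq\<close>)
  }
qed

subsection \<open>Coefficients of the two sides\<close>

definition pde_inner :: "'r::field_char_0 ppoly fps \<Rightarrow> nat \<Rightarrow> nat \<Rightarrow> nat \<Rightarrow> 'r ppoly fps"
  where "pde_inner G j m l = (\<Sum>a\<in>compositions (l + 1) j. fps_const (pprod a) * ((perp_series G ^ m) $ l))"

definition pde_term :: "'a::field_char_0 fps \<Rightarrow> 'a ppoly fps \<Rightarrow> nat \<Rightarrow> 'a ppoly fps"
  where "pde_term f G k = fps_const (pconst (f $ k / of_nat (k + 1))) *
    (\<Sum>j = 1..k. of_nat ((k + 1) choose j) * suminf (pde_inner G j (k + 1 - j)))"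

lemma pde_lhs_eq:
  "pde_lhs f G = fps_X * fps_const (pconst (f $ 0) * pvar 1) + fps_X * suminf (\<lambda>k'. pde_term f G (Suc k'))"
  by (simp add: pde_lhs_def pde_term_def Let_def pde_inner_def[abs_def])

lemma pde_inner_nth: "pde_inner G j m l $ n = (\<Sum>a\<in>compositions (l + 1) j. pprod a * (perp_series G ^ m) $ l $ n)"
  by (simp add: pde_inner_def fps_sum_nth)

lemma pde_inner_nth_0: "(perp_series G ^ m) $ l $ n = 0 \<Longrightarrow> pde_inner G j m l $ n = 0"
  by (simp add: pde_inner_nth)

lemma suminf_pde_inner_nth:
  assumes "\<forall>l\<ge>C. pde_inner G j m l $ n = 0"
  shows "suminf (pde_inner G j m) $ n = (\<Sum>l<C. pde_inner G j m l $ n)"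
proof (rule fps_suminf_nth[OF _ assms])
  fix n
  obtain B where B: "\<forall>t\<le>n. \<forall>i>B. perp i (G $ t) = 0" using perp_bound by blast
  have "pde_inner G j m l $ n = 0" if "m * B + 1 \<le> l" for l
    by (rule pde_inner_nth_0, rule power_u_bound[of n B]) (use B that in \<open>auto simp: perp_series_nth\<close>)
  then show "\<exists>C. \<forall>l\<ge>C. pde_inner G j m l $ n = 0" by blast
qed

lemma compositions_empty: "n < j \<Longrightarrow> compositions n j = {}"
  using length_le_sum_list by (fastforce simp: compositions_def)

text \<open>
  A nonzero term needs a power \<open>m \<le> n\<close> of the series in \<open>u\<close>, whose \<open>u\<close>-exponent \<open>l\<close> is then at most \<open>n B\<close>; but
  \<open>j = k + 1 - m\<close> positive parts have sum \<open>l + 1\<close>, which bounds \<open>k\<close>.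
\<close>

lemma pde_term_vanishes:
  assumes G0: "G $ 0 = 0" and B: "\<forall>t\<le>n. \<forall>i>B. perp i (G $ t) = 0" and k: "n + n * B < k"
  shows "pde_term f G k $ n = 0"
proof -
  have z: "suminf (pde_inner G j (k + 1 - j)) $ n = 0" if j: "j \<in> {1..k}" for j
  proof -
    define m where "m = k + 1 - j"
    have "pde_inner G j m l $ n = 0" for l
    proof (cases "n < m")
      case True
      have "perp_series G $ i $ 0 = 0" for i by (cases "i = 0") (simp_all add: perp_series_nth G0)
      then show ?thesis using True by (intro pde_inner_nth_0 power_z_bound)
    next
      case False
      show ?thesis
      proof (cases "m * B < l")
        case True
        show ?thesis
          by (rule pde_inner_nth_0, rule power_u_bound[of n B]) (use B True in \<open>auto simp: perp_series_nth\<close>)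
      next
        case nl: False
        have "m * B \<le> n * B" using False by (intro mult_right_mono) auto
        moreover have "j + m = k + 1" using j by (simp add: m_def)
        ultimately have "l + 1 < j" using nl False k by linarith
        then show ?thesis by (simp add: pde_inner_nth compositions_empty)
      qed
    qed
    then show ?thesis using suminf_pde_inner_nth[of 0 G j m n] by (simp add: m_def)
  qed
  have "(\<Sum>j = 1..k. of_nat ((k + 1) choose j) * suminf (pde_inner G j (k + 1 - j))) $ n = 0"
    unfolding fps_sum_nth
    by (rule sum.neutral) (use z in \<open>simp add: fps_of_nat[symmetric] del: fps_of_nat of_nat_Suc\<close>)
  then show ?thesis by (simp add: pde_term_def)
qed

lemma pde_lhs_nth_0: "pde_lhs f G $ 0 = 0"
  by (simp add: pde_lhs_eq)

lemma pde_lhs_nth_Suc: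
  assumes G0: "G $ 0 = 0"
  shows "\<exists>K0. \<forall>C\<ge>K0. pde_lhs f G $ Suc n = (if n = 0 then pconst (f $ 0) * pvar 1 else 0) + (\<Sum>k<C. pde_term f G (Suc k) $ n)"
proof -
  have "\<exists>C. \<forall>k\<ge>C. pde_term f G (Suc k) $ n = 0" for n
  proof -
    obtain B where B: "\<forall>t\<le>n. \<forall>i>B. perp i (G $ t) = 0" using perp_bound by blast
    then have "\<forall>k\<ge>n + n * B. pde_term f G (Suc k) $ n = 0"
      by (intro allI impI pde_term_vanishes[OF G0 B]) simp
    then show ?thesis by blast
  qed
  then obtain N where N: "\<And>n. \<forall>k\<ge>N n. pde_term f G (Suc k) $ n = 0" by metis
  have "suminf (\<lambda>k'. pde_term f G (Suc k')) $ n = (\<Sum>k<C. pde_term f G (Suc k) $ n)" if "C \<ge> N n" for C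
    by (rule fps_suminf_nth) (use N that in \<open>auto intro: order_trans\<close>)
  then have "\<forall>C\<ge>N n. pde_lhs f G $ Suc n = (if n = 0 then pconst (f $ 0) * pvar 1 else 0) + (\<Sum>k<C. pde_term f G (Suc k) $ n)"
    by (simp add: pde_lhs_eq)
  then show ?thesis by blast
qed

text \<open>
  This triangularity makes the solution unique: the factor \<open>z\<close> on the left side lets the equation determine each
  coefficient from the earlier ones.
\<close>

lemma pde_lhs_nth_cong:
  assumes eq: "\<And>t. t \<le> n \<Longrightarrow> G $ t = G' $ t" and G0: "G $ 0 = 0"
  shows "pde_lhs f G $ Suc n = pde_lhs f G' $ Suc n"
proof -
  have P: "perp_series G $ i $ t = perp_series G' $ i $ t" if "t \<le> n" for i t
    using eq[OF that] by (cases "i = 0") (simp_all add: perp_series_nth)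
  have i: "pde_inner G j m l $ n = pde_inner G' j m l $ n" for j m l
    unfolding pde_inner_nth using power_nth_cong[of n "perp_series G" "perp_series G'" n m l] P by simp
  have s: "suminf (pde_inner G j m) $ n = suminf (pde_inner G' j m) $ n" for j m
  proof -
    obtain B where B: "\<forall>t\<le>n. \<forall>i>B. perp i (G $ t) = 0" using perp_bound by blast
    have "pde_inner G j m l $ n = 0" if "m * B + 1 \<le> l" for l
      by (rule pde_inner_nth_0, rule power_u_bound[of n B]) (use B that in \<open>auto simp: perp_series_nth\<close>)
    then have "\<forall>l\<ge>m * B + 1. pde_inner G j m l $ n = 0" "\<forall>l\<ge>m * B + 1. pde_inner G' j m l $ n = 0" by (simp_all add: i)
    then show ?thesis by (simp only: suminf_pde_inner_nth i)
  qed
  have t: "pde_term f G k $ n = pde_term f G' k $ n" for k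
    unfolding pde_term_def fps_mult_left_const_nth fps_sum_nth
    by (intro arg_cong2[of _ _ _ _ "(*)"] sum.cong refl) (simp add: s fps_of_nat[symmetric] del: fps_of_nat of_nat_Suc)
  have G0': "G' $ 0 = 0" using eq[of 0] G0 by simp
  obtain K1 where K1: "\<forall>C\<ge>K1. pde_lhs f G $ Suc n = (if n = 0 then pconst (f $ 0) * pvar 1 else 0) + (\<Sum>k<C. pde_term f G (Suc k) $ n)"
    using pde_lhs_nth_Suc[OF G0] by blast
  obtain K2 where K2: "\<forall>C\<ge>K2. pde_lhs f G' $ Suc n = (if n = 0 then pconst (f $ 0) * pvar 1 else 0) + (\<Sum>k<C. pde_term f G' (Suc k) $ n)"
    using pde_lhs_nth_Suc[OF G0'] by blast
  show ?thesis using K1[rule_format, of "max K1 K2"] K2[rule_format, of "max K1 K2"] by (simp add: t)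
qed

definition weight :: "(nat \<Rightarrow>\<^sub>0 nat) \<Rightarrow> nat"
  where "weight m = (\<Sum>i\<in>keys m. Suc i * lookup m i)"

lemma lookup_pvar_perp:
  "lookup (pvar i * perp i P) m = of_nat (i * lookup m (i - 1)) * lookup (P :: 'r::comm_ring_1 ppoly) m"
proof -
  have "pvar i * perp i P = (\<Sum>k\<in>keys P. pvar i * perp i (single k (lookup P k)))"
    by (subst sum_single_keys[of P, symmetric]) (simp add: perp_sum sum_distrib_left)
  also have "\<dots> = (\<Sum>k\<in>keys P. single k (of_nat (i * lookup k (i - 1)) * lookup P k))"
  proof (rule sum.cong[OF refl])
    fix k
    show "pvar i * perp i (single k (lookup P k)) = single k (of_nat (i * lookup k (i - 1)) * lookup P k)"
      using minus_var_exp_add[of k i] by (cases "lookup k (i - 1) = 0") (simp_all add: perp_single pvar_single)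
  qed
  finally show ?thesis
    by (auto simp: lookup_sum lookup_single when_def sum.If_cases in_keys_iff)
qed

text \<open>
  Each \<open>p\<^sub>i p\<^sub>i\<^sup>\<bottom>\<close> multiplies a monomial by \<open>i\<close> times its exponent of \<open>p\<^sub>i\<close>.
\<close>

lemma lookup_pde_rhs:
  fixes G :: "'a::field_char_0 ppoly fps"
  shows "lookup (pde_rhs G $ n) m = of_nat (weight m) * lookup (G $ n) m"
proof -
  let ?h = "\<lambda>i. fps_const (pvar (Suc i)) * zperp (Suc i) G"
  have conv: "\<exists>C. \<forall>i\<ge>C. ?h i $ n = 0" for n
  proof -
    obtain B where "\<forall>t\<le>n. \<forall>i>B. perp i (G $ t) = 0" using perp_bound by blast
    then show ?thesis by (intro exI[of _ B]) auto
  qed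
  then obtain C where C: "\<forall>i\<ge>C. ?h i $ n = 0" by blast
  have l: "lookup (?h i $ n) m = of_nat (Suc i * lookup m i) * lookup (G $ n) m" for i
    using lookup_pvar_perp[of "Suc i" "G $ n" m] by simp
  have "pde_rhs G $ n = (\<Sum>i<C. ?h i $ n)"
    unfolding pde_rhs_def Let_def by (rule fps_suminf_nth[OF conv C])
  then have "lookup (pde_rhs G $ n) m = (\<Sum>i<C. of_nat (Suc i * lookup m i) * lookup (G $ n) m)"
    unfolding lookup_sum l[symmetric] by (simp add: lookup_sum)
  also have "\<dots> = of_nat (weight m) * lookup (G $ n) m"
  proof (cases "lookup (G $ n) m = 0")
    case False
    have "keys m \<subseteq> {..<C}"
    proof
      fix i assume i: "i \<in> keys m"
      show "i \<in> {..<C}"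
      proof (rule ccontr)
        assume "i \<notin> {..<C}"
        then have "?h i $ n = 0" using C by simp
        then have "of_nat (Suc i * lookup m i) * lookup (G $ n) m = 0"
          using l[of i] by (simp del: of_nat_mult of_nat_Suc fps_mult_left_const_nth)
        then show False using False i by (simp add: in_keys_iff del: of_nat_Suc of_nat_mult mult_Suc)
      qed
    qed
    then have "weight m = (\<Sum>i<C. Suc i * lookup m i)"
      unfolding weight_def by (intro sum.mono_neutral_left) (auto simp: in_keys_iff)
    then show ?thesis by (simp add: sum_distrib_right del: of_nat_Suc)
  qed simp
  finally show ?thesis .
qed

lemma weight_add: "weight (m + k) = weight m + weight k"
proof -
  let ?A = "keys m \<union> keys k"
  have s: "weight q = (\<Sum>i\<in>?A. Suc i * lookup q i)" if "keys q \<subseteq> ?A" for q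
    unfolding weight_def using that by (intro sum.mono_neutral_left) (auto simp: in_keys_iff)
  show ?thesis using keys_add[of m k] s[of "m + k"] s[of m] s[of k]
    by (simp add: lookup_add distrib_left sum.distrib del: mult_Suc)
qed

lemma weight_pexp: "0 \<notin> set \<alpha> \<Longrightarrow> weight (pexp \<alpha>) = sum_list \<alpha>"
proof (induction \<alpha>)
  case (Cons a \<alpha>)
  have "weight (var_exp a) = a" using Cons.prems by (cases a) (simp_all add: weight_def var_exp_def)
  then show ?case using Cons by (simp add: pexp_Cons weight_add)
qed (simp add: pexp_def weight_def)

lemma weight_eq_0: "weight m = 0 \<Longrightarrow> m = 0"
  by (rule poly_mapping_eqI) (auto simp: weight_def in_keys_iff)

subsection \<open>The genus zero series satisfies the equation\<close>

text \<open>
  A variable \<open>p\<^sub>i\<close> cannot occur in a homogeneous polynomial of degree less than \<open>i\<close>.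
\<close>

lemma Psi0_hat_triangular:
  assumes "t < i"
  shows "perp i (Psi0_hat f $ t) = 0"
proof (rule perp_eq_0)
  fix m assume "m \<in> keys (Psi0_hat f $ t)"
  then obtain \<alpha> where \<alpha>: "m = pexp \<alpha>" "0 \<notin> set \<alpha>" "sum_list \<alpha> = t"
    using Psi0_hat_homogeneous[of t f] unfolding homogeneous_def by blast
  have "i \<notin> set \<alpha>" using member_le_sum_list[of i \<alpha>] \<alpha>(3) assms by auto
  then show "lookup m (i - 1) = 0"
    using lookup_pexp[OF \<alpha>(2), of "i - 1"] assms \<alpha>(1) by (simp add: count_eq_zero_iff)
qed

lemma Psi0_hat_0: "Psi0_hat f $ 0 = 0"
  by (rule poly_mapping_eqI) (simp add: lookup_Psi0_hat log_series_def pconst_def)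

lemma sum_list_complement:
  "\<forall>x\<in>set v. x \<le> M \<Longrightarrow> sum_list (map (\<lambda>x. M - x) v) + sum_list v = M * length (v :: nat list)"
  by (induction v) auto

text \<open>
  Replacing each \<open>x\<close> by \<open>M - x\<close> turns the sequences of down steps into compositions. The bound \<open>s \<le> M\<close>
  guarantees that no part exceeds \<open>M\<close>.
\<close>

lemma down_power_nth:
  fixes M :: nat
  defines "A \<equiv> Abs_fps (\<lambda>v. if v < M then fps_const (pvar (M - v)) else 0) :: 'a::field_char_0 ppoly fps fps"
  assumes j: "j \<ge> 1" and s: "s \<le> M"
  shows "A ^ j $ (M * j - s) = (\<Sum>a\<in>compositions s j. fps_const (pprod a))"
proof -
  let ?N = "natpermute (M * j - s) j"
  have sM: "s \<le> M * j" using j s by (metis le_trans mult_le_mono2 mult.right_neutral)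
  have w: "(\<Prod>i<j. A $ (v ! i)) = (if \<forall>x\<in>set v. x < M then fps_const (pprod (map (\<lambda>x. M - x) v)) else 0)" if v: "v \<in> ?N" for v
  proof -
    have l: "length v = j" using v by (simp add: natpermute_def)
    show ?thesis
    proof (cases "\<forall>x\<in>set v. x < M")
      case True
      have "(\<Prod>i<j. A $ (v ! i)) = prod_list (map (\<lambda>x. A $ x) v)"
        by (simp add: prod.list_conv_set_nth lessThan_atLeast0 l)
      also have "\<dots> = fps_const (prod_list (map (\<lambda>x. pvar (M - x)) v))"
        using True by (induction v) (simp_all add: A_def)
      finally show ?thesis using True by (simp add: pprod_def comp_def)
    next
      case False
      then obtain i where "i < j" "\<not> v ! i < M" using l by (auto simp: in_set_conv_nth)
      then have "(\<Prod>i<j. A $ (v ! i)) = 0" by (intro prod_zero) (auto simp: A_def)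
      then show ?thesis by (simp only: False if_False)
    qed
  qed
  have "A ^ j $ (M * j - s) = (\<Sum>v\<in>?N. \<Prod>i<j. A $ (v ! i))"
  proof -
    have "{0..j - 1} = {..<j}" using j by auto
    then show ?thesis using j by (simp add: fps_power_nth)
  qed
  also have "\<dots> = (\<Sum>v\<in>{v \<in> ?N. \<forall>x\<in>set v. x < M}. fps_const (pprod (map (\<lambda>x. M - x) v)))"
    by (subst sum.inter_filter[OF natpermute_finite]) (rule sum.cong[OF refl w])
  also have "\<dots> = (\<Sum>a\<in>compositions s j. fps_const (pprod a))"
  proof (rule sum.reindex_bij_witness[of _ "\<lambda>a. map (\<lambda>x. M - x) a" "\<lambda>v. map (\<lambda>x. M - x) v"])
    fix v assume v: "v \<in> {v \<in> ?N. \<forall>x\<in>set v. x < M}"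
    then have "sum_list (map (\<lambda>x. M - x) v) + sum_list v = M * j" "sum_list v = M * j - s"
      using sum_list_complement[of v M] by (auto simp: natpermute_def less_imp_le)
    then have "sum_list (map (\<lambda>x. M - x) v) = s" using sM by simp
    then show "map (\<lambda>x. M - x) v \<in> compositions s j" using v by (auto simp: compositions_def natpermute_def)
    show "map (\<lambda>x. M - x) (map (\<lambda>x. M - x) v) = v" using v by (auto intro!: map_idI)
  next
    fix a assume a: "a \<in> compositions s j"
    then have aM: "x \<le> M" "x > 0" if "x \<in> set a" for x
      using that member_le_sum_list[of x a] s by (auto simp: compositions_def intro: gr0I)
    have "sum_list (map (\<lambda>x. M - x) a) + sum_list a = M * j" using sum_list_complement[of a M] aM a by (auto simp: compositions_def)
    then have "sum_list (map (\<lambda>x. M - x) a) = M * j - s" using a by (auto simp: compositions_def)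
    moreover have "x < M" if "x \<in> set (map (\<lambda>x. M - x) a)" for x using that aM by fastforce
    ultimately show "map (\<lambda>x. M - x) a \<in> {v \<in> ?N. \<forall>x\<in>set v. x < M}" using a by (auto simp: compositions_def natpermute_def)
    show "map (\<lambda>x. M - x) (map (\<lambda>x. M - x) a) = a" using aM by (auto intro!: map_idI)
  qed simp
  finally show ?thesis .
qed

text \<open>
  The binomial theorem for down steps and up steps. The two extreme terms drop out: without a down step the total
  cannot be \<open>-1\<close>, and \<open>k + 1 \<ge> 2\<close> down steps alone have total at most \<open>-2\<close>.
\<close>

lemma power_nth_compositions:
  fixes G :: "'a::field_char_0 ppoly fps"
  assumes tri: "\<And>i t. t < i \<Longrightarrow> perp i (G $ t) = 0" and M: "n < M" and k: "k \<ge> 1"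
  shows "step_series M G ^ Suc k $ (M * Suc k - 1) $ n = (\<Sum>j = 1..k. of_nat (Suc k choose j) * suminf (pde_inner G j (Suc k - j)) $ n)"
proof -
  define A :: "'a ppoly fps fps" where "A = Abs_fps (\<lambda>v. if v < M then fps_const (pvar (M - v)) else 0)"
  let ?P = "perp_series G"
  have H: "step_series M G = A + fps_X ^ M * ?P"
    by (rule fps_ext) (auto simp: step_series_def A_def fps_X_power_mult_nth perp_series_def)
  have tri': "?P $ i $ t = 0" if "t < i" for i t using tri[OF that] that by (simp add: perp_series_nth)
  have coeff_j: "(A ^ j * (fps_X ^ M * ?P) ^ (Suc k - j)) $ (M * Suc k - 1) $ n =
      (if j = 0 then 0 else \<Sum>l<M. pde_inner G j (Suc k - j) l $ n)" if j: "j \<le> Suc k" for j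
  proof -
    let ?m = "Suc k - j"
    have "A ^ j * (fps_X ^ M * ?P) ^ ?m = fps_X ^ (M * ?m) * (A ^ j * ?P ^ ?m)"
      by (simp add: power_mult_distrib power_mult[symmetric] mult_ac)
    then have e: "(A ^ j * (fps_X ^ M * ?P) ^ ?m) $ (M * Suc k - 1) =
        (if M * Suc k - 1 < M * ?m then 0 else (A ^ j * ?P ^ ?m) $ (M * Suc k - 1 - M * ?m))"
      by (simp only: fps_X_power_mult_nth)
    show ?thesis
    proof (cases "j = 0")
      case True
      have "M * Suc k - 1 < M * ?m" using True M by simp
      then show ?thesis using e True by simp
    next
      case False
      have Mj: "M \<le> M * j" using False by simp
      have split: "M * Suc k = M * ?m + M * j" using j by (metis add_mult_distrib2 le_add_diff_inverse2)
      have nl: "\<not> M * Suc k - 1 < M * ?m" and d: "M * Suc k - 1 - M * ?m = M * j - 1" using split Mj M by linarith+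
      have "(A ^ j * ?P ^ ?m) $ (M * j - 1) = (\<Sum>l=0..M * j - 1. ?P ^ ?m $ l * A ^ j $ (M * j - 1 - l))"
        by (subst mult.commute) (rule fps_mult_nth)
      then have "(A ^ j * ?P ^ ?m) $ (M * j - 1) $ n = (\<Sum>l=0..M * j - 1. (?P ^ ?m $ l * A ^ j $ (M * j - 1 - l)) $ n)"
        by (simp add: fps_sum_nth)
      also have "\<dots> = (\<Sum>l<M. (?P ^ ?m $ l * A ^ j $ (M * j - 1 - l)) $ n)"
      proof (rule sum.mono_neutral_right)
        show "{..<M} \<subseteq> {0..M * j - 1}"
        proof
          fix x assume "x \<in> {..<M}"
          then have "x < M" by simp
          then have "x < M * j" using Mj by (rule less_le_trans)
          then show "x \<in> {0..M * j - 1}" by simp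
        qed
        show "\<forall>l\<in>{0..M * j - 1} - {..<M}. (?P ^ ?m $ l * A ^ j $ (M * j - 1 - l)) $ n = 0"
        proof
          fix l assume "l \<in> {0..M * j - 1} - {..<M}"
          then have "n < l" using M by auto
          then have "?P ^ ?m $ l $ t = 0" if "t \<le> n" for t using that by (intro power_triangular tri') auto
          then show "(?P ^ ?m $ l * A ^ j $ (M * j - 1 - l)) $ n = 0" by (simp add: fps_mult_nth)
        qed
      qed simp
      also have "\<dots> = (\<Sum>l<M. pde_inner G j ?m l $ n)"
      proof (rule sum.cong[OF refl])
        fix l assume l: "l \<in> {..<M}"
        have "M * j - 1 - l = M * j - (l + 1)" by simp
        then have "A ^ j $ (M * j - 1 - l) = (\<Sum>a\<in>compositions (l + 1) j. fps_const (pprod a))"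
          using down_power_nth[of j "l + 1" M, where 'a = 'a] False l unfolding A_def by simp
        then show "(?P ^ ?m $ l * A ^ j $ (M * j - 1 - l)) $ n = pde_inner G j ?m l $ n"
          by (simp add: pde_inner_def sum_distrib_left mult.commute)
      qed
      finally show ?thesis using e nl d False by simp
    qed
  qed
  have inner_sum: "suminf (pde_inner G j m) $ n = (\<Sum>l<M. pde_inner G j m l $ n)" for j m
  proof (rule suminf_pde_inner_nth, intro allI impI pde_inner_nth_0)
    fix l assume "M \<le> l"
    then show "?P ^ m $ l $ n = 0" using M by (intro power_triangular tri') auto
  qed
  have last: "suminf (pde_inner G (Suc k) 0) $ n = 0"
  proof -
    have "pde_inner G (Suc k) 0 l $ n = 0" for l
      using compositions_empty[of "l + 1" "Suc k"] k by (cases l) (simp_all add: pde_inner_def fps_sum_nth)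
    then show ?thesis unfolding inner_sum by simp
  qed
  have "step_series M G ^ Suc k = (\<Sum>j\<le>Suc k. of_nat (Suc k choose j) * A ^ j * (fps_X ^ M * ?P) ^ (Suc k - j))"
    unfolding H by (rule binomial_ring)
  then have "step_series M G ^ Suc k $ (M * Suc k - 1) $ n =
      (\<Sum>j\<le>Suc k. of_nat (Suc k choose j) * (A ^ j * (fps_X ^ M * ?P) ^ (Suc k - j)) $ (M * Suc k - 1) $ n)"
  proof -
    have o: "(of_nat c * F) $ i $ t = of_nat c * F $ i $ t" for c i t and F :: "'a ppoly fps fps"
      by (induction c) (simp_all add: distrib_right)
    show "step_series M G ^ Suc k = (\<Sum>j\<le>Suc k. of_nat (Suc k choose j) * A ^ j * (fps_X ^ M * ?P) ^ (Suc k - j)) \<Longrightarrow> ?thesis"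
      by (simp only: fps_sum_nth mult.assoc o)
  qed
  also have "\<dots> = (\<Sum>j\<le>Suc k. of_nat (Suc k choose j) * (if j = 0 then 0 else suminf (pde_inner G j (Suc k - j)) $ n))"
    by (intro sum.cong refl) (simp only: coeff_j inner_sum atMost_iff)
  also have "\<dots> = (\<Sum>j = 1..k. of_nat (Suc k choose j) * (if j = 0 then 0 else suminf (pde_inner G j (Suc k - j)) $ n))"
  proof (rule sum.mono_neutral_right)
    show "\<forall>j\<in>{..Suc k} - {1..k}. of_nat (Suc k choose j) * (if j = 0 then 0 else suminf (pde_inner G j (Suc k - j)) $ n) = 0"
    proof
      fix j assume "j \<in> {..Suc k} - {1..k}"
      then have "j = 0 \<or> j = Suc k" by auto
      then show "of_nat (Suc k choose j) * (if j = 0 then 0 else suminf (pde_inner G j (Suc k - j)) $ n) = 0"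
        using last by auto
    qed
  qed auto
  also have "\<dots> = (\<Sum>j = 1..k. of_nat (Suc k choose j) * suminf (pde_inner G j (Suc k - j)) $ n)"
    by (intro sum.cong refl) auto
  finally show ?thesis .
qed

lemma pde_term_eq_unmark:
  fixes G :: "'a::field_char_0 ppoly fps"
  assumes tri: "\<And>i t. t < i \<Longrightarrow> perp i (G $ t) = 0" and M: "n < M" and k: "k \<ge> 1"
  shows "pde_term f G k $ n = (fps_const (pconst (f $ k)) * unmark M ((cut_join_lead M G ^^ k) (unit_state 1))) $ n"
proof -
  let ?S = "\<Sum>j = 1..k. of_nat (Suc k choose j) * suminf (pde_inner G j (Suc k - j)) $ n"
  let ?pi = "unmark M ((cut_join_lead M G ^^ k) (unit_state 1))"
  have o: "(of_nat c * F) $ t = of_nat c * F $ t" for c t and F :: "'a ppoly fps"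
    by (induction c) (simp_all add: distrib_right)
  have "?S = of_nat (Suc k) * ?pi $ n"
  proof -
    have "M > 0" using M by simp
    then have "(of_nat (Suc k) * ?pi) $ n = step_series M G ^ Suc k $ (M * Suc k - 1) $ n" by (simp only: unmark_cut_join_lead_power)
    moreover have "?S = step_series M G ^ Suc k $ (M * Suc k - 1) $ n"
      by (rule power_nth_compositions[OF tri M k, symmetric])
    ultimately show ?thesis by (simp only: o)
  qed
  moreover have "pconst (f $ k / of_nat (Suc k)) * of_nat (Suc k) = (pconst (f $ k) :: 'a ppoly)"
    by (simp add: pconst_def single_of_nat[symmetric] mult_single del: of_nat_Suc)
  ultimately have "pconst (f $ k / of_nat (Suc k)) * ?S = pconst (f $ k) * ?pi $ n"
    by (simp only: mult.assoc[symmetric])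
  then show ?thesis unfolding pde_term_def fps_mult_left_const_nth fps_sum_nth o Suc_eq_plus1 .
qed

text \<open>
  The term with \<open>k = 0\<close> of the path sum is the summand \<open>z f\<^sub>0 p\<^sub>1\<close>, and the weighted degree agrees with the
  exponent of \<open>z\<close> on the homogeneous genus zero series.
\<close>

theorem Psi0_hat_satisfies_pde: "pde_lhs f (Psi0_hat f) = pde_rhs (Psi0_hat f)"
proof (rule fps_ext)
  fix n
  let ?G = "Psi0_hat f"
  show "pde_lhs f ?G $ n = pde_rhs ?G $ n"
  proof (cases n)
    case 0
    then show ?thesis by (intro poly_mapping_eqI) (simp add: pde_lhs_nth_0 lookup_pde_rhs Psi0_hat_0)
  next
    case (Suc p)
    \<comment> \<open>Any bound that exceeds \<open>p\<close> gives the same coefficient of \<open>z\<^sup>p\<close>.\<close>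
    let ?M = "Suc p"
    let ?t = "\<lambda>k. (fps_const (pconst (f $ k)) * unmark ?M ((cut_join_lead ?M ?G ^^ k) (unit_state 1))) $ p"
    show ?thesis
    proof (rule poly_mapping_eqI)
      fix m
      obtain K1 where K1: "\<forall>C\<ge>K1. pde_lhs f ?G $ Suc p = (if p = 0 then pconst (f $ 0) * pvar 1 else 0) + (\<Sum>k<C. pde_term f ?G (Suc k) $ p)"
        using pde_lhs_nth_Suc[OF Psi0_hat_0] by blast
      obtain K2 where K2: "\<forall>C\<ge>K2. of_nat (Suc p) * lookup (?G $ Suc p) m = lookup ((\<Sum>k<C. fps_const (pconst (f $ k)) * unmark ?M ((cut_join_lead ?M ?G ^^ k) (unit_state 1))) $ p) m"
        using genus_zero_leading(2)[of p ?M f m] by auto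
      define C where "C = max K1 K2"
      have t0: "?t 0 = (if p = 0 then pconst (f $ 0) * pvar 1 else 0)"
      proof -
        have "unmark ?M (unit_state 1) = (\<Sum>a\<in>{1..?M}. if a = 1 then fps_const (pvar 1) else (0 :: 'a ppoly fps))"
          unfolding unmark_def by (intro sum.cong refl) (simp add: unit_state_def)
        also have "\<dots> = fps_const (pvar 1)" by simp
        finally show ?thesis by simp
      qed
      have "pde_lhs f ?G $ Suc p = ?t 0 + (\<Sum>k<C. ?t (Suc k))"
      proof -
        have tm: "pde_term f ?G (Suc k) $ p = ?t (Suc k)" for k
          by (rule pde_term_eq_unmark[OF Psi0_hat_triangular lessI]) simp_all
        have "pde_lhs f ?G $ Suc p = (if p = 0 then pconst (f $ 0) * pvar 1 else 0) + (\<Sum>k<C. pde_term f ?G (Suc k) $ p)"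
          using K1 by (simp add: C_def)
        then show ?thesis by (simp only: t0 tm)
      qed
      also have "\<dots> = (\<Sum>k<Suc C. ?t k)" by (rule sum.lessThan_Suc_shift[symmetric])
      finally have "lookup (pde_lhs f ?G $ Suc p) m = of_nat (Suc p) * lookup (?G $ Suc p) m"
        using K2[rule_format, of "Suc C"] by (simp only: fps_sum_nth) (simp add: C_def)
      also have "\<dots> = of_nat (weight m) * lookup (?G $ Suc p) m"
      proof (cases "lookup (?G $ Suc p) m = 0")
        case False
        then have "m \<in> keys (?G $ Suc p)" by (simp add: in_keys_iff)
        then obtain \<alpha> where "m = pexp \<alpha>" "0 \<notin> set \<alpha>" "sum_list \<alpha> = Suc p"
          using Psi0_hat_homogeneous[of "Suc p" f] unfolding homogeneous_def by blast
        then show ?thesis by (simp add: weight_pexp)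
      qed simp
      finally show "lookup (pde_lhs f ?G $ n) m = lookup (pde_rhs ?G $ n) m"
        unfolding Suc lookup_pde_rhs .
    qed
  qed
qed

lemma at_p_zero_Psi0_hat: "at_p_zero (Psi0_hat f) = 0"
proof (rule fps_ext)
  fix n
  have "lookup (Psi0_hat f $ n) 0 = 0"
  proof (rule ccontr)
    assume "lookup (Psi0_hat f $ n) 0 \<noteq> 0"
    then have k: "0 \<in> keys (Psi0_hat f $ n)" by (simp add: in_keys_iff)
    then obtain \<alpha> where "0 = pexp \<alpha>" "0 \<notin> set \<alpha>" "sum_list \<alpha> = n"
      using Psi0_hat_homogeneous[of n f] unfolding homogeneous_def by blast
    then have "n = 0" using weight_pexp[of \<alpha>] by (simp add: weight_def)
    then show False using k by (simp add: Psi0_hat_0)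
  qed
  then show "at_p_zero (Psi0_hat f) $ n = 0 $ n" by (simp add: at_p_zero_def pcoeff_def pexp_def)
qed

text \<open>
  The equation determines the coefficients of all monomials of positive weight; the constant monomial has weight 0,
  and its coefficient is fixed by the conditions at \<open>p = 0\<close>.
\<close>

lemma pde_solution_unique:
  fixes G G' :: "'a::field_char_0 ppoly fps"
  assumes "pde_lhs f G = pde_rhs G" "G $ 0 = 0" "at_p_zero G = 0"
    and "pde_lhs f G' = pde_rhs G'" "G' $ 0 = 0" "at_p_zero G' = 0"
  shows "G = G'"
proof (rule fps_ext)
  fix n show "G $ n = G' $ n"
  proof (induction n rule: less_induct)
    case (less n)
    show ?case
    proof (cases n)
      case (Suc p)
      have "pde_lhs f G $ Suc p = pde_lhs f G' $ Suc p"
        by (rule pde_lhs_nth_cong) (use less Suc assms(2) in auto)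
      then have r: "pde_rhs G $ n = pde_rhs G' $ n" using assms(1,4) Suc by simp
      show ?thesis
      proof (rule poly_mapping_eqI)
        fix m
        show "lookup (G $ n) m = lookup (G' $ n) m"
        proof (cases "weight m = 0")
          case True
          have "pcoeff (G $ n) [] = 0" "pcoeff (G' $ n) [] = 0"
            using arg_cong[OF assms(3), of "\<lambda>h. h $ n"] arg_cong[OF assms(6), of "\<lambda>h. h $ n"] by (simp_all add: at_p_zero_def)
          then show ?thesis using weight_eq_0[OF True] by (simp add: pcoeff_def pexp_def)
        next
          case False
          then show ?thesis using arg_cong[OF r, of "\<lambda>P. lookup P m"] by (simp add: lookup_pde_rhs)
        qed
      qed
    qed (use assms in simp)
  qed
qed

theorem theorem7p1:
  fixes f :: "'a::field_char_0 fps" and G :: "'a ppoly fps"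
  shows "(pde_lhs f G = pde_rhs G \<and> G $ 0 = 0 \<and> at_p_zero G = 0) \<longleftrightarrow> G = Psi0_hat f"
proof
  assume "pde_lhs f G = pde_rhs G \<and> G $ 0 = 0 \<and> at_p_zero G = 0"
  then show "G = Psi0_hat f"
    using pde_solution_unique[of f G "Psi0_hat f"] Psi0_hat_satisfies_pde Psi0_hat_0 at_p_zero_Psi0_hat by blast
next
  assume "G = Psi0_hat f"
  then show "pde_lhs f G = pde_rhs G \<and> G $ 0 = 0 \<and> at_p_zero G = 0"
    using Psi0_hat_satisfies_pde Psi0_hat_0 at_p_zero_Psi0_hat by blast
qed

end
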